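(* Let $G$ be a finite group and let $N\unlhd G$ be a normal subgroup. Let $\chi\in\mathrm{Irr}(G)$ and $\psi\in\mathrm{Irr}(N)$ be such that $\psi$ is a constituent of the restriction $\chi{\downarrow}^G_N$, and let $p$ be an odd prime with $p\nmid[G:\mathcal{I}_G(\psi)]$ and $p\nmid e$, where $\mathcal{I}_G(\psi):=\{g\in G\mid {}^g\psi=\psi\}$ is the inertia group of $\psi$ in $G$ and $e$ is the ramification index of $\chi$ in $N$. Assume that Property 1.3 (as defined in the context) holds for $G$, $\chi$ and $p$, and that the $p$-element $g$ for which $p\nmid[\mathbb{Q}_{(f_\chi)_p}:\mathbb{Q}(\chi(g))]$ can be chosen such that $g\in N$. Then Property 1.3 also holds for $N$, $\psi$ and $p$.
   Context: $\mathrm{Irr}(G)$ is the set of irreducible complex characters of $G$. For $g\in G$, ${}^g\psi$ is the conjugate character $x\mapsto\psi(g^{-1}xg)$ of $N$. By Clifford's theorem $\chi{\downarrow}^G_N=e\sum_{g\in G/\mathcal{I}_G(\psi)}{}^g\psi$ for a positive integer $e$, called the ramification index of $\chi$ in $N$. $\mathbb{Q}_n$ denotes the $n$-th cyclotomic field. For a character $\chi$, $\mathbb{Q}(\chi)$ is the field generated over $\mathbb{Q}$ by the values of $\chi$, and its conductor $f_\chi$ is the smallest positive integer $f$ with $\mathbb{Q}(\chi)\subseteq\mathbb{Q}_f$. For a positive integer $n$, $n_p$ is the largest power of $p$ dividing $n$. A $p$-element is an element whose order is a power of $p$ (including the identity). Property 1.3 for a finite group $H$, an odd prime $p$ and $\theta\in\mathrm{Irr}(H)$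 with $p\nmid\theta(1)$: there exists a $p$-element $g\in H$ such that $p$ does not divide $[\mathbb{Q}_{(f_\theta)_p}:\mathbb{Q}(\theta(g))]$ (note that $\mathbb{Q}(\theta(g))\subseteq\mathbb{Q}_{(f_\theta)_p}$ for $p$-elements $g$). If $p\mid\theta(1)$, Property 1.3 makes no statement, i.e. it is regarded as holding vacuously. *)

theory Defs
  imports
    "Jordan_Normal_Form.VS_Connect"
    "HOL-Algebra.Left_Coset"
    "HOL-Algebra.Generated_Fields"
    "HOL-Algebra.Embedded_Algebras"
    Complex_Main
begin

section \<open>Complex characters of finite groups\<close>

definition is_rep :: "('a, 'b) monoid_scheme \<Rightarrow> nat \<Rightarrow> ('a \<Rightarrow> complex mat) \<Rightarrow> bool" where
  "is_rep G n \<rho> \<longleftrightarrow> \<rho> \<in> hom G (units_of (ring_mat TYPE(complex) n ()))"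

definition irreducible_rep :: "('a, 'b) monoid_scheme \<Rightarrow> nat \<Rightarrow> ('a \<Rightarrow> complex mat) \<Rightarrow> bool" where
  "irreducible_rep G n \<rho> \<longleftrightarrow> is_rep G n \<rho> \<and> 0 < n \<and>
     (\<forall>W. VectorSpace.subspace class_ring W (module_vec TYPE(complex) n) \<longrightarrow>
          (\<forall>x\<in>carrier G. \<forall>v\<in>W. \<rho> x *\<^sub>v v \<in> W) \<longrightarrow>
          W = {0\<^sub>v n} \<or> W = carrier_vec n)"

text \<open>
  Characters are restricted to the carrier of the group, so that two characters are equal as
  functions if and only if they agree on the group.
\<close>

definition rep_character ::
    "('a, 'b) monoid_scheme \<Rightarrow> nat \<Rightarrow> ('a \<Rightarrow> complex mat) \<Rightarrow> 'a \<Rightarrow> complex" where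
  "rep_character G n \<rho> = (\<lambda>x\<in>carrier G. \<Sum>i<n. \<rho> x $$ (i, i))"

definition Irr :: "('a, 'b) monoid_scheme \<Rightarrow> ('a \<Rightarrow> complex) set" where
  "Irr G = {rep_character G n \<rho> | n \<rho>. irreducible_rep G n \<rho>}"

definition char_degree :: "('a, 'b) monoid_scheme \<Rightarrow> ('a \<Rightarrow> complex) \<Rightarrow> nat" where
  "char_degree G \<theta> = (THE d. \<theta> \<one>\<^bsub>G\<^esub> = of_nat d)"

text \<open>
  A character \<open>\<psi>\<close> is a constituent of \<open>\<theta>\<close> if \<open>\<theta> - \<psi>\<close> is a character or zero; the
  representation of degree \<open>n = 0\<close> accounts for the case zero.
\<close>

definition constituent ::
    "('a, 'b) monoid_scheme \<Rightarrow> ('a \<Rightarrow> complex) \<Rightarrow> ('a \<Rightarrow> complex) \<Rightarrow> bool" where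
  "constituent H \<psi> \<theta> \<longleftrightarrow>
     (\<exists>n \<rho>. is_rep H n \<rho> \<and> (\<forall>x\<in>carrier H. \<theta> x = \<psi> x + rep_character H n \<rho> x))"


section \<open>Conjugate characters, inertia group and ramification index\<close>

definition conj_char ::
    "('a, 'b) monoid_scheme \<Rightarrow> 'a set \<Rightarrow> 'a \<Rightarrow> ('a \<Rightarrow> complex) \<Rightarrow> 'a \<Rightarrow> complex" where
  "conj_char G N g \<psi> = (\<lambda>x\<in>N. \<psi> (inv\<^bsub>G\<^esub> g \<otimes>\<^bsub>G\<^esub> x \<otimes>\<^bsub>G\<^esub> g))"

definition inertia_group ::
    "('a, 'b) monoid_scheme \<Rightarrow> 'a set \<Rightarrow> ('a \<Rightarrow> complex) \<Rightarrow> 'a set" where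
  "inertia_group G N \<psi> = {g \<in> carrier G. conj_char G N g \<psi> = \<psi>}"

text \<open>
  The conjugate of \<open>\<psi>\<close> by \<open>g\<close> depends only on the left coset of \<open>g\<close> modulo the inertia group,
  so the sum below does not depend on the chosen representatives. Existence of the
  ramification index is Clifford's theorem.
\<close>

definition ramification_index ::
    "('a, 'b) monoid_scheme \<Rightarrow> 'a set \<Rightarrow> ('a \<Rightarrow> complex) \<Rightarrow> ('a \<Rightarrow> complex) \<Rightarrow> nat" where
  "ramification_index G N \<chi> \<psi> =
     (THE e. 0 < e \<and>
        (\<forall>x\<in>N. \<chi> x =
           of_nat e * (\<Sum>C\<in>lcosets\<^bsub>G\<^esub> (inertia_group G N \<psi>). conj_char G N (SOME g. g \<in> C) \<psi> x)))"


section \<open>Fields of values and conductors\<close>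

text \<open>
  All fields are subfields of the field \<open>class_ring\<close> of complex numbers; the field generated by
  a set contains the rationals, being a subfield in characteristic zero.
\<close>

definition rat_adjoin :: "complex set \<Rightarrow> complex set" where
  "rat_adjoin S = generate_field class_ring S"

definition cyclotomic_field :: "nat \<Rightarrow> complex set" where
  "cyclotomic_field n = rat_adjoin {cis (2 * pi / real n)}"

definition field_degree :: "complex set \<Rightarrow> complex set \<Rightarrow> nat" where
  "field_degree L K = ring.dim class_ring K L"

definition char_conductor :: "('a, 'b) monoid_scheme \<Rightarrow> ('a \<Rightarrow> complex) \<Rightarrow> nat" where
  "char_conductor G \<theta> = (LEAST f. 0 < f \<and> rat_adjoin (\<theta> ` carrier G) \<subseteq> cyclotomic_field f)"

definition p_part :: "nat \<Rightarrow> nat \<Rightarrow> nat" where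
  "p_part p n = p ^ multiplicity p n"


section \<open>Realising the p-part of the conductor on a p-element\<close>

definition p_element :: "('a, 'b) monoid_scheme \<Rightarrow> nat \<Rightarrow> 'a \<Rightarrow> bool" where
  "p_element G p g \<longleftrightarrow> g \<in> carrier G \<and> (\<exists>k. group.ord G g = p ^ k)"

definition property_1_3_witness ::
    "('a, 'b) monoid_scheme \<Rightarrow> nat \<Rightarrow> ('a \<Rightarrow> complex) \<Rightarrow> 'a \<Rightarrow> bool" where
  "property_1_3_witness H p \<theta> g \<longleftrightarrow> p_element H p g \<and>
     \<not> p dvd field_degree (cyclotomic_field (p_part p (char_conductor H \<theta>))) (rat_adjoin {\<theta> g})"

definition property_1_3 ::
    "('a, 'b) monoid_scheme \<Rightarrow> nat \<Rightarrow> ('a \<Rightarrow> complex) \<Rightarrow> bool" where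
  "property_1_3 H p \<theta> \<longleftrightarrow>
     (\<not> p dvd char_degree H \<theta> \<longrightarrow> (\<exists>g\<in>carrier H. property_1_3_witness H p \<theta> g))"

end

theory Submission
  imports Defs "Jordan_Normal_Form.Schur_Decomposition" "HOL-Number_Theory.Cong"
begin

text \<open>
  Let \<open>p\<^sup>a\<close> and \<open>p\<^sup>b\<close> be the \<open>p\<close>-parts of the conductors of \<open>\<chi>\<close> and \<open>\<psi>\<close>, and assume that \<open>p\<close> does not divide
  \<open>\<psi>(1)\<close>. By Clifford's theorem (\<open>clifford\<close>) the restriction of \<open>\<chi>\<close> to \<open>N\<close> is \<open>e\<close> times the sum of the
  \<open>G\<close>-conjugates of \<open>\<psi>\<close>. Since \<open>e\<close> and the number of conjugates are prime to \<open>p\<close>, so is \<open>\<chi>(1)\<close>, and there is a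
  \<open>p\<close>-element \<open>g\<close> of \<open>N\<close> at which \<open>\<chi>\<close> realises \<open>p\<^sup>a\<close>.

  If \<open>b \<le> 1\<close>, the degree of the \<open>p\<^sup>b\<close>-th cyclotomic field over the rationals is less than \<open>p\<close>, and the
  identity element is a witness for \<open>\<psi>\<close>. Let \<open>b \<ge> 2\<close>.

  The main point is that \<open>b \<le> a\<close> (\<open>p_exponent_conductor_le\<close>). Suppose that \<open>a < b\<close>. A Galois
  automorphism that fixes the roots of unity of order \<open>p\<^sup>b\<^sup>-\<^sup>1\<close> and those of order prime to \<open>p\<close> fixes \<open>\<chi>\<close>, so
  it permutes the conjugates of \<open>\<psi>\<close> (\<open>galois_conjugate_mem\<close>). On these it has order \<open>1\<close> or \<open>p\<close>, and as their
  number is prime to \<open>p\<close>, it fixes one of them and therefore \<open>\<psi>\<close>. All such automorphisms fixing \<open>\<psi>\<close>, the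
  values of \<open>\<psi>\<close> lie in a cyclotomic field in which \<open>p\<close> has exponent \<open>b - 1\<close>, contrary to the choice of \<open>b\<close>.

  The Galois group of the \<open>p\<^sup>b\<close>-th cyclotomic field is cyclic because \<open>p\<close> is odd. Hence an element \<open>z\<close> of this
  field generates a subfield of index divisible by \<open>p\<close> if and only if \<open>z\<close> lies in the \<open>p\<^sup>b\<^sup>-\<^sup>1\<close>-th cyclotomic
  field (\<open>prime_dvd_field_degree\<close>, \<open>prime_not_dvd_field_degree\<close>). If \<open>\<psi>\<close> took values in the latter at all
  \<open>G\<close>-conjugates of \<open>g\<close>, then \<open>\<chi>(g)\<close> would lie in it too, hence in the \<open>p\<^sup>a\<^sup>-\<^sup>1\<close>-th cyclotomic field,
  contrary to the choice of \<open>g\<close>. So some conjugate of \<open>g\<close> is a witness for \<open>\<psi>\<close>.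

  Two tools are developed for this. The automorphisms of cyclotomic fields are constructed from the
  fact that a root of unity and its coprime powers satisfy the same integer polynomials
  (\<open>int_eval_root_coprime_power\<close>). The character theory rests on Schur's lemma, in the form that
  convolution with a class function multiplies an irreducible character by a scalar
  (\<open>char_conv_Irr_multiple\<close>) and that irreducible characters are orthogonal idempotents for convolution
  up to a factor (\<open>char_conv_self\<close>, \<open>char_conv_distinct\<close>). These identities involve field operations
  only, which is what makes them accessible to Galois automorphisms.
\<close>

section \<open>Integer polynomials at roots of unity\<close>

definition int_eval :: "int poly \<Rightarrow> complex \<Rightarrow> complex" where
  "int_eval P w = poly (map_poly of_int P) w"

lemma int_eval_simps [simp]:
  "int_eval 0 w = 0" "int_eval 1 w = 1"
  "int_eval (P + Q) w = int_eval P w + int_eval Q w"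
  "int_eval (P - Q) w = int_eval P w - int_eval Q w"
  "int_eval (- P) w = - int_eval P w"
  "int_eval (P * Q) w = int_eval P w * int_eval Q w"
  "int_eval (P ^ m) w = int_eval P w ^ m"
  "int_eval (pCons c P) w = of_int c + w * int_eval P w"
  "int_eval (of_int c) w = of_int c"
  "int_eval (of_nat m) w = of_nat m"
  by (simp_all add: int_eval_def hom_distribs of_int_poly_hom.hom_power)

lemma int_eval_monom [simp]: "int_eval (Polynomial.monom c i) w = of_int c * w ^ i"
  by (simp add: int_eval_def poly_monom)

lemma int_eval_altdef: "int_eval P w = (\<Sum>i\<le>degree P. of_int (Polynomial.coeff P i) * w ^ i)"
  unfolding int_eval_def by (subst poly_altdef) (simp add: degree_map_poly coeff_map_poly)

lemma int_eval_pcompose [simp]: "int_eval (pcompose P Q) w = int_eval P (int_eval Q w)"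
  by (induction P) (simp_all add: pcompose_pCons hom_distribs  one_poly_def)

lemma power_mod_root_of_unity:
  fixes w :: complex
  assumes "w ^ n = 1"
  shows "w ^ (m mod n) = w ^ m"
proof -
  have "w ^ m = w ^ (n * (m div n) + m mod n)" by simp
  also have "\<dots> = w ^ (m mod n)" by (simp only: power_add power_mult assms) simp
  finally show ?thesis by simp
qed

text \<open>
  Multiplication by the value \<open>P(w)\<close> maps the family \<open>1, w, \<dots>, w\<^sup>n\<^sup>-\<^sup>1\<close> to integer combinations
  of itself, so \<open>P(w)\<close> is an eigenvalue of an integer matrix and a root of its characteristic
  polynomial, which is monic with integer coefficients.
\<close>

lemma algebraic_int_int_eval_root_of_unity:
  fixes w :: complex
  assumes n: "n > 0" and w: "w ^ n = 1"
  shows "algebraic_int (int_eval P w)"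
proof -
  define A :: "int mat" where "A = mat n n (\<lambda>(i, j). \<Sum>k\<in>{k. k \<le> degree P \<and> (i + k) mod n = j}. Polynomial.coeff P k)"
  have A: "A \<in> carrier_mat n n" by (simp add: A_def)
  define v where "v = vec n (\<lambda>j. w ^ j)"
  note wmod = power_mod_root_of_unity[OF w]
  have ev: "eigenvector (map_mat of_int A) v (int_eval P w)"
    unfolding eigenvector_def
  proof (intro conjI)
    show "v \<in> carrier_vec (dim_row (map_mat of_int A))" by (simp add: A_def v_def)
    have "v $ 0 \<noteq> 0" using n by (simp add: v_def)
    thus "v \<noteq> 0\<^sub>v (dim_row (map_mat of_int A))" using n by (auto simp: A_def)
    show "map_mat of_int A *\<^sub>v v = int_eval P w \<cdot>\<^sub>v v"
    proof (rule eq_vecI)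
      fix i assume "i < dim_vec (int_eval P w \<cdot>\<^sub>v v)"
      hence i: "i < n" by (simp add: v_def)
      have "(map_mat of_int A *\<^sub>v v) $ i = (\<Sum>j<n. of_int (A $$ (i, j)) * w ^ j)"
        using i by (simp add: A_def v_def scalar_prod_def atLeast0LessThan)
      also have "\<dots> = (\<Sum>j<n. \<Sum>k\<in>{k. k \<in> {..degree P} \<and> (i + k) mod n = j}. of_int (Polynomial.coeff P k) * w ^ (i + k))"
      proof (rule sum.cong[OF refl])
        fix j assume "j \<in> {..<n}"
        hence "of_int (A $$ (i, j)) * w ^ j = (\<Sum>k\<in>{k. k \<in> {..degree P} \<and> (i + k) mod n = j}. of_int (Polynomial.coeff P k) * w ^ j)"
          using i by (simp add: A_def sum_distrib_right)
        also have "\<dots> = (\<Sum>k\<in>{k. k \<in> {..degree P} \<and> (i + k) mod n = j}. of_int (Polynomial.coeff P k) * w ^ (i + k))"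
          by (intro sum.cong refl) (metis (mono_tags) mem_Collect_eq wmod)
        finally show "of_int (A $$ (i, j)) * w ^ j = \<dots>" .
      qed
      also have "\<dots> = (\<Sum>k\<le>degree P. of_int (Polynomial.coeff P k) * w ^ (i + k))"
        by (rule sum.group) (use n in auto)
      also have "\<dots> = int_eval P w * w ^ i"
        by (simp add: int_eval_altdef sum_distrib_left sum_distrib_right power_add mult_ac)
      finally show "(map_mat of_int A *\<^sub>v v) $ i = (int_eval P w \<cdot>\<^sub>v v) $ i"
        using i by (simp add: v_def)
    qed (simp add: A_def v_def)
  qed
  hence "eigenvalue (map_mat of_int A) (int_eval P w)"
    by (auto simp: eigenvalue_def)
  hence "poly (char_poly (map_mat of_int A)) (int_eval P w) = 0"
    by (subst (asm) eigenvalue_root_char_poly[of _ n]) (use A in auto)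
  hence "poly (map_poly of_int (char_poly A)) (int_eval P w) = 0"
    by (simp add: of_int_hom.char_poly_hom[OF A])
  moreover have "lead_coeff (char_poly A) = 1"
    using degree_monic_char_poly[OF A] by auto
  ultimately show ?thesis
    by (auto simp: algebraic_int_altdef_ipoly)
qed

text \<open>
  Dividing an integral equation for \<open>a\<close> by the largest possible power of \<open>a\<close> leaves a nonzero
  constant term, which exhibits an integer multiple of the inverse of \<open>a\<close> as a polynomial in \<open>a\<close>.
\<close>

lemma exists_relation_with_nonzero_constant:
  fixes a :: complex
  assumes "P \<noteq> 0" "int_eval P a = 0" "a \<noteq> 0"
  shows "\<exists>c R. c \<noteq> 0 \<and> of_int c + a * int_eval R a = 0"
  using assms
proof (induction P)
  case (pCons c P)
  show ?case
  proof (cases "c = 0")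
    case False
    thus ?thesis using pCons.prems by auto
  next
    case True
    thus ?thesis using pCons by auto
  qed
qed auto

text \<open>
  A nonzero element of \<open>\<int>[w]\<close> divides a nonzero integer within \<open>\<int>[w]\<close>. This gives inverses in
  \<open>\<rat>(w)\<close>, and it shows that only finitely many primes divide a given nonzero element.
\<close>

lemma int_eval_cofactor:
  assumes n: "n > 0" and w: "w ^ n = 1" and nz: "int_eval P w \<noteq> 0"
  shows "\<exists>m Q. m \<noteq> 0 \<and> int_eval P w * int_eval Q w = of_int m"
proof -
  obtain R where R: "poly (map_poly of_int R) (int_eval P w) = 0" "lead_coeff R = 1"
    using algebraic_int_int_eval_root_of_unity[OF n w] by (auto simp: algebraic_int_altdef_ipoly)
  hence "R \<noteq> 0" "int_eval R (int_eval P w) = 0" by (auto simp: int_eval_def)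
  from exists_relation_with_nonzero_constant[OF this nz] obtain c S
    where cS: "c \<noteq> 0" "of_int c + int_eval P w * int_eval S (int_eval P w) = 0" by auto
  have "int_eval P w * int_eval (- pcompose S P) w = of_int c"
    using cS(2) by (simp add: add_eq_0_iff)
  thus ?thesis using cS(1) by blast
qed

lemma prime_dvd_power_add_diff:
  fixes a b :: "'a :: comm_ring_1"
  assumes "prime q"
  shows "of_nat q dvd (a + b) ^ q - a ^ q - b ^ q"
proof -
  have q: "q > 1" using assms prime_gt_1_nat by blast
  have "(a + b) ^ q = (\<Sum>k\<le>q. of_nat (q choose k) * a ^ k * b ^ (q - k))"
    by (rule binomial_ring)
  also have "{..q} = insert 0 (insert q {1..<q})" using q by auto
  also have "(\<Sum>k\<in>insert 0 (insert q {1..<q}). of_nat (q choose k) * a ^ k * b ^ (q - k)) =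
     a ^ q + b ^ q + (\<Sum>k\<in>{1..<q}. of_nat (q choose k) * a ^ k * b ^ (q - k))"
    using q by simp
  finally have "(a + b) ^ q - a ^ q - b ^ q = (\<Sum>k\<in>{1..<q}. of_nat (q choose k) * a ^ k * b ^ (q - k))"
    by simp
  moreover have "of_nat q dvd (\<Sum>k\<in>{1..<q}. of_nat (q choose k) * a ^ k * b ^ (q - k))"
  proof (rule dvd_sum)
    fix k assume k: "k \<in> {1..<q}"
    have "q dvd (q choose k)" by (rule dvd_choose_prime) (use k assms in auto)
    then obtain c where "q choose k = q * c" ..
    thus "of_nat q dvd of_nat (q choose k) * a ^ k * b ^ (q - k)" by (simp add: mult.assoc)
  qed
  ultimately show ?thesis by simp
qed

lemma prime_dvd_int_power_diff:
  assumes "prime q"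
  shows "int q dvd a ^ q - a"
proof -
  have q: "q > 0" using assms prime_gt_0_nat by blast
  have nat: "int q dvd int m ^ q - int m" for m
  proof (induction m)
    case (Suc m)
    have "int q dvd (int m + 1) ^ q - int m ^ q - 1 ^ q"
      using prime_dvd_power_add_diff[OF assms, of "int m" 1] by simp
    hence "int q dvd ((int m + 1) ^ q - int m ^ q - 1 ^ q) + (int m ^ q - int m)"
      using Suc.IH by (rule dvd_add)
    thus ?case by (simp add: algebra_simps)
  qed (use q in \<open>simp add: power_0_left\<close>)
  have "[a ^ q = (a mod int q) ^ q] (mod int q)"
    by (intro cong_pow) (simp add: cong_def)
  also have "[(a mod int q) ^ q = a mod int q] (mod int q)"
    using nat[of "nat (a mod int q)"] q by (simp add: cong_iff_dvd_diff)
  also have "[a mod int q = a] (mod int q)" by (simp add: cong_def)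
  finally show ?thesis by (simp add: cong_iff_dvd_diff)
qed

text \<open>
  The Frobenius congruence \<open>P(w\<^sup>q) \<equiv> P(w)\<^sup>q\<close> modulo \<open>q\<int>[w]\<close>; the quotient is again given by an
  integer polynomial, the same for all \<open>w\<close>.
\<close>

lemma int_eval_prime_power:
  assumes "prime q"
  shows "\<exists>C. \<forall>w. int_eval P (w ^ q) = int_eval P w ^ q + of_nat q * int_eval C w"
proof (induction P)
  case 0
  show ?case by (rule exI[of _ 0]) (use assms prime_gt_0_nat in auto)
next
  case (pCons a P)
  then obtain C where C: "\<And>w. int_eval P (w ^ q) = int_eval P w ^ q + of_nat q * int_eval C w" by blast
  define X where "X = Polynomial.monom (1::int) 1 * P"
  obtain D where D: "([:a:] + X) ^ q - [:a:] ^ q - X ^ q = of_nat q * D"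
    using prime_dvd_power_add_diff[OF assms, of "[:a:]" X] by (elim dvdE)
  obtain c where c: "a ^ q - a = int q * c"
    using prime_dvd_int_power_diff[OF assms, of a] by (elim dvdE)
  show ?case
  proof (intro exI allI)
    fix w :: complex
    have "int_eval (([:a:] + X) ^ q - [:a:] ^ q - X ^ q) w = int_eval (of_nat q * D) w"
      by (simp only: D)
    hence 1: "(of_int a + w * int_eval P w) ^ q = of_int a ^ q + w ^ q * int_eval P w ^ q + of_nat q * int_eval D w"
      by (simp add: X_def power_mult_distrib algebra_simps)
    have "of_int (a ^ q - a) = (of_int (int q * c) :: complex)" by (simp only: c)
    hence 2: "of_int a ^ q = (of_int a + of_nat q * of_int c :: complex)" by (simp add: algebra_simps)
    show "int_eval (pCons a P) (w ^ q) = int_eval (pCons a P) w ^ q +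
            of_nat q * int_eval (Polynomial.monom 1 q * C - D - of_int c) w"
      by (simp add: C 1 2 algebra_simps)
  qed
qed

text \<open>
  If \<open>P(w\<^sup>a) = 0\<close>, then \<open>P(w\<^sup>a\<^sup>q)\<close> is divisible by \<open>q\<close> in \<open>\<int>[w]\<close> by the Frobenius congruence.
  The values \<open>P(w\<^sup>i)\<close> form a finite set, and a nonzero one is divisible by finitely many primes only,
  so for large \<open>q\<close> the value must vanish.
\<close>

lemma int_eval_root_large_prime:
  assumes n: "n > 0" and w: "w ^ n = 1"
  shows "\<exists>B. \<forall>q a. prime q \<longrightarrow> q > B \<longrightarrow> int_eval P (w ^ a) = 0 \<longrightarrow> int_eval P (w ^ (a * q)) = 0"
proof -
  have wn: "(w ^ a) ^ n = 1" for a
    by (metis mult.commute power_mult power_one w)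
  have "\<exists>m Q. m \<noteq> 0 \<and> (int_eval P (w ^ a) \<noteq> 0 \<longrightarrow> int_eval P (w ^ a) * int_eval Q (w ^ a) = of_int m)" for a
    using int_eval_cofactor[OF n wn[of a], of P] by (cases "int_eval P (w ^ a) = 0") (auto intro: exI[of _ 1])
  then obtain m Q where mQ: "\<And>a. m a \<noteq> 0"
      "\<And>a. int_eval P (w ^ a) \<noteq> 0 \<Longrightarrow> int_eval P (w ^ a) * int_eval (Q a) (w ^ a) = of_int (m a)"
    by metis
  \<comment> \<open>The exponents \<open>a < n\<close> represent all powers of \<open>w\<close>.\<close>
  define B where "B = nat (\<Sum>a<n. \<bar>m a\<bar>)"
  have mB: "\<bar>m a\<bar> \<le> int B" if "a < n" for a
    using that unfolding B_def by (auto intro!: member_le_sum sum_nonneg)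
  note wmod = power_mod_root_of_unity[OF w]
  show ?thesis
  proof (intro exI[of _ B] allI impI, rule ccontr)
    fix q a assume q: "prime q" "B < q" and 0: "int_eval P (w ^ a) = 0" and nz: "int_eval P (w ^ (a * q)) \<noteq> 0"
    have q0: "q > 0" using q by auto
    obtain C where C: "\<And>w. int_eval P (w ^ q) = int_eval P w ^ q + of_nat q * int_eval C w"
      using int_eval_prime_power[OF q(1)] by blast
    have eq: "int_eval P (w ^ (a * q)) = of_nat q * int_eval C (w ^ a)"
      using C[of "w ^ a"] 0 q0 by (simp add: power_mult)
    define b where "b = (a * q) mod n"
    have b: "b < n" "w ^ b = w ^ (a * q)" using n by (simp_all add: b_def wmod)
    have m: "of_nat q * int_eval C (w ^ a) * int_eval (Q b) (w ^ (a * q)) = of_int (m b)"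
      using mQ(2)[of b] nz eq b by simp
    define z where "z = int_eval (C * pcompose (Q b) (Polynomial.monom 1 q)) (w ^ a)"
    have z: "of_nat q * z = of_int (m b)"
      using m by (simp add: z_def power_mult mult.assoc)
    have "algebraic_int z"
      unfolding z_def by (rule algebraic_int_int_eval_root_of_unity[OF n wn])
    moreover have "z = of_int (m b) / of_nat q" using z q0 by (simp add: field_simps)
    hence "z \<in> \<rat>" by simp
    ultimately obtain t where t: "z = of_int t"
      using rational_algebraic_int_is_int by (auto elim: Ints_cases)
    have "of_int (int q * t) = (of_int (m b) :: complex)" using z t by simp
    hence "int q * t = m b" by (simp only: of_int_eq_iff)
    hence "int q dvd m b" by (metis dvd_triv_left)
    hence "int q \<le> \<bar>m b\<bar>" using dvd_imp_le_int[OF mQ(1)[of b], of "int q"] by simp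
    thus False using mB[OF b(1)] q(2) by simp
  qed
qed

text \<open>
  Add to \<open>k\<close> the multiple \<open>nM\<close> of \<open>n\<close>, where \<open>M\<close> is the product of the primes up to \<open>B\<close> that do not
  divide \<open>k\<close>: each prime up to \<open>B\<close> divides exactly one of the two summands.
\<close>

lemma exists_cong_large_prime_factors:
  fixes k n B :: nat
  assumes n: "n > 0" and cop: "coprime k n"
  shows "\<exists>k'. k' > 0 \<and> [k' = k] (mod n) \<and> (\<forall>q. prime q \<longrightarrow> q dvd k' \<longrightarrow> q > B)"
proof -
  define S where "S = {q. prime q \<and> q \<le> B \<and> \<not> q dvd k}"
  define M where "M = \<Prod>S"
  have fin: "finite S" unfolding S_def by simp
  have M0: "M > 0" unfolding M_def using fin by (auto simp: S_def prime_gt_0_nat intro!: prod_pos)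
  have "\<not> q dvd k + n * M" if q: "prime q" "q \<le> B" for q
  proof (cases "q dvd k")
    case True
    have "\<not> q dvd n"
      using True cop q(1) not_prime_unit by (meson coprime_common_divisor)
    moreover have "\<not> q dvd M"
    proof
      assume "q dvd M"
      then obtain r where r: "r \<in> S" "q dvd r"
        using prime_dvd_prod_iff[OF fin q(1), of "\<lambda>x. x"] unfolding M_def by auto
      hence "q = r" using q(1) primes_dvd_imp_eq by (auto simp: S_def)
      thus False using r True by (auto simp: S_def)
    qed
    ultimately show ?thesis using True q(1) by (simp add: dvd_add_right_iff prime_dvd_mult_iff)
  next
    case False
    hence "q dvd M" unfolding M_def using fin q by (intro dvd_prodI) (auto simp: S_def)
    thus ?thesis using False by (simp add: dvd_add_left_iff)
  qed
  hence "\<forall>q. prime q \<longrightarrow> q dvd k + n * M \<longrightarrow> q > B" by (meson not_le)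
  moreover have "[k + n * M = k] (mod n)" by (simp add: cong_def)
  moreover have "k + n * M > 0" using n M0 by simp
  ultimately show ?thesis by blast
qed

text \<open>
  This is the irreducibility of the cyclotomic polynomials in the form needed here: a root of unity
  and its coprime powers satisfy the same integer polynomials. The exponent only matters modulo \<open>n\<close>,
  so it may be replaced by one all of whose prime factors are large, and these are handled one at a
  time.
\<close>

lemma int_eval_root_coprime_power:
  assumes n: "n > 0" and w: "w ^ n = 1" and cop: "coprime k n" and root: "int_eval P w = 0"
  shows "int_eval P (w ^ k) = 0"
proof -
  obtain B where B: "\<And>q a. prime q \<Longrightarrow> q > B \<Longrightarrow> int_eval P (w ^ a) = 0 \<Longrightarrow> int_eval P (w ^ (a * q)) = 0"
    using int_eval_root_large_prime[OF n w, of P] by blast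
  obtain k' where k': "k' > 0" "[k' = k] (mod n)" "\<And>q. prime q \<Longrightarrow> q dvd k' \<Longrightarrow> q > B"
    using exists_cong_large_prime_factors[OF n cop] by blast
  have "int_eval P (w ^ l) = 0" if "l > 0" "\<And>q. prime q \<Longrightarrow> q dvd l \<Longrightarrow> q > B" for l
    using that
  proof (induction l rule: prime_divisors_induct)
    case (factor q l)
    hence "int_eval P (w ^ l) = 0" "q > B" by auto
    hence "int_eval P (w ^ (l * q)) = 0" using B factor by auto
    thus ?case by (simp add: mult.commute)
  qed (use root in auto)
  hence "int_eval P (w ^ k') = 0" using k' by blast
  moreover have "w ^ k' = w ^ k"
    using k'(2) power_mod_root_of_unity[OF w] by (metis cong_def)
  ultimately show ?thesis by simp
qed

section \<open>Subfields of the complex numbers and cyclotomic fields\<close>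

text \<open>
  Subfields of the complex numbers, stated with type class operations. Inversion is total with
  \<open>inverse 0 = 0\<close>, so it needs no side condition.
\<close>

locale complex_subfield =
  fixes K :: "complex set"
  assumes one_mem: "1 \<in> K"
    and uminus_mem: "x \<in> K \<Longrightarrow> - x \<in> K"
    and inverse_mem: "x \<in> K \<Longrightarrow> inverse x \<in> K"
    and add_mem: "x \<in> K \<Longrightarrow> y \<in> K \<Longrightarrow> x + y \<in> K"
    and mult_mem: "x \<in> K \<Longrightarrow> y \<in> K \<Longrightarrow> x * y \<in> K"
begin

lemma diff_mem: "x \<in> K \<Longrightarrow> y \<in> K \<Longrightarrow> x - y \<in> K"
  using add_mem[of x "- y"] uminus_mem by simp

lemma zero_mem: "0 \<in> K"
  using diff_mem[OF one_mem one_mem] by simp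

lemma divide_mem: "x \<in> K \<Longrightarrow> y \<in> K \<Longrightarrow> x / y \<in> K"
  using mult_mem inverse_mem by (simp add: divide_inverse)

lemma power_mem: "x \<in> K \<Longrightarrow> x ^ i \<in> K"
  by (induction i) (auto intro: one_mem mult_mem)

lemma sum_mem: "(\<And>i. i \<in> A \<Longrightarrow> f i \<in> K) \<Longrightarrow> sum f A \<in> K"
  by (induction A rule: infinite_finite_induct) (auto intro: zero_mem add_mem)

lemma of_nat_mem: "of_nat i \<in> K"
  by (induction i) (auto intro: zero_mem one_mem add_mem)

lemma of_int_mem: "of_int i \<in> K"
  by (cases i rule: int_diff_cases) (auto intro: diff_mem of_nat_mem)

lemma int_eval_mem: "x \<in> K \<Longrightarrow> int_eval P x \<in> K"
  by (auto simp: int_eval_altdef intro!: sum_mem mult_mem of_int_mem power_mem)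

lemma subfield_class_ring: "subfield K class_ring"
proof (rule field.subfieldI'[OF class_field])
  show "subring K class_ring"
    by (rule ring.subringI[OF class_ring.ring_axioms]) (auto simp: class_ring_simps intro: one_mem uminus_mem add_mem mult_mem)
  show "inv\<^bsub>class_ring\<^esub> k \<in> K" if "k \<in> K - {\<zero>\<^bsub>class_ring\<^esub>}" for k
    using that inverse_mem by (simp add: class_ring_simps)
qed

end

lemma rat_adjoin_subfield: "complex_subfield (rat_adjoin S)"
proof
  fix x assume x: "x \<in> rat_adjoin S"
  show "inverse x \<in> rat_adjoin S"
  proof (cases "x = 0")
    case False
    thus ?thesis using generate_field.m_inv[of x class_ring S] x
      by (simp add: rat_adjoin_def class_ring_simps)
  qed (use x in auto)
qed (use generate_field.one[of "class_ring :: complex ring"] generate_field.eng_add[of _ "class_ring :: complex ring"]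
      generate_field.eng_mult[of _ "class_ring :: complex ring"] generate_field.a_inv[of _ "class_ring :: complex ring"]
     in \<open>simp_all add: rat_adjoin_def class_ring_simps\<close>)

lemma rat_adjoin_incl: "x \<in> S \<Longrightarrow> x \<in> rat_adjoin S"
  unfolding rat_adjoin_def by (rule generate_field.incl)

lemma rat_adjoin_minimal:
  assumes "complex_subfield K" "S \<subseteq> K"
  shows "rat_adjoin S \<subseteq> K"
  unfolding rat_adjoin_def
  by (rule field.generate_field_min_subfield1[OF class_field]) (use assms complex_subfield.subfield_class_ring in auto)

definition zeta :: "nat \<Rightarrow> complex" where
  "zeta n = cis (2 * pi / real n)"

lemma zeta_power_self: "n > 0 \<Longrightarrow> zeta n ^ n = 1"
  by (simp add: zeta_def DeMoivre)

lemma zeta_mult_power: "d > 0 \<Longrightarrow> zeta (d * r) ^ r = zeta d" if "r > 0"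
  using that by (simp add: zeta_def DeMoivre field_simps)

lemma zeta_power_mod: "n > 0 \<Longrightarrow> zeta n ^ (i mod n) = zeta n ^ i"
  by (rule power_mod_root_of_unity[OF zeta_power_self])

lemma zeta_power_eq_1_iff:
  assumes "n > 0"
  shows "zeta n ^ i = 1 \<longleftrightarrow> n dvd i"
proof -
  have inj: "inj_on (\<lambda>k. zeta n ^ k) {..<n}"
    using bij_betw_roots_unity[OF assms] by (simp add: bij_betw_def zeta_def DeMoivre mult_ac)
  have "zeta n ^ i = 1 \<longleftrightarrow> zeta n ^ (i mod n) = zeta n ^ 0"
    by (simp add: zeta_power_mod[OF assms])
  also have "\<dots> \<longleftrightarrow> i mod n = 0"
    using assms by (intro inj_on_eq_iff[OF inj]) auto
  finally show ?thesis by (simp add: mod_eq_0_iff_dvd)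
qed

lemma sum_powers_zeta:
  assumes "r > 0"
  shows "(\<Sum>t<r. (zeta r ^ i) ^ t) = (if r dvd i then of_nat r else 0)"
proof (cases "r dvd i")
  case True
  thus ?thesis using zeta_power_eq_1_iff[OF assms, of i] by simp
next
  case False
  hence "zeta r ^ i \<noteq> 1" using zeta_power_eq_1_iff[OF assms] by simp
  moreover have "(zeta r ^ i) ^ r = 1"
    by (metis assms mult.commute power_mult power_one zeta_power_self)
  ultimately show ?thesis using False by (simp add: geometric_sum)
qed

lemma zeta_mem: "zeta n \<in> cyclotomic_field n"
  unfolding cyclotomic_field_def zeta_def by (rule rat_adjoin_incl) simp

lemma cyclotomic_field_subfield: "complex_subfield (cyclotomic_field n)"
  unfolding cyclotomic_field_def by (rule rat_adjoin_subfield)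

text \<open>
  Closure under inverses is the point: an inverse is a cofactor divided by an integer.
\<close>

lemma complex_subfield_int_eval_quotients:
  assumes n: "n > 0" and w: "w ^ n = 1"
  shows "complex_subfield {int_eval P w / of_int d | P d. d \<noteq> 0}" (is "complex_subfield ?K")
proof
  have memI: "x \<in> ?K" if "x = int_eval P w / of_int d" "d \<noteq> 0" for x P d
    using that by blast
  show "1 \<in> ?K" by (rule memI[of _ 1 1]) simp_all
  fix x assume "x \<in> ?K"
  then obtain P d where x: "x = int_eval P w / of_int d" "d \<noteq> 0" by blast
  show "- x \<in> ?K" by (rule memI[of _ "- P" d]) (use x in simp_all)
  show "inverse x \<in> ?K"
  proof (cases "int_eval P w = 0")
    case True
    show ?thesis by (rule memI[of _ 0 1]) (use True x in simp_all)
  next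
    case False
    obtain m Q where mQ: "m \<noteq> 0" "int_eval P w * int_eval Q w = of_int m"
      using int_eval_cofactor[OF n w False] by blast
    have "int_eval Q w \<noteq> 0" using mQ by auto
    hence "inverse x = int_eval (of_int d * Q) w / of_int m"
      using x False by (simp add: mQ(2)[symmetric])
    thus ?thesis by (rule memI[OF _ mQ(1)])
  qed
  fix y assume "y \<in> ?K"
  then obtain Q e where y: "y = int_eval Q w / of_int e" "e \<noteq> 0" by blast
  show "x + y \<in> ?K"
    by (rule memI[of _ "of_int e * P + of_int d * Q" "d * e"]) (use x y in \<open>simp_all add: add_frac_eq mult.commute\<close>)
  show "x * y \<in> ?K"
    by (rule memI[of _ "P * Q" "d * e"]) (use x y in simp_all)
qed

lemma cyclotomic_field_eq:
  assumes "n > 0"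
  shows "cyclotomic_field n = {int_eval P (zeta n) / of_int d | P d. d \<noteq> 0}" (is "_ = ?K")
proof
  interpret C: complex_subfield "cyclotomic_field n" by (rule cyclotomic_field_subfield)
  have "zeta n \<in> ?K"
    by (rule CollectI, intro exI[of _ "Polynomial.monom 1 1"] exI[of _ 1]) simp
  thus "cyclotomic_field n \<subseteq> ?K"
    unfolding cyclotomic_field_def zeta_def[symmetric]
    using complex_subfield_int_eval_quotients[OF assms zeta_power_self[OF assms]]
    by (intro rat_adjoin_minimal) auto
  show "?K \<subseteq> cyclotomic_field n"
    by (auto intro!: C.divide_mem C.int_eval_mem C.of_int_mem zeta_mem)
qed

lemma cyclotomic_field_mono:
  assumes "d dvd n" "n > 0"
  shows "cyclotomic_field d \<subseteq> cyclotomic_field n"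
proof -
  interpret C: complex_subfield "cyclotomic_field n" by (rule cyclotomic_field_subfield)
  obtain r where r: "n = d * r" using assms(1) ..
  have "zeta d = zeta n ^ r" using zeta_mult_power[of r d] assms(2) r by auto
  hence "zeta d \<in> cyclotomic_field n" by (simp add: C.power_mem zeta_mem)
  thus ?thesis unfolding cyclotomic_field_def zeta_def[symmetric]
    by (intro rat_adjoin_minimal rat_adjoin_subfield) auto
qed

section \<open>The Galois action on cyclotomic fields\<close>

text \<open>
  The automorphism of the \<open>n\<close>-th cyclotomic field that raises roots of unity to the \<open>k\<close>-th power.
  It substitutes \<open>\<zeta>\<^sup>k\<close> for \<open>\<zeta>\<close> in any representation of \<open>y\<close> as a rational polynomial in \<open>\<zeta>\<close>; lemma
  \<open>gal_eq\<close> shows that the choice of the representation does not matter when \<open>k\<close> is coprime to \<open>n\<close>.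
\<close>

definition gal :: "nat \<Rightarrow> nat \<Rightarrow> complex \<Rightarrow> complex" where
  "gal n k y = (SOME z. \<exists>P d. d \<noteq> 0 \<and> y = int_eval P (zeta n) / of_int d \<and> z = int_eval P (zeta n ^ k) / of_int d)"

context
  fixes n k :: nat
  assumes n: "n > 0" and cop: "coprime k n"
begin

lemma gal_eq:
  assumes "d \<noteq> 0"
  shows "gal n k (int_eval P (zeta n) / of_int d) = int_eval P (zeta n ^ k) / of_int d" (is "gal n k ?y = _")
proof -
  have "\<exists>P' e. e \<noteq> 0 \<and> ?y = int_eval P' (zeta n) / of_int e \<and> gal n k ?y = int_eval P' (zeta n ^ k) / of_int e"
    unfolding gal_def by (rule someI_ex) (use assms in blast)
  then obtain P' e where e: "e \<noteq> 0" "?y = int_eval P' (zeta n) / of_int e"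
      "gal n k ?y = int_eval P' (zeta n ^ k) / of_int e" by blast
  have "int_eval (of_int e * P - of_int d * P') (zeta n) = 0"
    using e(1,2) assms by (simp add: field_simps)
  hence "int_eval (of_int e * P - of_int d * P') (zeta n ^ k) = 0"
    by (rule int_eval_root_coprime_power[OF n zeta_power_self[OF n] cop])
  hence "of_int e * int_eval P (zeta n ^ k) = of_int d * int_eval P' (zeta n ^ k)" by simp
  thus ?thesis unfolding e(3) using e(1) assms by (simp add: frac_eq_eq mult.commute)
qed

lemma gal_eqI:
  assumes "y = int_eval P (zeta n) / of_int d" "d \<noteq> 0"
  shows "gal n k y = int_eval P (zeta n ^ k) / of_int d"
  unfolding assms(1) by (rule gal_eq[OF assms(2)])

lemma gal_add:
  assumes "x \<in> cyclotomic_field n" "y \<in> cyclotomic_field n"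
  shows "gal n k (x + y) = gal n k x + gal n k y"
proof -
  obtain P d Q e where x: "x = int_eval P (zeta n) / of_int d" "d \<noteq> 0"
    and y: "y = int_eval Q (zeta n) / of_int e" "e \<noteq> 0"
    using assms by (auto simp: cyclotomic_field_eq[OF n])
  have "x + y = int_eval (of_int e * P + of_int d * Q) (zeta n) / of_int (d * e)"
    using x y by (simp add: field_simps)
  hence "gal n k (x + y) = int_eval (of_int e * P + of_int d * Q) (zeta n ^ k) / of_int (d * e)"
    by (rule gal_eqI) (use x(2) y(2) in simp)
  also have "\<dots> = int_eval P (zeta n ^ k) / of_int d + int_eval Q (zeta n ^ k) / of_int e"
    using x(2) y(2) by (simp add: field_simps)
  finally show ?thesis using x y by (simp add: gal_eq)
qed

lemma gal_mult:
  assumes "x \<in> cyclotomic_field n" "y \<in> cyclotomic_field n"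
  shows "gal n k (x * y) = gal n k x * gal n k y"
proof -
  obtain P d Q e where x: "x = int_eval P (zeta n) / of_int d" "d \<noteq> 0"
    and y: "y = int_eval Q (zeta n) / of_int e" "e \<noteq> 0"
    using assms by (auto simp: cyclotomic_field_eq[OF n])
  have "x * y = int_eval (P * Q) (zeta n) / of_int (d * e)"
    using x y by simp
  hence "gal n k (x * y) = int_eval (P * Q) (zeta n ^ k) / of_int (d * e)"
    by (rule gal_eqI) (use x(2) y(2) in simp)
  also have "\<dots> = int_eval P (zeta n ^ k) / of_int d * (int_eval Q (zeta n ^ k) / of_int e)"
    using x(2) y(2) by simp
  finally show ?thesis using x y by (simp add: gal_eq)
qed

lemma gal_of_int_divide: "gal n k (of_int a / of_int b) = of_int a / of_int b"
proof (cases "b = 0")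
  case False
  thus ?thesis using gal_eq[of b "of_int a"] by simp
next
  case True
  thus ?thesis using gal_eq[of 1 0] by simp
qed

lemma gal_of_int: "gal n k (of_int a) = of_int a"
  using gal_of_int_divide[of a 1] by simp

lemma gal_of_nat_divide: "gal n k (of_nat a / of_nat b) = of_nat a / of_nat b"
  using gal_of_int_divide[of "int a" "int b"] by simp

lemma gal_0: "gal n k 0 = 0" and gal_1: "gal n k 1 = 1"
  using gal_of_int[of 0] gal_of_int[of 1] by simp_all

lemma gal_sum:
  assumes "\<And>i. i \<in> A \<Longrightarrow> f i \<in> cyclotomic_field n"
  shows "gal n k (\<Sum>i\<in>A. f i) = (\<Sum>i\<in>A. gal n k (f i))"
proof -
  interpret C: complex_subfield "cyclotomic_field n" by (rule cyclotomic_field_subfield)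
  show ?thesis using assms
    by (induction A rule: infinite_finite_induct) (simp_all add: gal_0 gal_add C.sum_mem)
qed

lemma gal_power:
  assumes "x \<in> cyclotomic_field n"
  shows "gal n k (x ^ i) = gal n k x ^ i"
proof -
  interpret C: complex_subfield "cyclotomic_field n" by (rule cyclotomic_field_subfield)
  show ?thesis by (induction i) (simp_all add: gal_1 gal_mult C.power_mem assms)
qed

lemma gal_zeta_power: "gal n k (zeta n ^ i) = zeta n ^ (i * k)"
  using gal_eq[of 1 "Polynomial.monom 1 i"] by (simp add: power_mult[symmetric] mult.commute)

lemma gal_divisor:
  assumes "d dvd n" "y = int_eval P (zeta d) / of_int e" "e \<noteq> 0"
  shows "gal n k y = int_eval P (zeta d ^ k) / of_int e"
proof -
  obtain r where r: "n = d * r" using assms(1) ..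
  have z: "zeta d = zeta n ^ r" using zeta_mult_power[of r d] n r by auto
  have "y = int_eval (pcompose P (Polynomial.monom 1 r)) (zeta n) / of_int e" using assms(2) z by simp
  hence "gal n k y = int_eval (pcompose P (Polynomial.monom 1 r)) (zeta n ^ k) / of_int e"
    using assms(3) by (rule gal_eqI)
  thus ?thesis by (simp add: z power_mult[symmetric] mult.commute)
qed

lemma gal_fix:
  assumes "d dvd n" "[k = 1] (mod d)" "y \<in> cyclotomic_field d"
  shows "gal n k y = y"
proof -
  have d: "d > 0" using assms(1) n by (auto intro: Nat.gr0I)
  obtain P e where P: "e \<noteq> 0" "y = int_eval P (zeta d) / of_int e"
    using assms(3) by (auto simp: cyclotomic_field_eq[OF d])
  have "zeta d ^ k = zeta d ^ 1" using assms(2) zeta_power_mod[OF d] by (metis cong_def)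
  thus ?thesis using gal_divisor[OF assms(1) P(2,1)] P by simp
qed

end

lemma gal_gal:
  assumes n: "n > 0" and k: "coprime k n" and l: "coprime l n" and y: "y \<in> cyclotomic_field n"
  shows "gal n k (gal n l y) = gal n (k * l) y"
proof -
  obtain P e where P: "e \<noteq> 0" "y = int_eval P (zeta n) / of_int e"
    using y by (auto simp: cyclotomic_field_eq[OF n])
  have "gal n l y = int_eval P (zeta n ^ l) / of_int e" using P gal_eq[OF n l] by simp
  also have "\<dots> = int_eval (pcompose P (Polynomial.monom 1 l)) (zeta n) / of_int e" by simp
  finally have "gal n k (gal n l y) = int_eval (pcompose P (Polynomial.monom 1 l)) (zeta n ^ k) / of_int e"
    using P(1) by (rule gal_eqI[OF n k])
  thus ?thesis using P gal_eq[OF n _ P(1), of "k * l" P] k l by (simp add: power_mult)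
qed

text \<open>
  The part of Galois theory that is used to recognise elements of a smaller cyclotomic field. Write
  \<open>y = \<Sum> c\<^sub>i \<zeta>\<^sup>i\<close> with \<open>\<zeta>\<close> of order \<open>dr\<close>. The automorphisms in question multiply \<open>\<zeta>\<^sup>i\<close> by the powers of
  an \<open>r\<close>-th root of unity, and averaging over them kills every term whose exponent \<open>i\<close> is not
  divisible by \<open>r\<close>; the others belong to the smaller field. The exponents \<open>j\<close> are only prescribed
  modulo \<open>dr\<close>, and the automorphisms act on a larger cyclotomic field, because they will be chosen with
  additional properties by the Chinese remainder theorem.
\<close>

lemma cyclotomic_field_descent:
  assumes n: "n > 0" and dr: "d * r dvd n" and y: "y \<in> cyclotomic_field (d * r)"
    and fix_ex: "\<And>t. t < r \<Longrightarrow> \<exists>j. [j = 1 + t * d] (mod (d * r)) \<and> coprime j n \<and> gal n j y = y"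
  shows "y \<in> cyclotomic_field d"
proof -
  have d0: "d > 0" and r0: "r > 0" and dr0: "d * r > 0" using n dr by (auto intro!: Nat.gr0I)
  interpret C: complex_subfield "cyclotomic_field d" by (rule cyclotomic_field_subfield)
  obtain P e where P: "e \<noteq> 0" "y = int_eval P (zeta (d * r)) / of_int e"
    using y by (auto simp: cyclotomic_field_eq[OF dr0])
  let ?z = "zeta (d * r)"
  have zd: "?z ^ d = zeta r" using zeta_mult_power[of d r] d0 r0 by (simp add: mult.commute)
  have eq: "of_int e * y = (\<Sum>i\<le>degree P. of_int (Polynomial.coeff P i) * ?z ^ i * (zeta r ^ i) ^ t)" if t: "t < r" for t
  proof -
    obtain j where j: "[j = 1 + t * d] (mod (d * r))" "coprime j n" "gal n j y = y"
      using fix_ex[OF t] by blast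
    have "y = int_eval P (?z ^ j) / of_int e"
      using gal_divisor[OF n j(2) dr P(2,1)] j(3) by simp
    also have "?z ^ j = ?z ^ (1 + t * d)"
      using j(1) zeta_power_mod[OF dr0] by (metis cong_def)
    also have "\<dots> = ?z * zeta r ^ t"
      by (simp add: power_add power_mult zd mult.commute[of t d])
    finally have "of_int e * y = int_eval P (?z * zeta r ^ t)" using P(1) by simp
    thus ?thesis
      by (simp add: int_eval_altdef power_mult_distrib power_mult[symmetric] mult_ac)
  qed
  have "of_nat r * (of_int e * y) = (\<Sum>t<r. of_int e * y)" by simp
  also have "\<dots> = (\<Sum>t<r. \<Sum>i\<le>degree P. of_int (Polynomial.coeff P i) * ?z ^ i * (zeta r ^ i) ^ t)"
    by (intro sum.cong refl eq) auto
  also have "\<dots> = (\<Sum>i\<le>degree P. of_int (Polynomial.coeff P i) * ?z ^ i * (\<Sum>t<r. (zeta r ^ i) ^ t))"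
    by (subst sum.swap) (simp add: sum_distrib_left)
  also have "\<dots> \<in> cyclotomic_field d"
  proof (rule C.sum_mem)
    fix i
    have "?z ^ i \<in> cyclotomic_field d" if "r dvd i"
    proof -
      obtain i' where "i = r * i'" using \<open>r dvd i\<close> by (rule dvdE)
      hence "?z ^ i = zeta d ^ i'" using zeta_mult_power[OF r0 d0] by (simp add: power_mult)
      thus ?thesis by (simp add: C.power_mem zeta_mem)
    qed
    thus "of_int (Polynomial.coeff P i) * ?z ^ i * (\<Sum>t<r. (zeta r ^ i) ^ t) \<in> cyclotomic_field d"
      by (auto simp: sum_powers_zeta[OF r0] intro!: C.mult_mem C.of_int_mem C.of_nat_mem C.zero_mem)
  qed
  finally have "of_nat r * (of_int e * y) \<in> cyclotomic_field d" .
  hence "of_nat r * (of_int e * y) / (of_nat r * of_int e) \<in> cyclotomic_field d"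
    by (intro C.divide_mem) (auto intro: C.mult_mem C.of_int_mem C.of_nat_mem)
  thus ?thesis using r0 P(1) by simp
qed

section \<open>Dimensions over subfields of the complex numbers\<close>

text \<open>
  Linear combinations and linear independence of the finite family \<open>e\<^sub>0, \<dots>, e\<^sub>m\<^sub>-\<^sub>1\<close>, in terms of sums
  rather than lists of coefficients.
\<close>

definition span_over :: "complex set \<Rightarrow> nat \<Rightarrow> (nat \<Rightarrow> complex) \<Rightarrow> complex set" where
  "span_over K m e = {\<Sum>i<m. c i * e i | c. \<forall>i<m. c i \<in> K}"

definition indep_over :: "complex set \<Rightarrow> nat \<Rightarrow> (nat \<Rightarrow> complex) \<Rightarrow> bool" where
  "indep_over K m e \<longleftrightarrow> (\<forall>c. (\<forall>i<m. c i \<in> K) \<longrightarrow> (\<Sum>i<m. c i * e i) = 0 \<longrightarrow> (\<forall>i<m. c i = 0))"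

lemma combine_class_ring:
  "ring.combine class_ring Ks Us = (\<Sum>i<min (length Us) (length Ks). Ks ! i * (Us ! i :: complex))"
proof (induction Ks arbitrary: Us)
  case Nil
  show ?case by (simp add: ring.combine.simps[OF class_ring.ring_axioms] class_ring_simps)
next
  case (Cons k Ks)
  show ?case
  proof (cases Us)
    case Nil
    thus ?thesis by (simp add: ring.combine.simps[OF class_ring.ring_axioms] class_ring_simps)
  next
    case (Cons u Us')
    thus ?thesis using Cons.IH[of Us']
      by (simp add: ring.combine.simps[OF class_ring.ring_axioms] class_ring_simps sum.lessThan_Suc_shift
         del: sum.lessThan_Suc)
  qed
qed

lemma Span_class_ring_eq:
  assumes "complex_subfield K"
  shows "ring.Span class_ring K (map e [0..<m]) = span_over K m e"
proof -
  note R = class_ring.ring_axioms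
  note K = complex_subfield.subfield_class_ring[OF assms]
  have "a \<in> ring.Span class_ring K (map e [0..<m]) \<longleftrightarrow> a \<in> span_over K m e" for a
  proof -
    have "a \<in> ring.Span class_ring K (map e [0..<m]) \<longleftrightarrow>
        (\<exists>Ks. set Ks \<subseteq> K \<and> length Ks = m \<and> a = ring.combine class_ring Ks (map e [0..<m]))"
      using ring.Span_mem_iff_length_version[OF R K, of "map e [0..<m]" a] by simp
    also have "\<dots> \<longleftrightarrow> (\<exists>Ks. set Ks \<subseteq> K \<and> length Ks = m \<and> a = (\<Sum>i<m. Ks ! i * e i))"
      by (intro ex_cong1 conj_cong refl) (auto simp: combine_class_ring)
    also have "\<dots> \<longleftrightarrow> a \<in> span_over K m e"
    proof
      assume "\<exists>Ks. set Ks \<subseteq> K \<and> length Ks = m \<and> a = (\<Sum>i<m. Ks ! i * e i)"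
      then obtain Ks where Ks: "set Ks \<subseteq> K" "length Ks = m" "a = (\<Sum>i<m. Ks ! i * e i)" by blast
      thus "a \<in> span_over K m e" unfolding span_over_def
        by (intro CollectI exI[of _ "\<lambda>i. Ks ! i"]) auto
    next
      assume "a \<in> span_over K m e"
      then obtain c where c: "\<forall>i<m. c i \<in> K" "a = (\<Sum>i<m. c i * e i)" unfolding span_over_def by blast
      thus "\<exists>Ks. set Ks \<subseteq> K \<and> length Ks = m \<and> a = (\<Sum>i<m. Ks ! i * e i)"
        by (intro exI[of _ "map c [0..<m]"]) auto
    qed
    finally show ?thesis .
  qed
  thus ?thesis by blast
qed

lemma independent_class_ring:
  assumes "complex_subfield K" "indep_over K m e"
  shows "ring.independent class_ring K (map e [0..<m])"
proof (rule ring.trivial_combine_imp_independent[OF class_ring.ring_axioms])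
  interpret K: complex_subfield K by fact
  show "subfield K class_ring" by (rule K.subfield_class_ring)
  show "set (map e [0..<m]) \<subseteq> carrier class_ring" by simp
  fix Ks :: "complex list"
  assume Ks: "set Ks \<subseteq> K" and 0: "ring.combine class_ring Ks (map e [0..<m]) = \<zero>\<^bsub>class_ring\<^esub>"
  define c where "c = (\<lambda>i. if i < length Ks then Ks ! i else 0)"
  have cK: "\<forall>i. c i \<in> K" using Ks K.zero_mem by (auto simp: c_def)
  let ?r = "min m (length Ks)"
  have "ring.combine class_ring Ks (map e [0..<m]) = (\<Sum>i<?r. Ks ! i * e i)"
    by (subst combine_class_ring) (auto intro!: sum.cong)
  also have "\<dots> = (\<Sum>i<m. c i * e i)"
    by (rule sum.mono_neutral_cong_left) (auto simp: c_def)
  finally have "(\<Sum>i<m. c i * e i) = 0" using 0 by simp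
  hence "\<forall>i<m. c i = 0" using assms(2) cK unfolding indep_over_def by blast
  thus "set (take (length (map e [0..<m])) Ks) \<subseteq> {\<zero>\<^bsub>class_ring\<^esub>}"
    by (auto simp: c_def in_set_conv_nth) (metis)
qed

context complex_subfield
begin

lemma span_over_add:
  assumes "x \<in> span_over K m e" "y \<in> span_over K m e"
  shows "x + y \<in> span_over K m e"
proof -
  obtain c d where "\<forall>i<m. c i \<in> K" "x = (\<Sum>i<m. c i * e i)" "\<forall>i<m. d i \<in> K" "y = (\<Sum>i<m. d i * e i)"
    using assms unfolding span_over_def by blast
  thus ?thesis unfolding span_over_def
    by (intro CollectI exI[of _ "\<lambda>i. c i + d i"]) (auto simp: sum.distrib algebra_simps intro: add_mem)
qed

lemma span_over_scale:
  assumes "a \<in> K" "x \<in> span_over K m e"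
  shows "a * x \<in> span_over K m e"
proof -
  obtain c where "\<forall>i<m. c i \<in> K" "x = (\<Sum>i<m. c i * e i)"
    using assms unfolding span_over_def by blast
  thus ?thesis unfolding span_over_def using assms(1)
    by (intro CollectI exI[of _ "\<lambda>i. a * c i"]) (auto simp: sum_distrib_left mult.assoc intro: mult_mem)
qed

lemma span_over_base:
  assumes "i < m"
  shows "e i \<in> span_over K m e"
  unfolding span_over_def using assms
  by (intro CollectI exI[of _ "\<lambda>j. if j = i then 1 else 0"]) 
     (auto simp: if_distrib[of "\<lambda>x. x * _"] cong: if_cong intro: one_mem zero_mem)

lemma span_over_zero: "0 \<in> span_over K m e"
  unfolding span_over_def by (intro CollectI exI[of _ "\<lambda>j. 0"]) (auto intro: zero_mem)

lemma span_over_sum: "(\<And>i. i \<in> A \<Longrightarrow> f i \<in> span_over K m e) \<Longrightarrow> sum f A \<in> span_over K m e"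
  by (induction A rule: infinite_finite_induct) (auto intro: span_over_zero span_over_add)

lemma span_over_subset_subfield:
  assumes "complex_subfield L" "K \<subseteq> L" "\<And>i. i < m \<Longrightarrow> e i \<in> L"
  shows "span_over K m e \<subseteq> L"
proof -
  interpret L: complex_subfield L by fact
  show ?thesis unfolding span_over_def using assms(2,3) by (auto intro!: L.sum_mem L.mult_mem)
qed

lemma finite_dimension_span_over: "ring.finite_dimension class_ring K (span_over K m e)"
  using ring.Span_finite_dimension[OF class_ring.ring_axioms subfield_class_ring, of "map e [0..<m]"]
    Span_class_ring_eq[OF complex_subfield_axioms, of e m] by simp

lemma dimension_field_degree_span_over:
  assumes "L = span_over K m e"
  shows "ring.dimension class_ring (field_degree L K) K L"
  using ring.finite_dimensionE[OF class_ring.ring_axioms subfield_class_ring finite_dimension_span_over] assms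
  by (simp add: field_degree_def over_def)

lemma field_degree_le_span_over:
  assumes "L = span_over K m e" "1 \<in> L"
  shows "field_degree L K \<le> m" "field_degree L K > 0"
proof -
  note R = class_ring.ring_axioms
  note K = subfield_class_ring
  have S: "ring.Span class_ring K (map e [0..<m]) = L"
    using Span_class_ring_eq[OF complex_subfield_axioms] assms(1) by simp
  have dim: "ring.dimension class_ring (field_degree L K) K L"
    by (rule dimension_field_degree_span_over[OF assms(1)])
  \<comment> \<open>The list \<open>Us\<close> may be dependent, so redundant generators are discarded before lengths are compared.\<close>
  have le: "length Vs \<le> length Us"
    if "ring.independent class_ring K Vs" "set Vs \<subseteq> ring.Span class_ring K Us" for Vs Us :: "complex list"
    using that
  proof -
    have "\<exists>Ws. set Ws \<subseteq> set Us \<and> ring.independent class_ring K Ws \<and> length Ws \<le> length Us \<and>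
            ring.Span class_ring K Ws = ring.Span class_ring K Us"
    proof (induction Us)
      case Nil
      show ?case by (rule exI[of _ "[]"]) (simp add: ring.li_Nil[OF R])
    next
      case (Cons u Us)
      then obtain Ws where Ws: "set Ws \<subseteq> set Us" "ring.independent class_ring K Ws" "length Ws \<le> length Us"
            "ring.Span class_ring K Ws = ring.Span class_ring K Us" by blast
      have Su: "ring.Span class_ring K (u # Us) = ring.line_extension class_ring K u (ring.Span class_ring K Us)" for u Us
        by (simp add: ring.Span.simps[OF R])
      show ?case
      proof (cases "u \<in> ring.Span class_ring K Us")
        case False
        hence "ring.independent class_ring K (u # Ws)" using Ws by (intro ring.li_Cons[OF R]) auto
        moreover have "ring.Span class_ring K (u # Ws) = ring.Span class_ring K (u # Us)"
          using Ws(4) by (simp add: Su)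
        ultimately show ?thesis using Ws by (intro exI[of _ "u # Ws"]) auto
      next
        case True
        have "ring.Span class_ring K (u # Us) \<subseteq> ring.Span class_ring K Us"
          using True ring.Span_base_incl[OF R K, of Us] by (intro ring.mono_Span_subset[OF R K]) auto
        moreover have "ring.Span class_ring K Us \<subseteq> ring.Span class_ring K (u # Us)"
          using ring.mono_Span[OF R K, of Us u] by simp
        ultimately show ?thesis using Ws by (intro exI[of _ Ws]) auto
      qed
    qed
    then obtain Ws where "ring.independent class_ring K Ws" "length Ws \<le> length Us"
            "ring.Span class_ring K Ws = ring.Span class_ring K Us" by blast
    thus ?thesis using ring.independent_length_le[OF R K that(1), of Ws] that(2) by simp
  qed
  obtain Vs where Vs: "ring.independent class_ring K Vs" "length Vs = field_degree L K" "ring.Span class_ring K Vs = L"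
    using ring.exists_base[OF R K dim] by blast
  have "set Vs \<subseteq> L" using ring.Span_base_incl[OF R K, of Vs] Vs(3) by simp
  thus "field_degree L K \<le> m" using le[OF Vs(1), of "map e [0..<m]"] S Vs(2) by simp
  show "field_degree L K > 0"
  proof (rule Nat.gr0I)
    assume "field_degree L K = 0"
    hence "L = {\<zero>\<^bsub>class_ring\<^esub>}" using dim by (intro ring.dimension_zero[OF R K]) simp
    thus False using assms(2) by simp
  qed
qed

lemma field_degree_eq_span_over:
  assumes "L = span_over K m e" "indep_over K m e"
  shows "field_degree L K = m"
proof -
  note R = class_ring.ring_axioms
  note K = subfield_class_ring
  have S: "ring.Span class_ring K (map e [0..<m]) = L"
    using Span_class_ring_eq[OF complex_subfield_axioms] assms(1) by simp
  show ?thesis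
    using ring.dimI[OF R K ring.dimensionI[OF R K independent_class_ring[OF complex_subfield_axioms assms(2)] S]]
    by (simp add: field_degree_def over_def)
qed

lemma span_over_eq_of_indep:
  assumes "L = span_over K m e" "1 \<in> L" "indep_over K m f" "\<And>i. i < m \<Longrightarrow> f i \<in> L"
  shows "span_over K m f = L"
proof -
  note R = class_ring.ring_axioms
  note K = subfield_class_ring
  have dim: "ring.dimension class_ring (field_degree L K) K L"
    by (rule dimension_field_degree_span_over[OF assms(1)])
  note ind = independent_class_ring[OF complex_subfield_axioms assms(3)]
  have sub: "set (map f [0..<m]) \<subseteq> L" using assms(4) by auto
  have "m \<le> field_degree L K"
    using ring.independent_length_le_dimension[OF R K dim ind sub] by simp
  hence "length (map f [0..<m]) = field_degree L K"
    using field_degree_le_span_over(1)[OF assms(1,2)] by simp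
  hence "ring.Span class_ring K (map f [0..<m]) = L"
    using ring.independent_length_eq_dimension[OF R K dim ind sub] by simp
  thus ?thesis by (simp add: Span_class_ring_eq[OF complex_subfield_axioms])
qed

end

text \<open>
  The spanning families only serve to guarantee that both dimensions are finite.
\<close>

lemma field_degree_tower:
  assumes "complex_subfield K" "complex_subfield M" "M = span_over K m e" "L = span_over M n f"
  shows "field_degree L K = field_degree M K * field_degree L M"
  using ring.telescopic_base_dim(2)[OF class_ring.ring_axioms, of K M L]
    complex_subfield.subfield_class_ring[OF assms(1)] complex_subfield.subfield_class_ring[OF assms(2)]
    complex_subfield.finite_dimension_span_over[OF assms(1), of m e]
    complex_subfield.finite_dimension_span_over[OF assms(2), of n f] assms(3,4)
  by (simp add: field_degree_def over_def)

section \<open>Degrees over subfields of cyclotomic fields of prime power order\<close>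

lemma cyclotomic_field_1_subset:
  assumes "complex_subfield K"
  shows "cyclotomic_field 1 \<subseteq> K"
  unfolding cyclotomic_field_def using assms
  by (intro rat_adjoin_minimal) (auto simp: complex_subfield.one_mem)

text \<open>
  A power \<open>\<zeta>\<^sup>i\<close> splits as \<open>(\<zeta>\<^sup>r)\<^sup>q \<zeta>\<^sup>s\<close> with \<open>i = qr + s\<close>, and \<open>\<zeta>\<^sup>r\<close> lies in the smaller cyclotomic field. With
  \<open>d = 1\<close> this covers every subfield, since the first cyclotomic field is the prime field.
\<close>

lemma cyclotomic_field_eq_span_over:
  assumes d: "d > 0" and r: "r > 0" and F: "complex_subfield F"
    and sub: "cyclotomic_field d \<subseteq> F" "F \<subseteq> cyclotomic_field (d * r)"
  shows "cyclotomic_field (d * r) = span_over F r (\<lambda>i. zeta (d * r) ^ i)"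
proof
  interpret F: complex_subfield F by fact
  interpret C: complex_subfield "cyclotomic_field (d * r)" by (rule cyclotomic_field_subfield)
  show "span_over F r (\<lambda>i. zeta (d * r) ^ i) \<subseteq> cyclotomic_field (d * r)"
    by (rule F.span_over_subset_subfield[OF cyclotomic_field_subfield sub(2)])
       (simp add: C.power_mem zeta_mem)
  have dr: "d * r > 0" using d r by simp
  have pow: "zeta (d * r) ^ i \<in> span_over F r (\<lambda>i. zeta (d * r) ^ i)" for i
  proof -
    have "zeta (d * r) ^ i = zeta (d * r) ^ (r * (i div r) + i mod r)" by simp
    also have "\<dots> = zeta d ^ (i div r) * zeta (d * r) ^ (i mod r)"
      using zeta_mult_power[OF r d] by (simp only: power_add power_mult)
    also have "\<dots> \<in> span_over F r (\<lambda>i. zeta (d * r) ^ i)"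
      using F.span_over_base[of "i mod r" r "\<lambda>i. zeta (d * r) ^ i"] r sub(1) zeta_mem[of d]
      by (intro F.span_over_scale F.power_mem) auto
    finally show ?thesis .
  qed
  show "cyclotomic_field (d * r) \<subseteq> span_over F r (\<lambda>i. zeta (d * r) ^ i)"
  proof
    fix y assume "y \<in> cyclotomic_field (d * r)"
    then obtain P e where "e \<noteq> 0" "y = int_eval P (zeta (d * r)) / of_int e"
      by (auto simp: cyclotomic_field_eq[OF dr])
    hence y: "y = inverse (of_int e) * (\<Sum>i\<le>degree P. of_int (Polynomial.coeff P i) * zeta (d * r) ^ i)"
      by (simp add: int_eval_altdef divide_inverse mult.commute)
    show "y \<in> span_over F r (\<lambda>i. zeta (d * r) ^ i)"
      unfolding y by (intro F.span_over_scale F.span_over_sum pow F.inverse_mem F.of_int_mem)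
  qed
qed

text \<open>
  The relation \<open>1 + \<zeta> + \<dots> + \<zeta>\<^sup>p\<^sup>-\<^sup>1 = 0\<close> saves one generator, so every relative degree is less than \<open>p\<close>.
\<close>

lemma cyclotomic_field_prime_eq_span_over:
  assumes p: "prime p" and F: "complex_subfield F" "F \<subseteq> cyclotomic_field p"
  shows "cyclotomic_field p = span_over F (p - 1) (\<lambda>i. zeta p ^ i)"
proof -
  interpret F: complex_subfield F by fact
  interpret C: complex_subfield "cyclotomic_field p" by (rule cyclotomic_field_subfield)
  have p1: "p > 1" using p prime_gt_1_nat by blast
  have "(\<Sum>t<p. zeta p ^ t) = 0"
    using sum_powers_zeta[of p 1] p1 by simp
  moreover have "{..<p} = insert (p - 1) {..<p - 1}" using p1 by auto
  ultimately have last: "zeta p ^ (p - 1) = (- 1) * (\<Sum>t<p - 1. zeta p ^ t)"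
    by (simp add: add_eq_0_iff)
  let ?S = "span_over F (p - 1) (\<lambda>i. zeta p ^ i)"
  have base: "zeta p ^ i \<in> ?S" if "i < p" for i
  proof (cases "i = p - 1")
    case True
    show ?thesis unfolding True last
      by (intro F.span_over_scale F.span_over_sum F.uminus_mem F.one_mem F.span_over_base) auto
  next
    case False
    thus ?thesis using that by (intro F.span_over_base) auto
  qed
  have "cyclotomic_field p = span_over F p (\<lambda>i. zeta p ^ i)"
    using cyclotomic_field_eq_span_over[of 1 p F] p1 F cyclotomic_field_1_subset[OF F(1)] by simp
  also have "\<dots> \<subseteq> ?S"
    unfolding span_over_def[of F p] using base
    by (auto intro!: F.span_over_sum F.span_over_scale)
  finally have "cyclotomic_field p \<subseteq> ?S" .
  moreover have "?S \<subseteq> cyclotomic_field p"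
    by (rule F.span_over_subset_subfield[OF cyclotomic_field_subfield F(2)])
       (simp add: C.power_mem zeta_mem)
  ultimately show ?thesis by blast
qed

lemma prime_not_dvd_field_degree_exponent_le_1:
  assumes p: "prime p" and b: "b \<le> 1" and K: "complex_subfield K" "K \<subseteq> cyclotomic_field (p ^ b)"
  shows "\<not> p dvd field_degree (cyclotomic_field (p ^ b)) K"
proof -
  interpret K: complex_subfield K by fact
  interpret C: complex_subfield "cyclotomic_field (p ^ b)" by (rule cyclotomic_field_subfield)
  have p1: "p > 1" using p prime_gt_1_nat by blast
  have "\<exists>m. m < p \<and> cyclotomic_field (p ^ b) = span_over K m (\<lambda>i. zeta (p ^ b) ^ i)"
  proof (cases "b = 0")
    case True
    thus ?thesis using cyclotomic_field_eq_span_over[of 1 1 K] cyclotomic_field_1_subset[OF K(1)] K p1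
      by (intro exI[of _ 1]) simp
  next
    case False
    hence "b = 1" using b by simp
    thus ?thesis using cyclotomic_field_prime_eq_span_over[OF p K(1)] K(2) p1
      by (intro exI[of _ "p - 1"]) simp
  qed
  then obtain m where m: "m < p" "cyclotomic_field (p ^ b) = span_over K m (\<lambda>i. zeta (p ^ b) ^ i)" by blast
  have "field_degree (cyclotomic_field (p ^ b)) K \<le> m" "field_degree (cyclotomic_field (p ^ b)) K > 0"
    using K.field_degree_le_span_over[OF m(2) C.one_mem] by auto
  thus ?thesis using m(1) nat_dvd_not_less[of "field_degree (cyclotomic_field (p ^ b)) K" p] by simp
qed

lemma coprime_one_plus_mult: "coprime (1 + t * d) (d :: nat)"
  using gcd_add_mult[of d t 1] by (simp add: coprime_iff_gcd_eq_1 gcd.commute add.commute)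

text \<open>
  Apply the automorphisms with exponent \<open>1 + td\<close> to a linear relation. They fix the coefficients and
  multiply \<open>\<zeta>\<^sup>i\<close> by the \<open>ti\<close>-th power of a primitive \<open>p\<close>-th root of unity, so a discrete Fourier
  transform in \<open>t\<close> isolates each coefficient. The assumption \<open>p dvd d\<close> makes all of these exponents
  coprime to \<open>dp\<close>.
\<close>

lemma indep_over_cyclotomic:
  assumes p: "prime p" and pd: "p dvd d" and d: "d > 0"
  shows "indep_over (cyclotomic_field d) p (\<lambda>i. zeta (d * p) ^ i)"
  unfolding indep_over_def
proof (intro allI impI)
  fix c j assume c: "\<forall>i<p. c i \<in> cyclotomic_field d" and 0: "(\<Sum>i<p. c i * zeta (d * p) ^ i) = 0" and j: "j < p"
  let ?n = "d * p"
  have p0: "p > 0" using p prime_gt_0_nat by blast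
  have n: "?n > 0" using d p0 by simp
  interpret C: complex_subfield "cyclotomic_field ?n" by (rule cyclotomic_field_subfield)
  have dn: "cyclotomic_field d \<subseteq> cyclotomic_field ?n" by (rule cyclotomic_field_mono) (use n in auto)
  have zp: "zeta ?n ^ d = zeta p" using zeta_mult_power[of d p] p0 d by (simp add: mult.commute)
  have eq: "(\<Sum>i<p. c i * zeta ?n ^ i * (zeta p ^ i) ^ t) = 0" for t
  proof -
    define k where "k = 1 + t * d"
    have cd: "coprime k d" unfolding k_def by (rule coprime_one_plus_mult)
    have "coprime k p" using coprime_divisors[of k k p d] pd cd by simp
    hence cop: "coprime k ?n" using cd by simp
    have k1: "[k = 1] (mod d)" unfolding cong_def k_def by (rule mod_mult_self1)
    have mem: "c i \<in> cyclotomic_field ?n" "zeta ?n ^ i \<in> cyclotomic_field ?n" if "i < p" for i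
      using that c dn by (auto intro: C.power_mem zeta_mem)
    have "0 = gal ?n k (\<Sum>i<p. c i * zeta ?n ^ i)" using gal_0[OF n cop] 0 by simp
    also have "\<dots> = (\<Sum>i<p. gal ?n k (c i * zeta ?n ^ i))"
      by (rule gal_sum[OF n cop]) (auto intro!: C.mult_mem mem)
    also have "\<dots> = (\<Sum>i<p. c i * zeta ?n ^ (i * k))"
      by (intro sum.cong refl) (use c in \<open>auto simp: gal_mult[OF n cop mem] gal_zeta_power[OF n cop] gal_fix[OF n cop _ k1]\<close>)
    also have "\<dots> = (\<Sum>i<p. c i * zeta ?n ^ i * (zeta p ^ i) ^ t)"
    proof (intro sum.cong refl)
      fix i
      have ik: "i * k = i + d * (i * t)" by (simp add: k_def algebra_simps)
      show "c i * zeta ?n ^ (i * k) = c i * zeta ?n ^ i * (zeta p ^ i) ^ t"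
        by (simp only: ik power_add power_mult zp mult.assoc)
    qed
    finally show ?thesis by simp
  qed
  \<comment> \<open>Multiply by the \<open>-tj\<close>-th power of the root of unity and sum over \<open>t\<close>: only the index \<open>j\<close> remains.\<close>
  have "0 = (\<Sum>t<p. (zeta p ^ (p - j)) ^ t * (\<Sum>i<p. c i * zeta ?n ^ i * (zeta p ^ i) ^ t))"
    by (simp add: eq)
  also have "\<dots> = (\<Sum>i<p. \<Sum>t<p. c i * zeta ?n ^ i * (zeta p ^ (i + (p - j))) ^ t)"
    by (subst sum.swap) (simp add: sum_distrib_left power_add power_mult_distrib mult_ac)
  also have "\<dots> = (\<Sum>i<p. if i = j then c i * zeta ?n ^ i * of_nat p else 0)"
  proof (intro sum.cong refl)
    fix i assume i: "i \<in> {..<p}"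
    have "p dvd i + (p - j) \<longleftrightarrow> i = j"
    proof
      assume "p dvd i + (p - j)"
      then obtain q where q: "i + (p - j) = p * q" ..
      have "q \<noteq> 0" using q j by (cases "q = 0") auto
      moreover have "q < 2"
      proof (rule ccontr)
        assume "\<not> q < 2"
        hence "p * 2 \<le> p * q" by simp
        moreover have "i + (p - j) < p * 2" using i j by auto
        ultimately show False using q by linarith
      qed
      ultimately have "q = 1" by simp
      thus "i = j" using q j by simp
    qed (use j in auto)
    thus "(\<Sum>t<p. c i * zeta ?n ^ i * (zeta p ^ (i + (p - j))) ^ t) = (if i = j then c i * zeta ?n ^ i * of_nat p else 0)"
      by (simp add: sum_distrib_left[symmetric] sum_powers_zeta[OF p0])
  qed
  also have "\<dots> = c j * zeta ?n ^ j * of_nat p" using j by simp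
  finally have "c j * zeta ?n ^ j * of_nat p = 0" by simp
  moreover have "zeta ?n \<noteq> 0" using zeta_power_self[OF n] n by (auto simp: zero_power)
  ultimately show "c j = 0" using p0 by simp
qed

text \<open>
  The field generated by \<open>w\<close> lies below a field over which the \<open>p\<^sup>a\<close>-th cyclotomic field has degree \<open>p\<close>.
\<close>

lemma prime_dvd_field_degree:
  assumes p: "prime p" and a: "a \<ge> 2" and w: "w \<in> cyclotomic_field (p ^ (a - 1))"
  shows "p dvd field_degree (cyclotomic_field (p ^ a)) (rat_adjoin {w})"
proof -
  let ?d = "p ^ (a - 1)"
  let ?M = "cyclotomic_field ?d" and ?L = "cyclotomic_field (p ^ a)" and ?K = "rat_adjoin {w}"
  have p0: "p > 0" using p prime_gt_0_nat by blast
  have d: "?d > 0" using p0 by simp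
  have pd: "p dvd ?d" using a by (intro dvd_power) auto
  have dp: "?d * p = p ^ a" using a power_minus_mult[of a p] by simp
  have K: "complex_subfield ?K" by (rule rat_adjoin_subfield)
  have KM: "?K \<subseteq> ?M" by (rule rat_adjoin_minimal[OF cyclotomic_field_subfield]) (use w in simp)
  interpret M: complex_subfield ?M by (rule cyclotomic_field_subfield)
  have "?M \<subseteq> cyclotomic_field (?d * p)" using d p0 by (intro cyclotomic_field_mono) auto
  from cyclotomic_field_eq_span_over[OF d p0 M.complex_subfield_axioms order_refl this]
  have L: "?L = span_over ?M p (\<lambda>i. zeta (p ^ a) ^ i)" unfolding dp .
  have "field_degree ?L ?M = p"
    by (rule M.field_degree_eq_span_over[OF L]) (use indep_over_cyclotomic[OF p pd d] in \<open>simp only: dp\<close>)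
  moreover have "?M = span_over ?K ?d (\<lambda>i. zeta ?d ^ i)"
    using cyclotomic_field_eq_span_over[of 1 ?d ?K] cyclotomic_field_1_subset[OF K] K KM d by simp
  ultimately show ?thesis
    using field_degree_tower[OF K M.complex_subfield_axioms _ L] by simp
qed

lemma one_plus_power_expansion:
  "\<exists>R. (1 + x :: nat) ^ t = 1 + t * x + (t choose 2) * x ^ 2 + x ^ 3 * R"
proof (induction t)
  case (Suc t)
  then obtain R where R: "(1 + x) ^ t = 1 + t * x + (t choose 2) * x ^ 2 + x ^ 3 * R" by blast
  have "Suc t choose 2 = t + (t choose 2)" by (simp add: numeral_2_eq_2)
  hence "(1 + x) * (1 + t * x + (t choose 2) * x ^ 2 + x ^ 3 * R) =
      1 + Suc t * x + (Suc t choose 2) * x ^ 2 + x ^ 3 * (R + x * R + (t choose 2))"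
    by (simp add: algebra_simps power2_eq_square power3_eq_cube)
  hence "(1 + x) ^ Suc t = 1 + Suc t * x + (Suc t choose 2) * x ^ 2 + x ^ 3 * (R + x * R + (t choose 2))"
    by (simp only: power_Suc R)
  thus ?case by blast
qed (auto intro: exI[of _ 0])

text \<open>
  Raising \<open>1 + p\<^sup>i s\<close> to the \<open>p\<close>-th power increases the \<open>p\<close>-adic valuation of the deviation from \<open>1\<close> by
  exactly one. This is where \<open>p\<close> must be odd: the quadratic term is \<open>p(p-1)/2\<close> times a square, and
  needs the factor \<open>p\<close>.
\<close>

lemma one_plus_prime_power_pow:
  fixes p :: nat
  assumes p: "prime p" "odd p" and i: "i \<ge> 1"
  shows "\<exists>s'. (1 + p ^ i * s) ^ (p ^ m) = 1 + p ^ (i + m) * s' \<and> [s' = s] (mod p)"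
proof (induction m)
  case (Suc m)
  then obtain s' where s': "(1 + p ^ i * s) ^ (p ^ m) = 1 + p ^ (i + m) * s'" "[s' = s] (mod p)" by blast
  define j where "j = i + m - 1"
  have j: "i + m = Suc j" using i by (simp add: j_def)
  let ?x = "p ^ Suc j * s'"
  have p2: "p > 2" using p prime_ge_2_nat[of p] by (cases "p = 2") auto
  obtain R where R: "(1 + ?x) ^ p = 1 + p * ?x + (p choose 2) * ?x ^ 2 + ?x ^ 3 * R"
    using one_plus_power_expansion by blast
  have "p dvd p choose 2" by (rule dvd_choose_prime) (use p p2 in auto)
  then obtain c where c: "p choose 2 = p * c" ..
  define s'' where "s'' = s' + p * (c * p ^ j * s' ^ 2 + p ^ j * p ^ j * s' ^ 3 * R)"
  have "(1 + p ^ i * s) ^ (p ^ Suc m) = (1 + ?x) ^ p"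
    by (simp only: power_Suc2 power_mult s'(1) j)
  also have "\<dots> = 1 + p ^ (Suc (Suc j)) * s''"
    unfolding R c s''_def by (simp add: algebra_simps power2_eq_square power3_eq_cube)
  finally have "(1 + p ^ i * s) ^ (p ^ Suc m) = 1 + p ^ (i + Suc m) * s''" by (simp add: j)
  moreover have "[s'' = s'] (mod p)" unfolding s''_def cong_def by simp
  ultimately show ?case using s'(2) cong_trans by blast
qed auto

text \<open>
  The exponents congruent to \<open>1\<close> modulo \<open>p\<close> form a cyclic \<open>p\<close>-group modulo \<open>p\<^sup>b\<close>, so every nontrivial
  subgroup contains all exponents congruent to \<open>1\<close> modulo \<open>p\<^sup>b\<^sup>-\<^sup>1\<close>. Concretely, raising
  \<open>w\<close> to a suitable power of \<open>p\<close> gives \<open>1 + p\<^sup>b\<^sup>-\<^sup>1 s'\<close> modulo \<open>p\<^sup>b\<close> with \<open>s'\<close> prime to \<open>p\<close>, and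
  the powers of this number run through all of them.
\<close>

lemma gal_fixed_descends:
  assumes p: "prime p" "odd p" and b: "b \<ge> 2" and z: "z \<in> cyclotomic_field (p ^ b)"
    and w: "[w = 1] (mod p)" "\<not> [w = 1] (mod p ^ b)" and fix_z: "gal (p ^ b) w z = z"
  shows "z \<in> cyclotomic_field (p ^ (b - 1))"
proof -
  let ?n = "p ^ b" and ?d = "p ^ (b - 1)"
  have p0: "p > 0" using p prime_gt_0_nat by blast
  have p1: "p > 1" using p prime_gt_1_nat by blast
  have n: "?n > 0" using p0 by simp
  have dp: "?d * p = ?n" using b power_minus_mult[of b p] by simp
  have cop1: "coprime k ?n" if "[k = 1] (mod p)" for k
    using cong_imp_coprime[OF cong_sym[OF that]] by simp
  have "w > 0"
  proof (rule Nat.gr0I)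
    assume "w = 0"
    thus False using w(1) p1 by (simp add: cong_def)
  qed
  define v where "v = w - 1"
  have wv: "w = 1 + v" using \<open>w > 0\<close> by (simp add: v_def)
  have pv: "p dvd v" using w(1) cong_add_lcancel_0_nat[of 1 v p] by (simp add: wv cong_0_iff)
  have nv: "\<not> ?n dvd v" using w(2) cong_add_lcancel_0_nat[of 1 v ?n] by (simp add: wv cong_0_iff)
  have v0: "v \<noteq> 0" using nv by (metis dvd_0_right)
  define i where "i = multiplicity p v"
  have npu: "\<not> is_unit p" using p1 by simp
  obtain s where s: "v = p ^ i * s" "\<not> p dvd s"
    using multiplicity_decompose'[OF v0 npu] unfolding i_def by metis
  have i1: "i \<ge> 1" using pv s by (cases "i = 0") auto
  have ib: "i < b"
  proof (rule ccontr)
    assume "\<not> i < b"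
    hence "?n dvd p ^ i" by (intro le_imp_power_dvd) simp
    thus False using nv s(1) by simp
  qed
  obtain s' where s': "w ^ (p ^ (b - 1 - i)) = 1 + p ^ (i + (b - 1 - i)) * s'" "[s' = s] (mod p)"
    using one_plus_prime_power_pow[OF p i1, of s "b - 1 - i"] unfolding wv s(1) by blast
  have ex: "i + (b - 1 - i) = b - 1" using ib by simp
  define u where "u = w ^ (p ^ (b - 1 - i))"
  have u: "u = 1 + ?d * s'" using s'(1)[unfolded ex] unfolding u_def .
  have s'p: "coprime s' p"
    using s(2) s'(2) p by (metis cong_dvd_iff coprime_commute prime_imp_coprime)
  have copw: "coprime w ?n" using cop1[OF w(1)] .
  have pow_fix: "coprime (w ^ m) ?n \<and> gal ?n (w ^ m) z = z" for m
  proof (induction m)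
    case 0
    show ?case using gal_fix[OF n, of 1 ?n z] z by simp
  next
    case (Suc m)
    have "gal ?n (w ^ Suc m) z = gal ?n w (gal ?n (w ^ m) z)"
      using gal_gal[OF n copw, of "w ^ m" z] Suc.IH z by simp
    moreover have "coprime (w ^ Suc m) ?n" using copw by (metis coprime_power_left_iff)
    ultimately show ?case using Suc.IH fix_z by simp
  qed
  show ?thesis
  proof (rule cyclotomic_field_descent[OF n, of ?d p])
    show "?d * p dvd ?n" "z \<in> cyclotomic_field (?d * p)" using dp z by simp_all
    fix t assume "t < p"
    obtain a where a: "[s' * a = t] (mod p)"
    proof -
      obtain a where "[s' * a = 1] (mod p)" using cong_solve_coprime_nat[OF s'p] by auto
      hence "[s' * a * t = 1 * t] (mod p)" by (rule cong_scalar_right)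
      thus thesis using that[of "a * t"] by (simp add: mult.assoc)
    qed
    obtain R where R: "(1 + ?d * s') ^ a = 1 + a * (?d * s') + (a choose 2) * (?d * s') ^ 2 + (?d * s') ^ 3 * R"
      using one_plus_power_expansion by blast
    have "p dvd ?d" using b by (intro dvd_power) auto
    then obtain d' where d': "?d = p * d'" ..
    have "(1 + ?d * s') ^ a = 1 + ?d * (a * s') + ?d * p * (d' * s' ^ 2 * (a choose 2) + d' * s' ^ 2 * (?d * s') * R)"
    proof -
      have "1 + a * (D * s') + (a choose 2) * (D * s') ^ 2 + (D * s') ^ 3 * R =
          1 + D * (a * s') + D * p * (d' * s' ^ 2 * (a choose 2) + d' * s' ^ 2 * (D * s') * R)" if "D = p * d'" for D
        unfolding that by (simp add: power2_eq_square power3_eq_cube algebra_simps)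
      from this[OF d'] show ?thesis unfolding R .
    qed
    hence "[u ^ a = 1 + ?d * (a * s')] (mod (?d * p))"
      unfolding u cong_def by (metis mod_mult_self2)
    also have "[1 + ?d * (a * s') = 1 + t * ?d] (mod (?d * p))"
    proof -
      have "[?d * (s' * a) = ?d * t] (mod (?d * p))"
        using a by (simp add: cong_def mod_mult_mult1)
      hence "[1 + ?d * (s' * a) = 1 + ?d * t] (mod (?d * p))" by (simp only: cong_add_lcancel_nat)
      thus ?thesis by (simp only: mult.commute)
    qed
    finally have "[u ^ a = 1 + t * ?d] (mod (?d * p))" .
    moreover have "u ^ a = w ^ (p ^ (b - 1 - i) * a)" by (simp add: u_def power_mult)
    ultimately show "\<exists>j. [j = 1 + t * ?d] (mod (?d * p)) \<and> coprime j ?n \<and> gal ?n j z = z"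
      using pow_fix by metis
  qed
qed

lemma gal_conjugates_distinct:
  assumes p: "prime p" "odd p" and b: "b \<ge> 2" and z: "z \<in> cyclotomic_field (p ^ b)" "z \<notin> cyclotomic_field (p ^ (b - 1))"
  shows "inj_on (\<lambda>s. gal (p ^ b) (1 + s * p) z) {..<p ^ (b - 1)}"
proof (rule inj_onI)
  let ?n = "p ^ b" and ?d = "p ^ (b - 1)"
  fix s t assume st: "s \<in> {..<?d}" "t \<in> {..<?d}" and eq: "gal ?n (1 + s * p) z = gal ?n (1 + t * p) z"
  have p0: "p > 0" using p prime_gt_0_nat by blast
  have n: "?n > 0" using p0 by simp
  have dp: "?d * p = ?n" using b power_minus_mult[of b p] by simp
  have pn: "p dvd ?n" using b by (intro dvd_power) auto
  have cop: "coprime (1 + k * p) ?n" for k using coprime_one_plus_mult[of k p] by simp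
  \<comment> \<open>If two conjugates agree, the quotient of the two exponents fixes \<open>z\<close>.\<close>
  obtain u where u: "[(1 + s * p) * u = 1] (mod ?n)" using cong_solve_coprime_nat[OF cop[of s]] by auto
  have "coprime ((1 + s * p) * u) ?n" using cong_imp_coprime[OF cong_sym[OF u]] by simp
  hence copu: "coprime u ?n" using coprime_mult_left_iff by blast
  have one: "[1 + k * p = 1] (mod p)" for k unfolding cong_def by (rule mod_mult_self1)
  have "[(1 + s * p) * u = 1 * u] (mod p)" using one by (rule cong_scalar_right)
  hence "[(1 + s * p) * u = u] (mod p)" by (simp only: mult_1)
  hence up: "[u = 1] (mod p)" using cong_dvd_modulus_nat[OF u pn] by (rule cong_trans[OF cong_sym])
  let ?w = "u * (1 + t * p)"
  have "gal ?n ?w z = gal ?n u (gal ?n (1 + t * p) z)"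
    by (rule gal_gal[OF n copu cop z(1), symmetric])
  also have "\<dots> = gal ?n u (gal ?n (1 + s * p) z)" by (simp only: eq)
  also have "\<dots> = gal ?n (u * (1 + s * p)) z" by (rule gal_gal[OF n copu cop z(1)])
  also have "\<dots> = z"
  proof (rule gal_fix[OF n _ dvd_refl _ z(1)])
    show "coprime (u * (1 + s * p)) ?n" using copu cop[of s] coprime_mult_left_iff by blast
    show "[u * (1 + s * p) = 1] (mod ?n)" using u by (simp only: mult.commute)
  qed
  finally have fixed: "gal ?n ?w z = z" .
  have "[?w = 1 * 1] (mod p)" by (rule cong_mult[OF up one])
  hence "[?w = 1] (mod ?n)" using gal_fixed_descends[OF p b z(1) _ _ fixed] z(2) by auto
  hence "[(1 + s * p) * ?w = (1 + s * p) * 1] (mod ?n)" by (rule cong_scalar_left)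
  hence s: "[(1 + s * p) * u * (1 + t * p) = 1 + s * p] (mod ?n)" by (simp only: mult.assoc mult_1_right)
  have "[(1 + s * p) * u * (1 + t * p) = 1 * (1 + t * p)] (mod ?n)" using u by (rule cong_scalar_right)
  hence "[(1 + s * p) * u * (1 + t * p) = 1 + t * p] (mod ?n)" by (simp only: mult_1)
  with s have "[1 + s * p = 1 + t * p] (mod ?n)" by (rule cong_trans[OF cong_sym])
  hence "[s * p = t * p] (mod ?n)" by (simp only: cong_add_lcancel_nat)
  moreover have "s * p < ?n" "t * p < ?n" using st p0 by (simp_all add: dp[symmetric])
  ultimately have "s * p = t * p" by (simp add: cong_def)
  thus "s = t" using p0 by simp
qed

text \<open>
  A relation is a polynomial of degree less than \<open>p\<^sup>b\<^sup>-\<^sup>1\<close> over the \<open>p\<close>-th cyclotomic field. It vanishes at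
  all conjugates of \<open>z\<close> over that field, and there are \<open>p\<^sup>b\<^sup>-\<^sup>1\<close> of them.
\<close>

lemma powers_indep_over_cyclotomic_field_prime:
  assumes p: "prime p" "odd p" and b: "b \<ge> 2" and z: "z \<in> cyclotomic_field (p ^ b)" "z \<notin> cyclotomic_field (p ^ (b - 1))"
  shows "indep_over (cyclotomic_field p) (p ^ (b - 1)) (\<lambda>i. z ^ i)"
  unfolding indep_over_def
proof (intro allI impI)
  let ?n = "p ^ b" and ?D = "p ^ (b - 1)"
  fix c j assume c: "\<forall>i<?D. c i \<in> cyclotomic_field p" and 0: "(\<Sum>i<?D. c i * z ^ i) = 0" and j: "j < ?D"
  have p0: "p > 0" using p prime_gt_0_nat by blast
  have n: "?n > 0" using p0 by simp
  have pn: "p dvd ?n" using b by (intro dvd_power) auto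
  interpret C: complex_subfield "cyclotomic_field ?n" by (rule cyclotomic_field_subfield)
  have sub: "cyclotomic_field p \<subseteq> cyclotomic_field ?n" by (rule cyclotomic_field_mono[OF pn n])
  define Q where "Q = (\<Sum>i<?D. Polynomial.monom (c i) i)"
  have coeff: "Polynomial.coeff Q i = (if i < ?D then c i else 0)" for i
    by (simp add: Q_def coeff_sum)
  have root: "poly Q (gal ?n (1 + s * p) z) = 0" for s
  proof -
    define k where "k = 1 + s * p"
    have cop: "coprime k ?n" using coprime_one_plus_mult[of s p] by (simp add: k_def)
    have k1: "[k = 1] (mod p)" unfolding cong_def k_def by (rule mod_mult_self1)
    have mem: "c i \<in> cyclotomic_field ?n" "z ^ i \<in> cyclotomic_field ?n" if "i < ?D" for i
      using that c sub z(1) by (auto intro: C.power_mem)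
    have "0 = gal ?n k (\<Sum>i<?D. c i * z ^ i)" using gal_0[OF n cop] 0 by simp
    also have "\<dots> = (\<Sum>i<?D. gal ?n k (c i * z ^ i))"
      by (rule gal_sum[OF n cop]) (auto intro!: C.mult_mem mem)
    also have "\<dots> = (\<Sum>i<?D. c i * gal ?n k z ^ i)"
      by (intro sum.cong refl)
         (use c in \<open>auto simp: gal_mult[OF n cop mem] gal_power[OF n cop z(1)] gal_fix[OF n cop pn k1]\<close>)
    also have "\<dots> = poly Q (gal ?n k z)" by (simp add: Q_def poly_sum poly_monom)
    finally show ?thesis by (simp add: k_def)
  qed
  have "Q = 0"
  proof (rule ccontr)
    assume Q: "Q \<noteq> 0"
    have "degree Q < ?D"
      using coeff[of "degree Q"] leading_coeff_neq_0[OF Q] by (metis)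
    moreover have "card ((\<lambda>s. gal ?n (1 + s * p) z) ` {..<?D}) \<le> card {x. poly Q x = 0}"
      by (rule card_mono[OF poly_roots_finite[OF Q]]) (use root in blast)
    hence "?D \<le> degree Q"
      using card_image[OF gal_conjugates_distinct[OF p b z]] card_poly_roots_bound[OF Q] by simp
    ultimately show False by simp
  qed
  thus "c j = 0" using coeff[of j] j by simp
qed

text \<open>
  The powers of \<open>z\<close> are a basis of the large field over the \<open>p\<close>-th cyclotomic field, so \<open>z\<close> together with
  a primitive \<open>p\<close>-th root of unity generates everything. Adjoining the latter to the field of \<open>z\<close> is an
  extension of degree less than \<open>p\<close>.
\<close>

lemma prime_not_dvd_field_degree:
  assumes p: "prime p" "odd p" and b: "b \<ge> 2" and z: "z \<in> cyclotomic_field (p ^ b)" "z \<notin> cyclotomic_field (p ^ (b - 1))"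
  shows "\<not> p dvd field_degree (cyclotomic_field (p ^ b)) (rat_adjoin {z})"
proof -
  let ?D = "p ^ (b - 1)" and ?L = "cyclotomic_field (p ^ b)" and ?K = "rat_adjoin {z}" and ?F = "cyclotomic_field p"
  have p0: "p > 0" using p prime_gt_0_nat by blast
  have p1: "p > 1" using p prime_gt_1_nat by blast
  have n: "p ^ b > 0" using p0 by simp
  have pn: "p dvd p ^ b" using b by (intro dvd_power) auto
  have dp: "p * ?D = p ^ b" using b power_minus_mult[of b p] by (simp add: mult.commute)
  have FL: "?F \<subseteq> ?L" by (rule cyclotomic_field_mono[OF pn n])
  interpret F: complex_subfield ?F by (rule cyclotomic_field_subfield)
  interpret L: complex_subfield ?L by (rule cyclotomic_field_subfield)
  interpret K: complex_subfield ?K by (rule rat_adjoin_subfield)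
  have KL: "?K \<subseteq> ?L" by (rule rat_adjoin_minimal[OF cyclotomic_field_subfield]) (use z in simp)
  have zK: "z \<in> ?K" by (rule rat_adjoin_incl) simp
  have Q: "complex_subfield (cyclotomic_field 1)" by (rule cyclotomic_field_subfield)
  have QK: "cyclotomic_field 1 \<subseteq> ?K" by (rule cyclotomic_field_1_subset) (rule K.complex_subfield_axioms)
  have "cyclotomic_field (p * ?D) = span_over ?F ?D (\<lambda>i. zeta (p * ?D) ^ i)"
    by (rule cyclotomic_field_eq_span_over[OF p0 _ F.complex_subfield_axioms order_refl])
       (use p0 FL in \<open>simp_all only: dp zero_less_power\<close>)
  hence "?L = span_over ?F ?D (\<lambda>i. zeta (p ^ b) ^ i)" by (simp only: dp)
  hence span_z: "span_over ?F ?D (\<lambda>i. z ^ i) = ?L"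
    by (rule F.span_over_eq_of_indep[OF _ L.one_mem powers_indep_over_cyclotomic_field_prime[OF p b z]]) (simp add: L.power_mem z(1))
  have F_eq: "?F = span_over (cyclotomic_field 1) (p - 1) (\<lambda>l. zeta p ^ l)"
    by (rule cyclotomic_field_prime_eq_span_over[OF p(1) Q cyclotomic_field_1_subset[OF F.complex_subfield_axioms]])
  have F_sub: "?F \<subseteq> span_over ?K (p - 1) (\<lambda>l. zeta p ^ l)"
    unfolding F_eq using QK by (auto simp: span_over_def)
  have "?L = span_over ?K (p - 1) (\<lambda>l. zeta p ^ l)"
  proof
    show "span_over ?K (p - 1) (\<lambda>l. zeta p ^ l) \<subseteq> ?L"
      by (rule K.span_over_subset_subfield[OF L.complex_subfield_axioms KL])
         (use FL zeta_mem[of p] in \<open>auto intro: L.power_mem\<close>)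
    show "?L \<subseteq> span_over ?K (p - 1) (\<lambda>l. zeta p ^ l)"
    proof
      fix y assume "y \<in> ?L"
      then obtain c where c: "\<forall>i<?D. c i \<in> ?F" "y = (\<Sum>i<?D. z ^ i * c i)"
        unfolding span_z[symmetric] span_over_def by (auto simp: mult.commute)
      show "y \<in> span_over ?K (p - 1) (\<lambda>l. zeta p ^ l)"
        unfolding c(2) using c(1) F_sub by (intro K.span_over_sum K.span_over_scale K.power_mem zK) auto
    qed
  qed
  from K.field_degree_le_span_over[OF this L.one_mem] show ?thesis
    using p1 nat_dvd_not_less[of "field_degree ?L ?K" p] by simp
qed

section \<open>Traces and representations\<close>

text \<open>
  Triangularise; the trace is invariant under similarity.
\<close>

lemma trace_eq_sum_eigenvalues:
  assumes A: "(A :: complex mat) \<in> carrier_mat n n"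
  obtains es where "(\<Sum>i<n. A $$ (i, i)) = sum_list es" "\<And>e. e \<in> set es \<Longrightarrow> eigenvalue A e"
proof -
  obtain es where es: "char_poly A = (\<Prod>e\<leftarrow>es. [:- e, 1:])"
    using char_poly_factorized[OF A] by blast
  obtain B P Q where BPQ: "schur_decomposition A es = (B, P, Q)" by (cases "schur_decomposition A es") auto
  have sim: "similar_mat_wit A B P Q" and diag: "diag_mat B = es"
    using schur_decomposition[OF A es BPQ] by auto
  from sim A have B: "B \<in> carrier_mat n n" and P: "P \<in> carrier_mat n n" and Q: "Q \<in> carrier_mat n n"
    and QP: "Q * P = 1\<^sub>m n" and eq: "A = P * B * Q"
    by (auto simp: similar_mat_wit_def Let_def)
  have comm: "(\<Sum>i<n. (C * D) $$ (i, i)) = (\<Sum>i<n. (D * C) $$ (i, i))"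
    if "C \<in> carrier_mat n n" "D \<in> carrier_mat n n" for C D :: "complex mat"
  proof -
    have "(\<Sum>i<n. (C * D) $$ (i, i)) = (\<Sum>i<n. \<Sum>k<n. C $$ (i, k) * D $$ (k, i))"
      using that by (intro sum.cong refl) (simp add: scalar_prod_def atLeast0LessThan)
    also have "\<dots> = (\<Sum>i<n. \<Sum>k<n. D $$ (i, k) * C $$ (k, i))"
      by (subst sum.swap) (simp add: mult.commute)
    also have "\<dots> = (\<Sum>i<n. (D * C) $$ (i, i))"
      using that by (intro sum.cong refl) (simp add: scalar_prod_def atLeast0LessThan)
    finally show ?thesis .
  qed
  have "(\<Sum>i<n. A $$ (i, i)) = (\<Sum>i<n. (Q * (P * B)) $$ (i, i))"
    unfolding eq by (rule comm) (use P B Q in auto)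
  also have "Q * (P * B) = (Q * P) * B" using P B Q by (simp add: assoc_mult_mat[of _ n n _ n _ n])
  also have "\<dots> = B" using QP B by simp
  also have "(\<Sum>i<n. B $$ (i, i)) = sum_list (diag_mat B)"
    using B by (simp add: diag_mat_def sum_list_sum_nth atLeast0LessThan)
  finally have "(\<Sum>i<n. A $$ (i, i)) = sum_list es" by (simp add: diag)
  moreover have "eigenvalue A e" if "e \<in> set es" for e
    using that by (auto simp: eigenvalue_root_char_poly[OF A] es poly_prod_list prod_list_zero_iff image_iff)
  ultimately show thesis using that by blast
qed

lemma idempotent_trace_nat:
  assumes A: "(A :: complex mat) \<in> carrier_mat n n" and idem: "A * A = A"
  shows "\<exists>m. (\<Sum>i<n. A $$ (i, i)) = of_nat m"
proof -
  obtain es where es: "(\<Sum>i<n. A $$ (i, i)) = sum_list es" "\<And>e. e \<in> set es \<Longrightarrow> eigenvalue A e"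
    using trace_eq_sum_eigenvalues[OF A] by blast
  have "e = 0 \<or> e = 1" if e: "e \<in> set es" for e
  proof -
    obtain v where v: "eigenvector A v e" using es(2)[OF e] by (auto simp: eigenvalue_def)
    hence vc: "v \<in> carrier_vec n" "v \<noteq> 0\<^sub>v n" "A *\<^sub>v v = e \<cdot>\<^sub>v v"
      using A by (auto simp: eigenvector_def)
    have "e \<cdot>\<^sub>v v = (A * A) *\<^sub>v v" using vc idem by simp
    also have "\<dots> = A *\<^sub>v (A *\<^sub>v v)" using A vc by simp
    also have "\<dots> = (e * e) \<cdot>\<^sub>v v"
      using A vc by (simp add: mult_mat_vec smult_smult_assoc)
    finally have eq: "e \<cdot>\<^sub>v v = (e * e) \<cdot>\<^sub>v v" .
    obtain i where i: "i < n" "v $ i \<noteq> 0"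
      using vc by (metis carrier_vecD eq_vecI index_zero_vec)
    have "e * v $ i = (e * e) * v $ i" using arg_cong[OF eq, of "\<lambda>w. w $ i"] i vc(1) by simp
    thus ?thesis using i(2) by simp
  qed
  hence "\<exists>m. sum_list es = of_nat m"
  proof (induction es)
    case (Cons e es)
    then obtain m where "sum_list es = of_nat m" by auto
    moreover have "e = of_nat 0 \<or> e = of_nat 1" using Cons.prems by auto
    ultimately show ?case by (auto simp: of_nat_add[symmetric] simp del: of_nat_add of_nat_Suc intro: exI[of _ m] exI[of _ "Suc m"])
  qed (auto intro: exI[of _ 0])
  thus ?thesis using es(1) by simp
qed

lemma is_repD:
  fixes H (structure)
  assumes "group H" "is_rep H n \<rho>"
  shows is_rep_carrier: "x \<in> carrier H \<Longrightarrow> \<rho> x \<in> carrier_mat n n"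
    and is_rep_mult: "x \<in> carrier H \<Longrightarrow> y \<in> carrier H \<Longrightarrow> \<rho> (x \<otimes> y) = \<rho> x * \<rho> y"
    and is_rep_one: "\<rho> \<one> = 1\<^sub>m n"
proof -
  let ?R = "ring_mat TYPE(complex) n ()"
  interpret R: ring ?R by (rule ring_mat)
  have h: "\<rho> \<in> hom H (units_of ?R)" using assms(2) by (simp add: is_rep_def)
  show "x \<in> carrier H \<Longrightarrow> \<rho> x \<in> carrier_mat n n"
    using h R.Units_closed by (auto simp: hom_def units_of_carrier ring_mat_simps)
  show "x \<in> carrier H \<Longrightarrow> y \<in> carrier H \<Longrightarrow> \<rho> (x \<otimes> y) = \<rho> x * \<rho> y"
    using hom_mult[OF h, of x y] by (simp add: units_of_mult ring_mat_simps)
  show "\<rho> \<one> = 1\<^sub>m n"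
    using hom_one[OF h assms(1) R.units_group] by (simp add: units_of_one ring_mat_simps)
qed

lemma rep_mult_entry:
  fixes H (structure)
  assumes "group H" "is_rep H n \<rho>" "x \<in> carrier H" "y \<in> carrier H" "i < n" "j < n"
  shows "\<rho> (x \<otimes> y) $$ (i, j) = (\<Sum>k<n. \<rho> x $$ (i, k) * \<rho> y $$ (k, j))"
  using is_rep_carrier[OF assms(1,2,3)] is_rep_carrier[OF assms(1,2,4)] assms(3-6)
  by (simp add: is_rep_mult[OF assms(1,2)] scalar_prod_def atLeast0LessThan)

lemma rep_one_entry:
  fixes H (structure)
  assumes "group H" "is_rep H n \<rho>" "i < n" "j < n"
  shows "\<rho> \<one> $$ (i, j) = (if i = j then 1 else 0)"
  using assms by (simp add: is_rep_one)

lemma rep_pow: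
  fixes H (structure)
  assumes "group H" "is_rep H n \<rho>" "x \<in> carrier H"
  shows "\<rho> (x [^] (m::nat)) = \<rho> x ^\<^sub>m m"
proof -
  interpret H: group H by fact
  show ?thesis
    by (induction m) (use is_repD[OF assms(1,2)] assms(3) in \<open>auto simp: carrier_matD\<close>)
qed

lemma rep_character_in_cyclotomic_field:
  fixes H (structure)
  assumes H: "group H" and rep: "is_rep H n \<rho>" and x: "x \<in> carrier H"
    and m: "m > 0" "x [^] m = \<one>"
  shows "rep_character H n \<rho> x \<in> cyclotomic_field m"
proof -
  interpret C: complex_subfield "cyclotomic_field m" by (rule cyclotomic_field_subfield)
  have A: "\<rho> x \<in> carrier_mat n n" by (rule is_rep_carrier[OF H rep x])
  obtain es where es: "(\<Sum>i<n. \<rho> x $$ (i, i)) = sum_list es" "\<And>e. e \<in> set es \<Longrightarrow> eigenvalue (\<rho> x) e"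
    using trace_eq_sum_eigenvalues[OF A] by blast
  have "e \<in> cyclotomic_field m" if e: "e \<in> set es" for e
  proof -
    obtain v where v: "eigenvector (\<rho> x) v e" using es(2)[OF e] by (auto simp: eigenvalue_def)
    hence vc: "v \<in> carrier_vec n" "v \<noteq> 0\<^sub>v n"
      using A by (auto simp: eigenvector_def)
    have "\<rho> x ^\<^sub>m m = 1\<^sub>m n"
      using rep_pow[OF H rep x, of m] m(2) is_rep_one[OF H rep] by simp
    hence eq: "v = (e ^ m) \<cdot>\<^sub>v v"
      using eigenvector_pow[OF A v, of m] vc(1) by simp
    obtain i where i: "i < n" "v $ i \<noteq> 0"
      using vc by (metis carrier_vecD eq_vecI index_zero_vec)
    have "v $ i = e ^ m * v $ i" using arg_cong[OF eq, of "\<lambda>w. w $ i"] i vc(1) by simp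
    hence "e ^ m = 1" using i(2) by simp
    then obtain k where "e = cis (2 * pi * real k / real m)"
      using bij_betw_roots_unity[OF m(1)] unfolding bij_betw_def by blast
    hence "e = zeta m ^ k" by (simp add: zeta_def DeMoivre mult_ac)
    thus ?thesis by (simp add: C.power_mem zeta_mem)
  qed
  hence "sum_list es \<in> cyclotomic_field m" by (induction es) (auto intro: C.zero_mem C.add_mem)
  thus ?thesis using x es(1) by (simp add: rep_character_def)
qed

lemma rep_character_one:
  fixes H (structure)
  assumes "group H" "is_rep H n \<rho>"
  shows "rep_character H n \<rho> \<one> = of_nat n"
proof -
  interpret H: group H by fact
  show ?thesis by (simp add: rep_character_def rep_one_entry[OF assms])
qed

lemma rep_character_mult:
  fixes H (structure)
  assumes "group H" "is_rep H n \<rho>" "x \<in> carrier H" "y \<in> carrier H"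
  shows "rep_character H n \<rho> (x \<otimes> y) = (\<Sum>i<n. \<Sum>k<n. \<rho> x $$ (i, k) * \<rho> y $$ (k, i))"
proof -
  interpret H: group H by fact
  show ?thesis using assms(3,4) by (simp add: rep_character_def rep_mult_entry[OF assms(1,2)])
qed

lemma rep_character_mult_commute:
  fixes H (structure)
  assumes "group H" "is_rep H n \<rho>" "x \<in> carrier H" "y \<in> carrier H"
  shows "rep_character H n \<rho> (x \<otimes> y) = rep_character H n \<rho> (y \<otimes> x)"
  unfolding rep_character_mult[OF assms] rep_character_mult[OF assms(1,2,4,3)]
  by (subst sum.swap) (simp add: mult.commute)

lemma irreducible_repD:
  assumes "irreducible_rep H n \<rho>"
  shows "is_rep H n \<rho>" "n > 0"
  using assms by (auto simp: irreducible_rep_def)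

section \<open>Schur's lemma and orthogonality\<close>

text \<open>
  Eigenspaces are the invariant subspaces to which irreducibility is applied in Schur's lemma.
\<close>

lemma subspace_eigenspace:
  assumes A: "(A :: complex mat) \<in> carrier_mat n n"
  shows "VectorSpace.subspace class_ring {v \<in> carrier_vec n. A *\<^sub>v v = c \<cdot>\<^sub>v v} (module_vec TYPE(complex) n)"
proof -
  interpret V: vec_space "TYPE(complex)" n .
  show ?thesis
    unfolding VectorSpace.subspace_def submodule_def
  proof (intro conjI allI impI)
    show "vectorspace class_ring (module_vec TYPE(complex) n)" by (rule V.vectorspace_axioms)
    show "Module.module class_ring (module_vec TYPE(complex) n)" by (rule V.module_axioms)
  qed (use A in \<open>auto simp: module_vec_simps mult_add_distrib_mat_vec smult_add_distrib_vec mult_mat_vec smult_smult_assoc mult.commute\<close>)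
qed

lemma schur_scalar:
  assumes H: "group H" and irr: "irreducible_rep H n \<rho>" and A: "A \<in> carrier_mat n n"
    and comm: "\<And>x. x \<in> carrier H \<Longrightarrow> \<rho> x * A = A * \<rho> x"
  shows "\<exists>c. A = c \<cdot>\<^sub>m 1\<^sub>m n"
proof -
  note rep = irreducible_repD[OF irr]
  obtain as where as: "char_poly A = (\<Prod>a\<leftarrow>as. [:- a, 1:])" "length as = n"
    using char_poly_factorized[OF A] by blast
  then obtain c where "c \<in> set as" using rep(2) by (metis length_greater_0_conv list.set_sel(1))
  hence "eigenvalue A c"
    by (auto simp: eigenvalue_root_char_poly[OF A] as(1) poly_prod_list prod_list_zero_iff image_iff)
  then obtain v where v: "v \<in> carrier_vec n" "v \<noteq> 0\<^sub>v n" "A *\<^sub>v v = c \<cdot>\<^sub>v v"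
    using A by (auto simp: eigenvalue_def eigenvector_def)
  define W where "W = {v \<in> carrier_vec n. A *\<^sub>v v = c \<cdot>\<^sub>v v}"
  have "VectorSpace.subspace class_ring W (module_vec TYPE(complex) n)"
    unfolding W_def by (rule subspace_eigenspace[OF A])
  moreover have "\<forall>x\<in>carrier H. \<forall>v\<in>W. \<rho> x *\<^sub>v v \<in> W"
  proof (intro ballI)
    fix x v assume x: "x \<in> carrier H" and "v \<in> W"
    hence v: "v \<in> carrier_vec n" "A *\<^sub>v v = c \<cdot>\<^sub>v v" by (auto simp: W_def)
    have r: "\<rho> x \<in> carrier_mat n n" by (rule is_rep_carrier[OF H rep(1) x])
    have "A *\<^sub>v (\<rho> x *\<^sub>v v) = (A * \<rho> x) *\<^sub>v v" using A r v by simp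
    also have "\<dots> = \<rho> x *\<^sub>v (A *\<^sub>v v)" using A r v comm[OF x, symmetric] by simp
    also have "\<dots> = c \<cdot>\<^sub>v (\<rho> x *\<^sub>v v)" using r v by (simp add: mult_mat_vec)
    finally show "\<rho> x *\<^sub>v v \<in> W" using r v by (simp add: W_def)
  qed
  ultimately have "W = {0\<^sub>v n} \<or> W = carrier_vec n" using irr by (auto simp: irreducible_rep_def)
  moreover have "v \<in> W" using v by (simp add: W_def)
  ultimately have W: "W = carrier_vec n" using v(2) by auto
  have "A = c \<cdot>\<^sub>m 1\<^sub>m n"
  proof (rule eq_matI)
    fix i j assume "i < dim_row (c \<cdot>\<^sub>m 1\<^sub>m n)" "j < dim_col (c \<cdot>\<^sub>m 1\<^sub>m n)"
    hence ij: "i < n" "j < n" by auto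
    have "unit_vec n j \<in> W" by (simp add: W)
    hence "A *\<^sub>v unit_vec n j = c \<cdot>\<^sub>v unit_vec n j" by (simp add: W_def)
    from arg_cong[OF this, of "\<lambda>w. w $ i"] show "A $$ (i, j) = (c \<cdot>\<^sub>m 1\<^sub>m n) $$ (i, j)"
      using A ij by (auto simp: scalar_prod_right_unit)
  qed (use A in auto)
  thus ?thesis by blast
qed

text \<open>
  Schur's lemma for a matrix given by its entries, which is the form in which averages over the group
  arise below.
\<close>

lemma schur_scalar_entries:
  fixes M :: "nat \<Rightarrow> nat \<Rightarrow> complex"
  assumes H: "group H" and irr: "irreducible_rep H n \<rho>"
    and comm: "\<And>x i j. x \<in> carrier H \<Longrightarrow> i < n \<Longrightarrow> j < n \<Longrightarrow>
       (\<Sum>k<n. \<rho> x $$ (i, k) * M k j) = (\<Sum>k<n. M i k * \<rho> x $$ (k, j))"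
  shows "\<exists>c. \<forall>i<n. \<forall>j<n. M i j = (if i = j then c else 0)"
proof -
  define A where "A = mat n n (\<lambda>(i, j). M i j)"
  have A: "A \<in> carrier_mat n n" by (simp add: A_def)
  have "\<rho> x * A = A * \<rho> x" if x: "x \<in> carrier H" for x
  proof (rule eq_matI)
    have r: "\<rho> x \<in> carrier_mat n n" by (rule is_rep_carrier[OF H irreducible_repD(1)[OF irr] x])
    fix i j assume "i < dim_row (A * \<rho> x)" "j < dim_col (A * \<rho> x)"
    hence "i < n" "j < n" using A r by auto
    thus "(\<rho> x * A) $$ (i, j) = (A * \<rho> x) $$ (i, j)"
      using r comm[OF x, of i j] by (simp add: A_def scalar_prod_def atLeast0LessThan)
  qed (use A is_rep_carrier[OF H irreducible_repD(1)[OF irr] x] in auto)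
  then obtain c where "A = c \<cdot>\<^sub>m 1\<^sub>m n" using schur_scalar[OF H irr A] by blast
  hence "A $$ (i, j) = (if i = j then c else 0)" if "i < n" "j < n" for i j using that by simp
  thus ?thesis by (auto simp: A_def)
qed

lemma sum_group_translate_left:
  fixes H (structure)
  assumes "group H" "g \<in> carrier H"
  shows "(\<Sum>y\<in>carrier H. f (g \<otimes> y)) = (\<Sum>y\<in>carrier H. f y)"
proof -
  interpret H: group H by fact
  show ?thesis
    by (rule sum.reindex_bij_witness[of _ "\<lambda>y. inv g \<otimes> y" "\<lambda>y. g \<otimes> y"])
       (use assms(2) in \<open>auto simp: H.m_assoc[symmetric]\<close>)
qed

lemma sum_group_inverse:
  fixes H (structure)
  assumes "group H"
  shows "(\<Sum>y\<in>carrier H. f (inv y)) = (\<Sum>y\<in>carrier H. f y)"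
proof -
  interpret H: group H by fact
  show ?thesis
    by (rule sum.reindex_bij_witness[of _ "\<lambda>y. inv y" "\<lambda>y. inv y"]) auto
qed

lemma sum_conjugate:
  fixes G (structure)
  assumes G: "group G" and N: "N \<subseteq> carrier G" "\<And>g y. g \<in> carrier G \<Longrightarrow> y \<in> N \<Longrightarrow> g \<otimes> y \<otimes> inv g \<in> N"
    and g: "g \<in> carrier G"
  shows "(\<Sum>y\<in>N. f (g \<otimes> y \<otimes> inv g)) = (\<Sum>y\<in>N. f y)"
proof -
  interpret G: group G by fact
  have *: "inv g \<otimes> y \<otimes> g \<in> N" if "y \<in> N" for y
    using N(2)[of "inv g" y] that g by simp
  show ?thesis
  proof (rule sum.reindex_bij_witness[of _ "\<lambda>y. inv g \<otimes> y \<otimes> g" "\<lambda>y. g \<otimes> y \<otimes> inv g"])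
    fix y assume y: "y \<in> N"
    hence yc: "y \<in> carrier G" using N(1) by auto
    show "inv g \<otimes> (g \<otimes> y \<otimes> inv g) \<otimes> g = y"
      using yc g by (metis G.inv_closed G.inv_solve_left' G.inv_solve_right' G.m_assoc G.m_closed)
    show "g \<otimes> (inv g \<otimes> y \<otimes> g) \<otimes> inv g = y"
      using yc g by (metis G.inv_closed G.inv_solve_left' G.inv_solve_right' G.m_assoc G.m_closed)
  qed (use * N(2) g in auto)
qed

text \<open>
  The sum \<open>\<Sum> f(y) \<rho>(y)\<close> over a union \<open>N\<close> of conjugacy classes commutes with the representation. The set \<open>N\<close>
  will be either the whole group or a normal subgroup.
\<close>

lemma class_sum_scalar:
  fixes G (structure)
  assumes G: "group G" and N: "N \<subseteq> carrier G" "\<And>g y. g \<in> carrier G \<Longrightarrow> y \<in> N \<Longrightarrow> g \<otimes> y \<otimes> inv g \<in> N"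
    and irr: "irreducible_rep G n \<rho>"
    and f: "\<And>g y. g \<in> carrier G \<Longrightarrow> y \<in> N \<Longrightarrow> f (g \<otimes> y \<otimes> inv g) = f y"
  shows "\<exists>c. \<forall>i<n. \<forall>j<n. (\<Sum>y\<in>N. f y * \<rho> y $$ (i, j)) = (if i = j then c else 0)"
proof (rule schur_scalar_entries[OF G irr])
  interpret G: group G by fact
  note rep = irreducible_repD(1)[OF irr]
  fix g i j assume g: "g \<in> carrier G" and ij: "i < n" "j < n"
  have Nc: "y \<in> carrier G" if "y \<in> N" for y using that N(1) by auto
  have "(\<Sum>k<n. \<rho> g $$ (i, k) * (\<Sum>y\<in>N. f y * \<rho> y $$ (k, j))) = (\<Sum>y\<in>N. f y * \<rho> (g \<otimes> y) $$ (i, j))"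
    using g ij Nc
    by (simp add: rep_mult_entry[OF G rep] sum_distrib_left mult_ac sum.swap[of _ N "{..<n}"])
  also have "\<dots> = (\<Sum>y\<in>N. f (g \<otimes> y \<otimes> inv g) * \<rho> (g \<otimes> y \<otimes> inv g \<otimes> g) $$ (i, j))"
    by (intro sum.cong refl) (use g Nc f in \<open>simp add: G.m_assoc\<close>)
  also have "\<dots> = (\<Sum>y\<in>N. f y * \<rho> (y \<otimes> g) $$ (i, j))"
    by (rule sum_conjugate[OF G N g, of "\<lambda>y. f y * \<rho> (y \<otimes> g) $$ (i, j)"])
  also have "\<dots> = (\<Sum>k<n. (\<Sum>y\<in>N. f y * \<rho> y $$ (i, k)) * \<rho> g $$ (k, j))"
    using g ij Nc
    by (simp add: rep_mult_entry[OF G rep] sum_distrib_left sum_distrib_right mult_ac sum.swap[of _ N "{..<n}"])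
  finally show "(\<Sum>k<n. \<rho> g $$ (i, k) * (\<Sum>y\<in>N. f y * \<rho> y $$ (k, j))) =
       (\<Sum>k<n. (\<Sum>y\<in>N. f y * \<rho> y $$ (i, k)) * \<rho> g $$ (k, j))" .
qed

text \<open>
  For fixed \<open>b\<close> and \<open>c\<close> the left-hand side is the entry \<open>(a, d)\<close> of the average of a matrix unit over the
  group; it commutes with the representation, hence is scalar, and its trace determines the scalar.
\<close>

lemma schur_orthogonality:
  fixes H (structure)
  assumes H: "group H" and fin: "finite (carrier H)" and irr: "irreducible_rep H n \<rho>"
    and idx: "a < n" "b < n" "c < n" "d < n"
  shows "(\<Sum>y\<in>carrier H. \<rho> y $$ (a, b) * \<rho> (inv y) $$ (c, d)) =
     (if b = c \<and> a = d then of_nat (card (carrier H)) / of_nat n else 0)"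
proof -
  interpret H: group H by fact
  note rep = irreducible_repD(1)[OF irr]
  note n = irreducible_repD(2)[OF irr]
  define M where "M = (\<lambda>a d. \<Sum>y\<in>carrier H. \<rho> y $$ (a, b) * \<rho> (inv y) $$ (c, d))"
  have "\<exists>l. \<forall>i<n. \<forall>j<n. M i j = (if i = j then l else 0)"
  proof (rule schur_scalar_entries[OF H irr])
    fix g i j assume g: "g \<in> carrier H" and ij: "i < n" "j < n"
    have "(\<Sum>k<n. \<rho> g $$ (i, k) * M k j) = (\<Sum>y\<in>carrier H. \<rho> (g \<otimes> y) $$ (i, b) * \<rho> (inv y) $$ (c, j))"
      using g ij idx unfolding M_def
      by (simp add: rep_mult_entry[OF H rep] sum_distrib_left sum_distrib_right mult.assoc sum.swap[of _ "carrier H" "{..<n}"])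
    also have "\<dots> = (\<Sum>y\<in>carrier H. \<rho> (g \<otimes> y) $$ (i, b) * \<rho> (inv (g \<otimes> y) \<otimes> g) $$ (c, j))"
      by (intro sum.cong refl) (use g in \<open>simp add: H.inv_mult_group H.m_assoc\<close>)
    also have "\<dots> = (\<Sum>y\<in>carrier H. \<rho> y $$ (i, b) * \<rho> (inv y \<otimes> g) $$ (c, j))"
      by (rule sum_group_translate_left[OF H g, of "\<lambda>y. \<rho> y $$ (i, b) * \<rho> (inv y \<otimes> g) $$ (c, j)"])
    also have "\<dots> = (\<Sum>k<n. M i k * \<rho> g $$ (k, j))"
      using g ij idx unfolding M_def
      by (simp add: rep_mult_entry[OF H rep] sum_distrib_left sum_distrib_right mult.assoc sum.swap[of _ "carrier H" "{..<n}"])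
    finally show "(\<Sum>k<n. \<rho> g $$ (i, k) * M k j) = (\<Sum>k<n. M i k * \<rho> g $$ (k, j))" .
  qed
  then obtain l where l: "\<And>i j. i < n \<Longrightarrow> j < n \<Longrightarrow> M i j = (if i = j then l else 0)" by blast
  have "of_nat n * l = (\<Sum>i<n. M i i)" by (simp add: l)
  also have "\<dots> = (\<Sum>y\<in>carrier H. \<Sum>i<n. \<rho> (inv y) $$ (c, i) * \<rho> y $$ (i, b))"
    unfolding M_def by (subst sum.swap) (simp add: mult.commute)
  also have "\<dots> = (\<Sum>y\<in>carrier H. \<rho> (inv y \<otimes> y) $$ (c, b))"
    by (intro sum.cong refl rep_mult_entry[OF H rep, symmetric]) (use idx in auto)
  also have "\<dots> = (if b = c then of_nat (card (carrier H)) else 0)"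
    using idx by (simp add: rep_one_entry[OF H rep])
  finally have "l = (if b = c then of_nat (card (carrier H)) / of_nat n else 0)"
    using n by (auto simp: field_simps)
  thus ?thesis using l[OF idx(1,4)] by (auto simp: M_def)
qed

section \<open>Convolution of characters\<close>

definition class_function :: "('a, 'b) monoid_scheme \<Rightarrow> ('a \<Rightarrow> complex) \<Rightarrow> bool" where
  "class_function H f \<longleftrightarrow> (\<forall>x\<in>carrier H. \<forall>y\<in>carrier H. f (x \<otimes>\<^bsub>H\<^esub> y) = f (y \<otimes>\<^bsub>H\<^esub> x))"

lemma class_functionD:
  "class_function H f \<Longrightarrow> x \<in> carrier H \<Longrightarrow> y \<in> carrier H \<Longrightarrow> f (x \<otimes>\<^bsub>H\<^esub> y) = f (y \<otimes>\<^bsub>H\<^esub> x)"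
  by (simp add: class_function_def)

lemma class_function_conj:
  fixes H (structure)
  assumes "group H" "class_function H f" "g \<in> carrier H" "y \<in> carrier H"
  shows "f (g \<otimes> y \<otimes> inv g) = f y"
proof -
  interpret H: group H by fact
  have "f (g \<otimes> y \<otimes> inv g) = f (inv g \<otimes> (g \<otimes> y))"
    by (rule class_functionD[OF assms(2)]) (use assms in auto)
  thus ?thesis using assms by (simp add: H.m_assoc[symmetric])
qed

lemma class_function_rep_character:
  "group H \<Longrightarrow> is_rep H n \<rho> \<Longrightarrow> class_function H (rep_character H n \<rho>)"
  unfolding class_function_def by (auto intro: rep_character_mult_commute)

text \<open>
  The convolution of \<open>f\<close> and \<open>g\<close>, with \<open>f\<close> evaluated at the inverse in place of a complex conjugate. Only
  field operations occur, so identities between convolutions are preserved by field automorphisms.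
\<close>

definition char_conv :: "('a, 'b) monoid_scheme \<Rightarrow> ('a \<Rightarrow> complex) \<Rightarrow> ('a \<Rightarrow> complex) \<Rightarrow> 'a \<Rightarrow> complex" where
  "char_conv H f g x = (\<Sum>y\<in>carrier H. f (inv\<^bsub>H\<^esub> y) * g (x \<otimes>\<^bsub>H\<^esub> y))"

lemma char_conv_commute:
  fixes H (structure)
  assumes H: "group H" and f: "class_function H f" and x: "x \<in> carrier H"
  shows "char_conv H f g x = char_conv H g f x"
proof -
  interpret H: group H by fact
  have "char_conv H f g x = (\<Sum>y\<in>carrier H. f (inv (inv x \<otimes> y)) * g (x \<otimes> (inv x \<otimes> y)))"
    unfolding char_conv_def
    by (rule sum_group_translate_left[OF H, symmetric, of "inv x" "\<lambda>y. f (inv y) * g (x \<otimes> y)"]) (use x in simp)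
  also have "\<dots> = (\<Sum>y\<in>carrier H. f (inv y \<otimes> x) * g y)"
    by (intro sum.cong refl) (use x in \<open>simp add: H.inv_mult_group H.m_assoc[symmetric]\<close>)
  also have "\<dots> = (\<Sum>y\<in>carrier H. f (y \<otimes> x) * g (inv y))"
    by (subst sum_group_inverse[OF H, symmetric]) simp
  also have "\<dots> = char_conv H g f x"
    unfolding char_conv_def
    by (intro sum.cong refl) (use x class_functionD[OF f] in \<open>simp add: mult.commute\<close>)
  finally show ?thesis .
qed

lemma Irr_cases:
  assumes "\<phi> \<in> Irr H"
  obtains n \<rho> where "irreducible_rep H n \<rho>" "is_rep H n \<rho>" "n > 0" "\<phi> = rep_character H n \<rho>"
  using assms irreducible_repD unfolding Irr_def by blast

lemma Irr_class_function:
  assumes "group H" "\<phi> \<in> Irr H"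
  shows "class_function H \<phi>"
  using assms by (elim Irr_cases) (auto intro: class_function_rep_character)

lemma Irr_degree:
  fixes H (structure)
  assumes "group H" "\<phi> \<in> Irr H"
  shows "\<phi> \<one> = of_nat (char_degree H \<phi>)" "char_degree H \<phi> > 0"
proof -
  obtain n \<rho> where "is_rep H n \<rho>" "n > 0" "\<phi> = rep_character H n \<rho>" using assms(2) by (rule Irr_cases)
  hence n: "\<phi> \<one> = of_nat n" using rep_character_one[OF assms(1)] by simp
  hence "char_degree H \<phi> = n" unfolding char_degree_def by (intro the_equality) auto
  thus "\<phi> \<one> = of_nat (char_degree H \<phi>)" "char_degree H \<phi> > 0" using n \<open>n > 0\<close> by auto
qed

lemma Irr_restrict: "\<phi> \<in> Irr H \<Longrightarrow> restrict \<phi> (carrier H) = \<phi>"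
  by (elim Irr_cases) (auto simp: rep_character_def)

lemma class_sum_acts_as_scalar_on_Irr:
  fixes G (structure)
  assumes G: "group G" and N: "N \<subseteq> carrier G" "\<And>g y. g \<in> carrier G \<Longrightarrow> y \<in> N \<Longrightarrow> g \<otimes> y \<otimes> inv g \<in> N"
    and \<phi>: "\<phi> \<in> Irr G"
    and f: "\<And>g y. g \<in> carrier G \<Longrightarrow> y \<in> N \<Longrightarrow> f (g \<otimes> y \<otimes> inv g) = f y"
  shows "\<exists>c. \<forall>x\<in>carrier G. (\<Sum>y\<in>N. f y * \<phi> (x \<otimes> y)) = c * \<phi> x"
proof -
  obtain n \<rho> where irr: "irreducible_rep G n \<rho>" and rep: "is_rep G n \<rho>"
    and \<phi>: "\<phi> = rep_character G n \<rho>" using \<phi> by (rule Irr_cases)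
  obtain c where c: "\<And>i j. i < n \<Longrightarrow> j < n \<Longrightarrow>
      (\<Sum>y\<in>N. f y * \<rho> y $$ (i, j)) = (if i = j then c else 0)"
    using class_sum_scalar[OF G N irr, of f] f by auto
  have "(\<Sum>y\<in>N. f y * \<phi> (x \<otimes> y)) = c * \<phi> x" if x: "x \<in> carrier G" for x
  proof -
    have "(\<Sum>y\<in>N. f y * \<phi> (x \<otimes> y)) = (\<Sum>y\<in>N. f y * (\<Sum>i<n. \<Sum>k<n. \<rho> x $$ (i, k) * \<rho> y $$ (k, i)))"
      unfolding \<phi> by (intro sum.cong refl) (use x N(1) in \<open>auto simp: rep_character_mult[OF G rep]\<close>)
    also have "\<dots> = (\<Sum>i<n. \<Sum>k<n. \<rho> x $$ (i, k) * (\<Sum>y\<in>N. f y * \<rho> y $$ (k, i)))"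
      by (simp add: sum_distrib_left mult_ac sum.swap[of _ N "{..<n}"])
    also have "\<dots> = (\<Sum>i<n. \<Sum>k<n. if k = i then \<rho> x $$ (i, i) * c else 0)"
      by (intro sum.cong refl) (auto simp: c)
    also have "\<dots> = c * \<phi> x" using x by (simp add: \<phi> rep_character_def sum_distrib_left mult.commute)
    finally show ?thesis .
  qed
  thus ?thesis by blast
qed

lemma char_conv_Irr_multiple:
  fixes H (structure)
  assumes H: "group H" and f: "class_function H f" and \<phi>: "\<phi> \<in> Irr H"
  shows "\<exists>c. \<forall>x\<in>carrier H. char_conv H f \<phi> x = c * \<phi> x"
proof -
  interpret H: group H by fact
  have "f (inv (g \<otimes> y \<otimes> inv g)) = f (inv y)" if "g \<in> carrier H" "y \<in> carrier H" for g y
    using class_function_conj[OF H f that(1), of "inv y"] that by (simp add: H.inv_mult_group H.m_assoc)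
  thus ?thesis unfolding char_conv_def
    using class_sum_acts_as_scalar_on_Irr[OF H _ _ \<phi>, of "carrier H" "\<lambda>y. f (inv y)"] by simp
qed

lemma char_inner_self:
  fixes H (structure)
  assumes H: "group H" and fin: "finite (carrier H)" and \<phi>: "\<phi> \<in> Irr H"
  shows "(\<Sum>y\<in>carrier H. \<phi> (inv y) * \<phi> y) = of_nat (card (carrier H))"
proof -
  interpret H: group H by fact
  obtain n \<rho> where irr: "irreducible_rep H n \<rho>" and rep: "is_rep H n \<rho>" and n: "n > 0"
    and \<phi>: "\<phi> = rep_character H n \<rho>" using \<phi> by (rule Irr_cases)
  have "(\<Sum>y\<in>carrier H. \<phi> (inv y) * \<phi> y) =
      (\<Sum>y\<in>carrier H. \<Sum>k<n. \<Sum>i<n. \<rho> y $$ (i, i) * \<rho> (inv y) $$ (k, k))"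
    unfolding \<phi> rep_character_def by (simp add: sum_distrib_left sum_distrib_right mult.commute)
  also have "\<dots> = (\<Sum>k<n. \<Sum>i<n. \<Sum>y\<in>carrier H. \<rho> y $$ (i, i) * \<rho> (inv y) $$ (k, k))"
    by (simp add: sum.swap[of _ "carrier H" "{..<n}"])
  also have "\<dots> = (\<Sum>k<n. \<Sum>i<n. if i = k then of_nat (card (carrier H)) / of_nat n else 0)"
    by (intro sum.cong refl) (auto simp: schur_orthogonality[OF H fin irr])
  also have "\<dots> = of_nat (card (carrier H))" using n by simp
  finally show ?thesis .
qed

lemma char_conv_self:
  fixes H (structure)
  assumes H: "group H" and fin: "finite (carrier H)" and \<phi>: "\<phi> \<in> Irr H" and x: "x \<in> carrier H"
  shows "char_conv H \<phi> \<phi> x = of_nat (card (carrier H)) / of_nat (char_degree H \<phi>) * \<phi> x"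
proof -
  interpret H: group H by fact
  obtain c where c: "\<And>x. x \<in> carrier H \<Longrightarrow> char_conv H \<phi> \<phi> x = c * \<phi> x"
    using char_conv_Irr_multiple[OF H Irr_class_function[OF H \<phi>] \<phi>] by blast
  have "c * of_nat (char_degree H \<phi>) = char_conv H \<phi> \<phi> \<one>"
    by (simp add: c Irr_degree(1)[OF H \<phi>])
  also have "\<dots> = of_nat (card (carrier H))"
    unfolding char_conv_def using char_inner_self[OF H fin \<phi>] by simp
  finally have "c = of_nat (card (carrier H)) / of_nat (char_degree H \<phi>)"
    using Irr_degree(2)[OF H \<phi>] by (simp add: field_simps)
  thus ?thesis using c[OF x] by simp
qed

text \<open>
  The convolution is a multiple of each of the two characters. If it were nonzero they would be
  proportional, and the factor would be \<open>1\<close>: its square is \<open>1\<close> because both characters have the same norm,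
  and it is positive because the degrees are.
\<close>

lemma char_conv_distinct:
  fixes H (structure)
  assumes H: "group H" and fin: "finite (carrier H)" and \<phi>: "\<phi> \<in> Irr H" and \<psi>: "\<psi> \<in> Irr H" and ne: "\<phi> \<noteq> \<psi>"
    and x: "x \<in> carrier H"
  shows "char_conv H \<phi> \<psi> x = 0"
proof -
  interpret H: group H by fact
  note clf = Irr_class_function[OF H]
  let ?h = "of_nat (card (carrier H)) :: complex"
  have h0: "?h \<noteq> 0" using fin H.one_closed by (auto simp: card_eq_0_iff)
  obtain c where c: "\<And>x. x \<in> carrier H \<Longrightarrow> char_conv H \<phi> \<psi> x = c * \<psi> x"
    using char_conv_Irr_multiple[OF H clf[OF \<phi>] \<psi>] by blast
  obtain d where d: "\<And>x. x \<in> carrier H \<Longrightarrow> char_conv H \<psi> \<phi> x = d * \<phi> x"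
    using char_conv_Irr_multiple[OF H clf[OF \<psi>] \<phi>] by blast
  have cd: "c * \<psi> x = d * \<phi> x" if "x \<in> carrier H" for x
    using c[OF that] d[OF that] char_conv_commute[OF H clf[OF \<phi>] that, of \<psi>] by simp
  show ?thesis
  proof (cases "c = 0")
    case False
    define t where "t = d / c"
    have t: "\<psi> y = t * \<phi> y" if "y \<in> carrier H" for y using cd[OF that] False by (simp add: t_def field_simps)
    have "char_conv H \<psi> \<psi> \<one> = t ^ 2 * char_conv H \<phi> \<phi> \<one>"
      unfolding char_conv_def by (simp add: t sum_distrib_left power2_eq_square mult_ac)
    moreover have "char_conv H \<phi> \<phi> \<one> = ?h" "char_conv H \<psi> \<psi> \<one> = ?h"
      unfolding char_conv_def using char_inner_self[OF H fin \<phi>] char_inner_self[OF H fin \<psi>] by simp_all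
    ultimately have "t ^ 2 = 1" using h0 by simp
    moreover have tdeg: "of_nat (char_degree H \<psi>) = t * of_nat (char_degree H \<phi>)"
      using t[OF H.one_closed] Irr_degree(1)[OF H \<phi>] Irr_degree(1)[OF H \<psi>] by simp
    have "t \<noteq> - 1"
    proof
      assume "t = - 1"
      hence "of_nat (char_degree H \<psi> + char_degree H \<phi>) = (0 :: complex)" using tdeg by simp
      thus False using Irr_degree(2)[OF H \<phi>] by (simp only: of_nat_eq_0_iff)
    qed
    ultimately have "t = 1" by (simp add: power2_eq_1_iff)
    hence "\<psi> y = \<phi> y" if "y \<in> carrier H" for y using t[OF that] by simp
    hence "restrict \<psi> (carrier H) = restrict \<phi> (carrier H)" by (auto simp: restrict_def)
    thus ?thesis using ne Irr_restrict[OF \<phi>] Irr_restrict[OF \<psi>] by simp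
  qed (use c x in simp)
qed

text \<open>
  The multiplicity of \<open>\<psi>\<close> in the character of \<open>\<tau>\<close> is realised as the trace of an idempotent matrix. With the
  matrix coefficient \<open>\<rho>\<^sub>0\<^sub>0\<close> of a representation affording \<open>\<psi>\<close>, the idempotent is
  \<open>P = (n/|H|) \<Sum> \<rho>\<^sub>0\<^sub>0(y\<^sup>-\<^sup>1) \<tau>(y)\<close>: that \<open>P\<close> is idempotent is Schur orthogonality, and replacing \<open>\<rho>\<^sub>0\<^sub>0\<close> by any other
  diagonal coefficient gives the same trace, so the trace equals the average over all of them, which is
  the inner product of the two characters.
\<close>

lemma char_inner_nat:
  fixes H (structure)
  assumes H: "group H" and fin: "finite (carrier H)" and \<psi>: "\<psi> \<in> Irr H" and \<tau>: "is_rep H m \<tau>"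
  shows "\<exists>k. (\<Sum>y\<in>carrier H. \<psi> (inv y) * rep_character H m \<tau> y) = of_nat (k * card (carrier H))"
proof -
  interpret H: group H by fact
  obtain n \<rho> where irr: "irreducible_rep H n \<rho>" and rep: "is_rep H n \<rho>" and n: "n > 0"
    and \<psi>: "\<psi> = rep_character H n \<rho>" using \<psi> by (rule Irr_cases)
  let ?h = "of_nat (card (carrier H)) :: complex"
  have h0: "?h \<noteq> 0" using fin H.one_closed by (auto simp: card_eq_0_iff)
  define q where "q = of_nat n / ?h"
  have q0: "q * (?h / of_nat n) = 1" using n h0 by (simp add: q_def)
  define P where "P = mat m m (\<lambda>(i, j). q * (\<Sum>y\<in>carrier H. \<rho> (inv y) $$ (0, 0) * \<tau> y $$ (i, j)))"
  have P: "P \<in> carrier_mat m m" by (simp add: P_def)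
  have "P * P = P"
  proof (rule eq_matI)
    fix i j assume "i < dim_row P" "j < dim_col P"
    hence ij: "i < m" "j < m" using P by auto
    have "(P * P) $$ (i, j) = (\<Sum>k<m. P $$ (i, k) * P $$ (k, j))"
      using ij P by (simp add: scalar_prod_def atLeast0LessThan)
    also have "\<dots> = q * q * (\<Sum>k<m. \<Sum>y\<in>carrier H. \<Sum>z\<in>carrier H.
        \<rho> (inv y) $$ (0, 0) * \<rho> (inv z) $$ (0, 0) * (\<tau> y $$ (i, k) * \<tau> z $$ (k, j)))"
      unfolding sum_distrib_left
      by (intro sum.cong refl) (use ij in \<open>simp add: P_def sum_product sum_distrib_left mult_ac\<close>)
    also have "\<dots> = q * q * (\<Sum>y\<in>carrier H. \<Sum>z\<in>carrier H.
        \<rho> (inv y) $$ (0, 0) * \<rho> (inv z) $$ (0, 0) * \<tau> (y \<otimes> z) $$ (i, j))"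
      using ij by (simp add: rep_mult_entry[OF H \<tau>] sum_distrib_left sum.swap[of _ "{..<m}"])
    also have "\<dots> = q * q * (\<Sum>y\<in>carrier H. \<Sum>z\<in>carrier H.
        \<rho> (inv y) $$ (0, 0) * \<rho> (inv (inv y \<otimes> z)) $$ (0, 0) * \<tau> (y \<otimes> (inv y \<otimes> z)) $$ (i, j))"
    proof (rule arg_cong[of _ _ "\<lambda>s. q * q * s"], rule sum.cong[OF refl])
      fix y assume y: "y \<in> carrier H"
      show "(\<Sum>z\<in>carrier H. \<rho> (inv y) $$ (0, 0) * \<rho> (inv z) $$ (0, 0) * \<tau> (y \<otimes> z) $$ (i, j)) =
        (\<Sum>z\<in>carrier H. \<rho> (inv y) $$ (0, 0) * \<rho> (inv (inv y \<otimes> z)) $$ (0, 0) * \<tau> (y \<otimes> (inv y \<otimes> z)) $$ (i, j))"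
        by (rule sum_group_translate_left[OF H, symmetric, of "inv y"
            "\<lambda>z. \<rho> (inv y) $$ (0, 0) * \<rho> (inv z) $$ (0, 0) * \<tau> (y \<otimes> z) $$ (i, j)"]) (use y in simp)
    qed
    also have "\<dots> = q * q * (\<Sum>y\<in>carrier H. \<Sum>w\<in>carrier H. \<tau> w $$ (i, j) *
        (\<Sum>k<n. \<rho> (inv w) $$ (0, k) * (\<rho> y $$ (k, 0) * \<rho> (inv y) $$ (0, 0))))"
      by (intro arg_cong[of _ _ "\<lambda>s. q * q * s"] sum.cong refl)
         (use n in \<open>simp add: H.inv_mult_group H.m_assoc[symmetric] rep_mult_entry[OF H rep] sum_distrib_left sum_distrib_right mult_ac\<close>)
    also have "\<dots> = q * q * (\<Sum>w\<in>carrier H. \<tau> w $$ (i, j) * (\<Sum>k<n. \<rho> (inv w) $$ (0, k) *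
        (\<Sum>y\<in>carrier H. \<rho> y $$ (k, 0) * \<rho> (inv y) $$ (0, 0))))"
    proof -
      have "(\<Sum>y\<in>carrier H. \<Sum>w\<in>carrier H. \<tau> w $$ (i, j) *
          (\<Sum>k<n. \<rho> (inv w) $$ (0, k) * (\<rho> y $$ (k, 0) * \<rho> (inv y) $$ (0, 0)))) =
        (\<Sum>w\<in>carrier H. \<tau> w $$ (i, j) * (\<Sum>y\<in>carrier H.
          \<Sum>k<n. \<rho> (inv w) $$ (0, k) * (\<rho> y $$ (k, 0) * \<rho> (inv y) $$ (0, 0))))"
        unfolding sum_distrib_left by (rule sum.swap)
      also have "\<dots> = (\<Sum>w\<in>carrier H. \<tau> w $$ (i, j) * (\<Sum>k<n. \<rho> (inv w) $$ (0, k) *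
        (\<Sum>y\<in>carrier H. \<rho> y $$ (k, 0) * \<rho> (inv y) $$ (0, 0))))"
      proof (intro sum.cong refl arg_cong2[of _ _ _ _ "(*)"])
        fix w
        show "(\<Sum>y\<in>carrier H. \<Sum>k<n. \<rho> (inv w) $$ (0, k) * (\<rho> y $$ (k, 0) * \<rho> (inv y) $$ (0, 0))) =
          (\<Sum>k<n. \<rho> (inv w) $$ (0, k) * (\<Sum>y\<in>carrier H. \<rho> y $$ (k, 0) * \<rho> (inv y) $$ (0, 0)))"
          unfolding sum_distrib_left by (rule sum.swap)
      qed
      finally show ?thesis by simp
    qed
    also have "\<dots> = q * q * (\<Sum>w\<in>carrier H. \<tau> w $$ (i, j) * (\<rho> (inv w) $$ (0, 0) * (?h / of_nat n)))"
    proof (intro arg_cong[of _ _ "\<lambda>s. q * q * s"] sum.cong refl arg_cong2[of _ _ _ _ "(*)"])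
      fix w
      have "(\<Sum>k<n. \<rho> (inv w) $$ (0, k) * (\<Sum>y\<in>carrier H. \<rho> y $$ (k, 0) * \<rho> (inv y) $$ (0, 0))) =
        (\<Sum>k<n. if k = 0 then \<rho> (inv w) $$ (0, 0) * (?h / of_nat n) else 0)"
        by (intro sum.cong refl) (use n in \<open>simp add: schur_orthogonality[OF H fin irr]\<close>)
      thus "(\<Sum>k<n. \<rho> (inv w) $$ (0, k) * (\<Sum>y\<in>carrier H. \<rho> y $$ (k, 0) * \<rho> (inv y) $$ (0, 0))) =
        \<rho> (inv w) $$ (0, 0) * (?h / of_nat n)" using n by simp
    qed
    also have "\<dots> = q * (q * (?h / of_nat n)) * (\<Sum>w\<in>carrier H. \<rho> (inv w) $$ (0, 0) * \<tau> w $$ (i, j))"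
      by (simp only: sum_distrib_left mult_ac)
    also have "\<dots> = P $$ (i, j)" unfolding q0 using ij by (simp add: P_def)
    finally show "(P * P) $$ (i, j) = P $$ (i, j)" .
  qed (use P in auto)
  then obtain k where k: "(\<Sum>i<m. P $$ (i, i)) = of_nat k"
    using idempotent_trace_nat[OF P] by blast
  let ?\<theta> = "rep_character H m \<tau>"
  have "class_function H ?\<theta>" by (rule class_function_rep_character[OF H \<tau>])
  hence "?\<theta> (inv (g \<otimes> y \<otimes> inv g)) = ?\<theta> (inv y)" if "g \<in> carrier H" "y \<in> carrier H" for g y
    using class_function_conj[OF H _ that(1), of ?\<theta> "inv y"] that by (simp add: H.inv_mult_group H.m_assoc)
  then obtain l where l: "\<And>i j. i < n \<Longrightarrow> j < n \<Longrightarrow>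
      (\<Sum>y\<in>carrier H. ?\<theta> (inv y) * \<rho> y $$ (i, j)) = (if i = j then l else 0)"
    using class_sum_scalar[OF H _ _ irr, of "carrier H" "\<lambda>y. ?\<theta> (inv y)"] by auto
  have inv: "(\<Sum>y\<in>carrier H. ?\<theta> (inv y) * f y) = (\<Sum>y\<in>carrier H. f (inv y) * ?\<theta> y)" for f :: "_ \<Rightarrow> complex"
    by (subst sum_group_inverse[OF H, symmetric]) (simp add: mult.commute)
  have "(\<Sum>i<m. P $$ (i, i)) = q * (\<Sum>y\<in>carrier H. \<rho> (inv y) $$ (0, 0) * (\<Sum>i<m. \<tau> y $$ (i, i)))"
    by (simp add: P_def sum_distrib_left sum.swap[of _ "{..<m}"])
  also have "(\<Sum>y\<in>carrier H. \<rho> (inv y) $$ (0, 0) * (\<Sum>i<m. \<tau> y $$ (i, i))) =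
      (\<Sum>y\<in>carrier H. \<rho> (inv y) $$ (0, 0) * ?\<theta> y)"
    by (intro sum.cong refl) (simp add: rep_character_def)
  also have "\<dots> = l" using l[of 0 0] n inv[of "\<lambda>y. \<rho> y $$ (0, 0)"] by simp
  finally have ql: "q * l = of_nat k" using k by simp
  have "(\<Sum>y\<in>carrier H. \<psi> (inv y) * ?\<theta> y) = (\<Sum>y\<in>carrier H. ?\<theta> (inv y) * \<psi> y)"
    using inv[of \<psi>] by simp
  also have "\<dots> = (\<Sum>i<n. \<Sum>y\<in>carrier H. ?\<theta> (inv y) * \<rho> y $$ (i, i))"
    by (simp add: \<psi> rep_character_def[of H n \<rho>] sum_distrib_left sum.swap[of _ "{..<n}"])
  also have "\<dots> = of_nat n * l" by (simp add: l)
  also have "\<dots> = ?h * (q * l)" using h0 by (simp add: q_def)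
  finally show ?thesis unfolding ql by (intro exI[of _ k]) (simp add: mult.commute)
qed

section \<open>Conjugate characters and Clifford's theorem\<close>

lemma normal_subgroup_simps:
  fixes G (structure)
  assumes "N \<lhd> G"
  shows "group (G\<lparr>carrier := N\<rparr>)"
    and "x \<in> N \<Longrightarrow> inv\<^bsub>G\<lparr>carrier := N\<rparr>\<^esub> x = inv x"
    and "N \<subseteq> carrier G"
    and "g \<in> carrier G \<Longrightarrow> y \<in> N \<Longrightarrow> g \<otimes> y \<otimes> inv g \<in> N"
    and "g \<in> carrier G \<Longrightarrow> y \<in> N \<Longrightarrow> inv g \<otimes> y \<otimes> g \<in> N"
    and "\<one> \<in> N"
proof -
  interpret normal N G by fact
  show "\<one> \<in> N" by (rule subgroup.one_closed[OF is_subgroup])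
  show "group (G\<lparr>carrier := N\<rparr>)" by (rule subgroup_is_group) (rule is_group)
  show "x \<in> N \<Longrightarrow> inv\<^bsub>G\<lparr>carrier := N\<rparr>\<^esub> x = inv x"
    using m_inv_consistent[OF is_subgroup] by simp
  show "N \<subseteq> carrier G" by (rule subset)
  show "g \<in> carrier G \<Longrightarrow> y \<in> N \<Longrightarrow> g \<otimes> y \<otimes> inv g \<in> N" by (rule inv_op_closed2)
  show "g \<in> carrier G \<Longrightarrow> y \<in> N \<Longrightarrow> inv g \<otimes> y \<otimes> g \<in> N" by (rule inv_op_closed1)
qed

lemma conj_conj_cancel:
  fixes G (structure)
  assumes "group G" "g \<in> carrier G" "x \<in> carrier G"
  shows "inv g \<otimes> (g \<otimes> x \<otimes> inv g) \<otimes> g = x"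
    "g \<otimes> (inv g \<otimes> x \<otimes> g) \<otimes> inv g = x"
proof -
  interpret group G by fact
  show "inv g \<otimes> (g \<otimes> x \<otimes> inv g) \<otimes> g = x"
    "g \<otimes> (inv g \<otimes> x \<otimes> g) \<otimes> inv g = x"
    using assms(2,3) by (metis inv_closed inv_solve_left' inv_solve_right' m_assoc m_closed)+
qed

lemma conj_char_Irr:
  fixes G (structure)
  assumes G: "group G" and N: "N \<lhd> G" and \<psi>: "\<psi> \<in> Irr (G\<lparr>carrier := N\<rparr>)" and g: "g \<in> carrier G"
  shows "conj_char G N g \<psi> \<in> Irr (G\<lparr>carrier := N\<rparr>)"
proof -
  interpret G: group G by fact
  note NS = normal_subgroup_simps[OF N]
  let ?H = "G\<lparr>carrier := N\<rparr>"
  let ?c = "\<lambda>x. inv g \<otimes> x \<otimes> g"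
  obtain n \<rho> where irr: "irreducible_rep ?H n \<rho>" and rep: "is_rep ?H n \<rho>" and n: "n > 0"
    and \<psi>: "\<psi> = rep_character ?H n \<rho>" using \<psi> by (rule Irr_cases)
  have mult: "?c (x \<otimes> y) = ?c x \<otimes> ?c y" if "x \<in> N" "y \<in> N" for x y
  proof -
    have [simp]: "x \<in> carrier G" "y \<in> carrier G" using that NS(3) by auto
    have canc: "g \<otimes> (inv g \<otimes> z) = z" if "z \<in> carrier G" for z
      using g that by (simp add: G.m_assoc[symmetric])
    show ?thesis using g by (simp add: G.m_assoc canc)
  qed
  define \<rho>' where "\<rho>' = (\<lambda>x. \<rho> (?c x))"
  have h: "\<rho> \<in> hom ?H (units_of (ring_mat TYPE(complex) n ()))" using rep by (simp add: is_rep_def)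
  have "\<rho>' \<in> hom ?H (units_of (ring_mat TYPE(complex) n ()))"
  proof (rule homI)
    fix x assume "x \<in> carrier ?H"
    hence "?c x \<in> carrier ?H" using NS(5)[OF g] by simp
    thus "\<rho>' x \<in> carrier (units_of (ring_mat TYPE(complex) n ()))"
      using h by (auto simp: hom_def \<rho>'_def)
  next
    fix x y assume "x \<in> carrier ?H" "y \<in> carrier ?H"
    hence xy: "x \<in> N" "y \<in> N" by auto
    show "\<rho>' (x \<otimes>\<^bsub>?H\<^esub> y) = \<rho>' x \<otimes>\<^bsub>units_of (ring_mat TYPE(complex) n ())\<^esub> \<rho>' y"
      using hom_mult[OF h, of "?c x" "?c y"] NS(5)[OF g] xy mult[OF xy] by (simp add: \<rho>'_def)
  qed
  hence rep': "is_rep ?H n \<rho>'" by (simp add: is_rep_def)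
  have "irreducible_rep ?H n \<rho>'"
    unfolding irreducible_rep_def
  proof (intro conjI allI impI rep' n)
    fix W assume W: "VectorSpace.subspace class_ring W (module_vec TYPE(complex) n)"
      and inv: "\<forall>x\<in>carrier ?H. \<forall>v\<in>W. \<rho>' x *\<^sub>v v \<in> W"
    have "\<forall>x\<in>carrier ?H. \<forall>v\<in>W. \<rho> x *\<^sub>v v \<in> W"
    proof (intro ballI)
      fix x v assume x: "x \<in> carrier ?H" and v: "v \<in> W"
      hence xc: "x \<in> carrier G" using NS(3) by auto
      have "\<rho>' (g \<otimes> x \<otimes> inv g) = \<rho> x"
        unfolding \<rho>'_def by (simp only: conj_conj_cancel[OF G g xc])
      moreover have "g \<otimes> x \<otimes> inv g \<in> carrier ?H" using NS(4)[OF g] x by simp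
      ultimately show "\<rho> x *\<^sub>v v \<in> W" using inv v by metis
    qed
    thus "W = {0\<^sub>v n} \<or> W = carrier_vec n" using irr W by (simp add: irreducible_rep_def)
  qed
  moreover have "conj_char G N g \<psi> = rep_character ?H n \<rho>'"
    unfolding conj_char_def rep_character_def \<psi> \<rho>'_def
    by (auto simp: fun_eq_iff NS(5)[OF g] restrict_def)
  ultimately show ?thesis by (auto simp: Irr_def)
qed

lemma conj_char_mult:
  fixes G (structure)
  assumes G: "group G" and N: "N \<lhd> G" and g: "g \<in> carrier G" and h: "h \<in> carrier G"
  shows "conj_char G N (g \<otimes> h) \<psi> = conj_char G N g (conj_char G N h \<psi>)"
proof -
  interpret G: group G by fact
  note NS = normal_subgroup_simps[OF N]
  show ?thesis
    unfolding conj_char_def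
  proof (rule restrict_ext)
    fix x assume x: "x \<in> N"
    have xc: "x \<in> carrier G" using x NS(3) by auto
    have "inv (g \<otimes> h) \<otimes> x \<otimes> (g \<otimes> h) = inv h \<otimes> (inv g \<otimes> x \<otimes> g) \<otimes> h"
      using g h xc by (simp add: G.inv_mult_group G.m_assoc)
    thus "\<psi> (inv (g \<otimes> h) \<otimes> x \<otimes> (g \<otimes> h)) =
        (\<lambda>x\<in>N. \<psi> (inv h \<otimes> x \<otimes> h)) (inv g \<otimes> x \<otimes> g)"
      using NS(5)[OF g x] by simp
  qed
qed

lemma conj_char_one:
  fixes G (structure)
  assumes G: "group G" and N: "N \<lhd> G" and \<psi>: "\<psi> \<in> Irr (G\<lparr>carrier := N\<rparr>)"
  shows "conj_char G N \<one> \<psi> = \<psi>"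
proof -
  interpret G: group G by fact
  note NS = normal_subgroup_simps[OF N]
  have "conj_char G N \<one> \<psi> = restrict \<psi> N"
    unfolding conj_char_def by (rule restrict_ext) (use NS(3) in auto)
  thus ?thesis using Irr_restrict[OF \<psi>] by simp
qed

definition conj_orbit :: "('a, 'b) monoid_scheme \<Rightarrow> 'a set \<Rightarrow> ('a \<Rightarrow> complex) \<Rightarrow> ('a \<Rightarrow> complex) set" where
  "conj_orbit G N \<psi> = (\<lambda>g. conj_char G N g \<psi>) ` carrier G"

lemma conj_orbit_conj:
  assumes G: "group G" and N: "N \<lhd> G" and g: "g \<in> carrier G" and \<phi>: "\<phi> \<in> conj_orbit G N \<psi>"
  shows "conj_char G N g \<phi> \<in> conj_orbit G N \<psi>"
proof -
  interpret G: group G by fact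
  show ?thesis using \<phi> g conj_char_mult[OF G N g, symmetric] by (auto simp: conj_orbit_def)
qed

lemma conj_orbit_Irr:
  assumes G: "group G" and N: "N \<lhd> G" and \<psi>: "\<psi> \<in> Irr (G\<lparr>carrier := N\<rparr>)"
  shows "conj_orbit G N \<psi> \<subseteq> Irr (G\<lparr>carrier := N\<rparr>)"
  using conj_char_Irr[OF G N \<psi>] by (auto simp: conj_orbit_def)

lemma conj_orbit_self:
  fixes G (structure)
  assumes G: "group G" and N: "N \<lhd> G" and \<psi>: "\<psi> \<in> Irr (G\<lparr>carrier := N\<rparr>)"
  shows "\<psi> \<in> conj_orbit G N \<psi>"
proof -
  interpret G: group G by fact
  show ?thesis unfolding conj_orbit_def
    by (rule image_eqI[of _ _ "\<one>"]) (simp_all add: conj_char_one[OF G N \<psi>])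
qed

lemma conj_orbit_at_one:
  fixes G (structure)
  assumes G: "group G" and N: "N \<lhd> G" and \<phi>: "\<phi> \<in> conj_orbit G N \<psi>"
  shows "\<phi> \<one> = \<psi> \<one>"
proof -
  interpret G: group G by fact
  interpret N: normal N G by fact
  show ?thesis using \<phi> by (auto simp: conj_orbit_def conj_char_def)
qed

lemma conj_orbit_degree:
  assumes G: "group G" and N: "N \<lhd> G" and \<phi>: "\<phi> \<in> conj_orbit G N \<psi>"
  shows "char_degree (G\<lparr>carrier := N\<rparr>) \<phi> = char_degree (G\<lparr>carrier := N\<rparr>) \<psi>"
  using conj_orbit_at_one[OF assms] by (simp add: char_degree_def)

lemma sum_conj_orbit_invariant:
  fixes G (structure)
  assumes G: "group G" and N: "N \<lhd> G" and \<psi>: "\<psi> \<in> Irr (G\<lparr>carrier := N\<rparr>)"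
    and g: "g \<in> carrier G" and x: "x \<in> N"
  shows "(\<Sum>\<phi>\<in>conj_orbit G N \<psi>. \<phi> (g \<otimes> x \<otimes> inv g)) = (\<Sum>\<phi>\<in>conj_orbit G N \<psi>. \<phi> x)"
proof -
  interpret G: group G by fact
  have gi: "inv g \<in> carrier G" using g by simp
  have canc: "conj_char G N a (conj_char G N b \<phi>) = \<phi>" 
    if "a \<in> carrier G" "b \<in> carrier G" "a \<otimes> b = \<one>" "\<phi> \<in> conj_orbit G N \<psi>" for a b \<phi>
    using conj_char_mult[OF G N that(1,2), of \<phi>, symmetric] that(3,4) conj_char_one[OF G N] conj_orbit_Irr[OF G N \<psi>] by auto
  have "(\<Sum>\<phi>\<in>conj_orbit G N \<psi>. (conj_char G N (inv g) \<phi>) x) = (\<Sum>\<phi>\<in>conj_orbit G N \<psi>. \<phi> x)"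
    by (rule sum.reindex_bij_witness[of _ "conj_char G N g" "conj_char G N (inv g)"])
       (use g gi canc conj_orbit_conj[OF G N] in auto)
  moreover have "conj_char G N (inv g) \<phi> x = \<phi> (g \<otimes> x \<otimes> inv g)" for \<phi>
    using x g by (simp add: conj_char_def)
  ultimately show ?thesis by simp
qed

text \<open>
  Clifford's theorem. The sum \<open>s\<close> of the orbit of \<open>\<psi>\<close> is invariant under \<open>G\<close>, so the corresponding element
  of the group algebra of \<open>N\<close> acts as a scalar \<open>c\<close> on the irreducible representation of \<open>G\<close>. On the other
  hand, convolving \<open>\<chi>\<close> with an irreducible character \<open>\<phi>\<close> of \<open>N\<close> gives a multiple of \<open>\<phi>\<close>, with the same factor
  for all \<open>\<phi>\<close> in the orbit. Hence \<open>c\<chi>\<close> is a multiple of \<open>s\<close> on \<open>N\<close>, and \<open>c\<close> is nonzero because \<open>\<psi>\<close> is a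
  constituent. The factor is the inner product of \<open>\<chi>\<close> and \<open>\<psi>\<close>, which is a positive integer.
\<close>

lemma restriction_eq_multiple_of_orbit_sum:
  fixes G (structure)
  assumes G: "group G" and fin: "finite (carrier G)" and N: "N \<lhd> G"
    and \<chi>: "\<chi> \<in> Irr G" and \<psi>: "\<psi> \<in> Irr (G\<lparr>carrier := N\<rparr>)"
    and cons: "constituent (G\<lparr>carrier := N\<rparr>) \<psi> (restrict \<chi> N)"
  shows "\<exists>e::nat. e > 0 \<and> (\<forall>x\<in>N. \<chi> x = of_nat e * (\<Sum>\<phi>\<in>conj_orbit G N \<psi>. \<phi> x))"
proof -
  interpret G: group G by fact
  interpret N: normal N G by fact
  note NS = normal_subgroup_simps[OF N]
  let ?H = "G\<lparr>carrier := N\<rparr>"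
  let ?X = "conj_orbit G N \<psi>"
  interpret H: group ?H by (rule NS(1))
  have finN: "finite N" using fin NS(3) finite_subset by blast
  have finH: "finite (carrier ?H)" using finN by simp
  have finX: "finite ?X" using fin by (simp add: conj_orbit_def)
  have XIrr: "?X \<subseteq> Irr ?H" by (rule conj_orbit_Irr[OF G N \<psi>])
  have Nc: "x \<in> carrier G" if "x \<in> N" for x using that NS(3) by auto
  let ?h = "of_nat (card N) :: complex"
  have h0: "?h \<noteq> 0" using finN NS(6) by (metis card_eq_0_iff empty_iff of_nat_eq_0_iff)
  define d where "d = char_degree ?H \<psi>"
  have d0: "d > 0" using Irr_degree(2)[OF NS(1) \<psi>] by (simp add: d_def)
  have X1: "\<phi> \<one> = of_nat d" if "\<phi> \<in> ?X" for \<phi>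
    using conj_orbit_at_one[OF G N that] Irr_degree(1)[OF NS(1) \<psi>] by (simp add: d_def)
  \<comment> \<open>\<open>I \<phi>\<close> is \<open>|N|\<close> times the inner product of \<open>\<chi>\<close> and \<open>\<phi>\<close>; it is constant on the orbit.\<close>
  define I where "I = (\<lambda>\<phi>. \<Sum>y\<in>N. \<phi> (inv y) * \<chi> y)"
  have chi_conj: "\<chi> (g \<otimes> y \<otimes> inv g) = \<chi> y" if "g \<in> carrier G" "y \<in> carrier G" for g y
    by (rule class_function_conj[OF G Irr_class_function[OF G \<chi>] that])
  have I_eq: "I \<phi> = I \<psi>" if "\<phi> \<in> ?X" for \<phi>
  proof -
    obtain g where g: "g \<in> carrier G" "\<phi> = conj_char G N g \<psi>" using \<open>\<phi> \<in> ?X\<close> by (auto simp: conj_orbit_def)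
    have gi: "inv g \<in> carrier G" using g by simp
    have "I \<phi> = (\<Sum>y\<in>N. \<psi> (inv (inv g \<otimes> y \<otimes> inv (inv g))) * \<chi> (inv g \<otimes> y \<otimes> inv (inv g)))"
      unfolding I_def
    proof (intro sum.cong refl arg_cong2[of _ _ _ _ "(*)"])
      fix y assume y: "y \<in> N"
      show "\<phi> (inv y) = \<psi> (inv (inv g \<otimes> y \<otimes> inv (inv g)))"
        using y g(1) Nc[OF y] by (simp add: g(2) conj_char_def G.inv_mult_group G.m_assoc)
      show "\<chi> y = \<chi> (inv g \<otimes> y \<otimes> inv (inv g))"
        by (rule chi_conj[OF gi Nc[OF y], symmetric])
    qed
    also have "\<dots> = I \<psi>"
      unfolding I_def by (rule sum_conjugate[OF G NS(3,4) gi, of "\<lambda>y. \<psi> (inv y) * \<chi> y"])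
    finally show ?thesis .
  qed
  obtain m where m: "m > 0" "I \<psi> = of_nat m * ?h"
  proof -
    obtain r \<tau> where \<tau>: "is_rep ?H r \<tau>" and eq: "\<And>x. x \<in> N \<Longrightarrow> \<chi> x = \<psi> x + rep_character ?H r \<tau> x"
      using cons unfolding constituent_def by auto
    obtain k where k: "(\<Sum>y\<in>carrier ?H. \<psi> (inv\<^bsub>?H\<^esub> y) * rep_character ?H r \<tau> y) = of_nat (k * card (carrier ?H))"
      using char_inner_nat[OF NS(1) finH \<psi> \<tau>] by blast
    have "I \<psi> = (\<Sum>y\<in>carrier ?H. \<psi> (inv\<^bsub>?H\<^esub> y) * \<psi> y) + (\<Sum>y\<in>carrier ?H. \<psi> (inv\<^bsub>?H\<^esub> y) * rep_character ?H r \<tau> y)"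
      unfolding I_def sum.distrib[symmetric]
      by (intro sum.cong) (auto simp: eq NS(2) distrib_left)
    also have "\<dots> = of_nat (Suc k) * ?h"
      unfolding k char_inner_self[OF NS(1) finH \<psi>] by (simp add: algebra_simps)
    finally show thesis using that[of "Suc k"] by simp
  qed
  \<comment> \<open>The orbit sum, read as an element of the group algebra, acts as the scalar \<open>c\<close>.\<close>
  define s where "s = (\<lambda>x. \<Sum>\<phi>\<in>?X. \<phi> x)"
  have s_inv: "s (inv (g \<otimes> y \<otimes> inv g)) = s (inv y)" if "g \<in> carrier G" "y \<in> N" for g y
  proof -
    have "inv (g \<otimes> y \<otimes> inv g) = g \<otimes> inv y \<otimes> inv g"
      using that Nc[OF that(2)] by (simp add: G.inv_mult_group G.m_assoc)
    thus ?thesis using sum_conj_orbit_invariant[OF G N \<psi> that(1), of "inv y"] that(2) by (simp add: s_def)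
  qed
  obtain c where c: "\<And>x. x \<in> carrier G \<Longrightarrow> (\<Sum>y\<in>N. s (inv y) * \<chi> (x \<otimes> y)) = c * \<chi> x"
    using class_sum_acts_as_scalar_on_Irr[OF G NS(3,4) \<chi>, of "\<lambda>y. s (inv y)"] s_inv by auto
  have clf: "class_function ?H \<chi>"
    using class_functionD[OF Irr_class_function[OF G \<chi>]] Nc by (auto simp: class_function_def)
  have conv: "(\<Sum>y\<in>N. \<phi> (inv y) * \<chi> (x \<otimes> y)) = I \<psi> / of_nat d * \<phi> x" if \<phi>: "\<phi> \<in> ?X" and x: "x \<in> N" for \<phi> x
  proof -
    have \<phi>I: "\<phi> \<in> Irr ?H" using \<phi> XIrr by auto
    obtain l where l: "\<And>x. x \<in> carrier ?H \<Longrightarrow> char_conv ?H \<chi> \<phi> x = l * \<phi> x"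
      using char_conv_Irr_multiple[OF NS(1) clf \<phi>I] by blast
    have conv_l: "(\<Sum>y\<in>N. \<phi> (inv y) * \<chi> (x \<otimes> y)) = l * \<phi> x" if x: "x \<in> N" for x
    proof -
      have "(\<Sum>y\<in>N. \<phi> (inv y) * \<chi> (x \<otimes> y)) = char_conv ?H \<phi> \<chi> x"
        unfolding char_conv_def by (intro sum.cong) (auto simp: NS(2))
      also have "\<dots> = char_conv ?H \<chi> \<phi> x"
        by (rule char_conv_commute[OF NS(1) Irr_class_function[OF NS(1) \<phi>I]]) (use x in simp)
      finally show ?thesis using l x by simp
    qed
    have "I \<phi> = (\<Sum>y\<in>N. \<phi> (inv y) * \<chi> (\<one> \<otimes> y))"
      unfolding I_def by (intro sum.cong refl) (use Nc in auto)
    also have "\<dots> = l * of_nat d" using conv_l[OF NS(6)] X1[OF \<phi>] by simp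
    finally have "l = I \<psi> / of_nat d" using I_eq[OF \<phi>] d0 by (simp add: field_simps)
    thus ?thesis using conv_l[OF x] by simp
  qed
  have c_chi: "c * \<chi> x = I \<psi> / of_nat d * s x" if x: "x \<in> N" for x
  proof -
    have "c * \<chi> x = (\<Sum>y\<in>N. s (inv y) * \<chi> (x \<otimes> y))" using c[OF Nc[OF x]] by simp
    also have "\<dots> = (\<Sum>\<phi>\<in>?X. \<Sum>y\<in>N. \<phi> (inv y) * \<chi> (x \<otimes> y))"
      unfolding s_def sum_distrib_right by (rule sum.swap)
    also have "\<dots> = I \<psi> / of_nat d * s x"
      unfolding s_def sum_distrib_left by (intro sum.cong refl conv x) 
    finally show ?thesis .
  qed
  have s1: "s \<one> = of_nat (card ?X * d)" unfolding s_def by (simp add: X1)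
  have "card ?X > 0" using finX conj_orbit_self[OF G N \<psi>] by (auto simp: card_gt_0_iff)
  hence "c * \<chi> \<one> \<noteq> 0"
    unfolding c_chi[OF NS(6)] s1 using m d0 h0 by simp
  hence c0: "c \<noteq> 0" by auto
  define e where "e = I \<psi> / of_nat d / c"
  have chi_e: "\<chi> x = e * s x" if "x \<in> N" for x
  proof -
    have "\<chi> x = c * \<chi> x / c" using c0 by simp
    thus ?thesis unfolding c_chi[OF that] by (simp add: e_def)
  qed
  have "I \<psi> = e * (\<Sum>\<phi>\<in>?X. \<Sum>y\<in>N. \<psi> (inv y) * \<phi> y)"
  proof -
    have "I \<psi> = (\<Sum>y\<in>N. \<Sum>\<phi>\<in>?X. e * (\<psi> (inv y) * \<phi> y))"
      unfolding I_def by (intro sum.cong refl) (simp add: chi_e s_def sum_distrib_left mult_ac)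
    also have "\<dots> = (\<Sum>\<phi>\<in>?X. \<Sum>y\<in>N. e * (\<psi> (inv y) * \<phi> y))" by (rule sum.swap)
    finally show ?thesis by (simp add: sum_distrib_left)
  qed
  also have "(\<Sum>\<phi>\<in>?X. \<Sum>y\<in>N. \<psi> (inv y) * \<phi> y) = (\<Sum>\<phi>\<in>?X. if \<phi> = \<psi> then ?h else 0)"
  proof (intro sum.cong refl)
    fix \<phi> assume \<phi>: "\<phi> \<in> ?X"
    hence \<phi>I: "\<phi> \<in> Irr ?H" using XIrr by auto
    have "(\<Sum>y\<in>N. \<psi> (inv y) * \<phi> y) = char_conv ?H \<psi> \<phi> \<one>\<^bsub>?H\<^esub>"
      unfolding char_conv_def by (intro sum.cong) (auto simp: NS(2) Nc)
    also have "\<dots> = (if \<phi> = \<psi> then ?h else 0)"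
    proof (cases "\<phi> = \<psi>")
      case True
      thus ?thesis using char_conv_self[OF NS(1) finH \<psi> H.one_closed] Irr_degree[OF NS(1) \<psi>] by simp
    next
      case False
      thus ?thesis using char_conv_distinct[OF NS(1) finH \<psi> \<phi>I _ H.one_closed] by auto
    qed
    finally show "(\<Sum>y\<in>N. \<psi> (inv y) * \<phi> y) = (if \<phi> = \<psi> then ?h else 0)" .
  qed
  also have "\<dots> = ?h" using finX conj_orbit_self[OF G N \<psi>] by simp
  finally have "e = of_nat m" using m(2) h0 by simp
  thus ?thesis using m(1) chi_e by (intro exI[of _ m]) (simp add: s_def)
qed

text \<open>
  The left coset of \<open>g\<close> modulo the inertia group is the set of all elements that conjugate \<open>\<psi>\<close> in the same
  way as \<open>g\<close>.
\<close>

lemma lcosets_inertia_bij: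
  fixes G (structure)
  assumes G: "group G" and N: "N \<lhd> G" and \<psi>: "\<psi> \<in> Irr (G\<lparr>carrier := N\<rparr>)"
  shows "bij_betw (\<lambda>C. conj_char G N (SOME g. g \<in> C) \<psi>) (lcosets (inertia_group G N \<psi>)) (conj_orbit G N \<psi>)"
proof -
  interpret G: group G by fact
  let ?I = "inertia_group G N \<psi>"
  have coset: "g <# ?I = {h \<in> carrier G. conj_char G N h \<psi> = conj_char G N g \<psi>}" if g: "g \<in> carrier G" for g
  proof (intro equalityI subsetI)
    fix x assume "x \<in> g <# ?I"
    then obtain i where i: "i \<in> carrier G" "conj_char G N i \<psi> = \<psi>" "x = g \<otimes> i"
      by (auto simp: l_coset_def inertia_group_def)
    thus "x \<in> {h \<in> carrier G. conj_char G N h \<psi> = conj_char G N g \<psi>}"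
      using conj_char_mult[OF G N g i(1), of \<psi>] g by simp
  next
    fix x assume x: "x \<in> {h \<in> carrier G. conj_char G N h \<psi> = conj_char G N g \<psi>}"
    let ?i = "inv g \<otimes> x"
    have "conj_char G N ?i \<psi> = conj_char G N (inv g) (conj_char G N g \<psi>)"
      using x g conj_char_mult[OF G N, of "inv g" x \<psi>] by simp
    also have "\<dots> = \<psi>"
      using g conj_char_mult[OF G N, of "inv g" g \<psi>] conj_char_one[OF G N \<psi>] by simp
    finally have "?i \<in> ?I" using x g by (simp add: inertia_group_def)
    moreover have "x = g \<otimes> ?i" using x g by (simp add: G.m_assoc[symmetric])
    ultimately show "x \<in> g <# ?I" unfolding l_coset_def by blast
  qed
  have rep: "conj_char G N (SOME h. h \<in> g <# ?I) \<psi> = conj_char G N g \<psi>" if g: "g \<in> carrier G" for g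
  proof -
    have "g \<in> g <# ?I" using g by (simp add: coset)
    hence "(SOME h. h \<in> g <# ?I) \<in> g <# ?I" by (rule someI)
    thus ?thesis using coset[OF g] by blast
  qed
  show ?thesis
    unfolding bij_betw_def
  proof
    show "inj_on (\<lambda>C. conj_char G N (SOME g. g \<in> C) \<psi>) (lcosets ?I)"
    proof (rule inj_onI)
      fix C D assume "C \<in> lcosets ?I" "D \<in> lcosets ?I"
        and eq: "conj_char G N (SOME g. g \<in> C) \<psi> = conj_char G N (SOME g. g \<in> D) \<psi>"
      then obtain a b where ab: "a \<in> carrier G" "b \<in> carrier G" "C = a <# ?I" "D = b <# ?I"
        by (auto simp: LCOSETS_def)
      hence "conj_char G N a \<psi> = conj_char G N b \<psi>" using eq rep by simp
      thus "C = D" using ab coset by simp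
    qed
    show "(\<lambda>C. conj_char G N (SOME g. g \<in> C) \<psi>) ` (lcosets ?I) = conj_orbit G N \<psi>"
      by (auto simp: LCOSETS_def rep conj_orbit_def image_UN)
  qed
qed

text \<open>
  The sum over cosets in the definition of the ramification index is the sum over the orbit, and the
  value at the identity determines the index.
\<close>

lemma clifford:
  fixes G (structure)
  assumes G: "group G" and fin: "finite (carrier G)" and N: "N \<lhd> G"
    and \<chi>: "\<chi> \<in> Irr G" and \<psi>: "\<psi> \<in> Irr (G\<lparr>carrier := N\<rparr>)"
    and cons: "constituent (G\<lparr>carrier := N\<rparr>) \<psi> (restrict \<chi> N)"
  shows "ramification_index G N \<chi> \<psi> > 0"
    and "x \<in> N \<Longrightarrow> \<chi> x = of_nat (ramification_index G N \<chi> \<psi>) * (\<Sum>\<phi>\<in>conj_orbit G N \<psi>. \<phi> x)"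
proof -
  interpret N: normal N G by fact
  note NS = normal_subgroup_simps[OF N]
  let ?X = "conj_orbit G N \<psi>"
  have sum_eq: "(\<Sum>C\<in>lcosets (inertia_group G N \<psi>). conj_char G N (SOME g. g \<in> C) \<psi> x) = (\<Sum>\<phi>\<in>?X. \<phi> x)" for x
    by (rule sum.reindex_bij_betw[OF lcosets_inertia_bij[OF G N \<psi>]])
  obtain e where e: "e > 0" "\<And>x. x \<in> N \<Longrightarrow> \<chi> x = of_nat e * (\<Sum>\<phi>\<in>?X. \<phi> x)"
    using restriction_eq_multiple_of_orbit_sum[OF assms] by blast
  have "ramification_index G N \<chi> \<psi> = e"
    unfolding ramification_index_def sum_eq
  proof (rule the_equality)
    show "0 < e \<and> (\<forall>x\<in>N. \<chi> x = of_nat e * (\<Sum>\<phi>\<in>?X. \<phi> x))" using e by blast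
    fix e' assume "0 < e' \<and> (\<forall>x\<in>N. \<chi> x = of_nat e' * (\<Sum>\<phi>\<in>?X. \<phi> x))"
    hence "of_nat e' * (\<Sum>\<phi>\<in>?X. \<phi> \<one>) = of_nat e * (\<Sum>\<phi>\<in>?X. \<phi> \<one>)"
      using e(2)[OF NS(6)] NS(6) by metis
    moreover have "(\<Sum>\<phi>\<in>?X. \<phi> \<one>) \<noteq> 0"
      using e(2)[OF NS(6)] Irr_degree[OF G \<chi>] by auto
    ultimately show "e' = e" by simp
  qed
  thus "ramification_index G N \<chi> \<psi> > 0"
    and "x \<in> N \<Longrightarrow> \<chi> x = of_nat (ramification_index G N \<chi> \<psi>) * (\<Sum>\<phi>\<in>?X. \<phi> x)"
    using e by simp_all
qed

section \<open>Galois conjugates of characters\<close>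

text \<open>
  Without fixed points all orbits of a permutation of prime order \<open>p\<close> have \<open>p\<close> elements; they are removed
  one at a time.
\<close>

lemma prime_dvd_card_if_no_fixed_point:
  assumes p: "prime p" and fin: "finite X" and maps: "\<And>x. x \<in> X \<Longrightarrow> F x \<in> X"
    and period: "\<And>x. x \<in> X \<Longrightarrow> (F ^^ p) x = x" and nofix: "\<And>x. x \<in> X \<Longrightarrow> F x \<noteq> x"
  shows "p dvd card X"
  using fin maps period nofix
proof (induction "card X" arbitrary: X rule: less_induct)
  case less
  show ?case
  proof (cases "X = {}")
    case False
    then obtain x where x: "x \<in> X" by blast
    have p0: "p > 0" using p prime_gt_0_nat by blast
    have iter: "(F ^^ i) y \<in> X" if "y \<in> X" for i y
      using that by (induction i) (auto intro: less.prems(2))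
    define Orb where "Orb = (\<lambda>i. (F ^^ i) x) ` {..<p}"
    have OrbI: "(F ^^ m) x \<in> Orb" for m
    proof -
      have "(F ^^ m) x = (F ^^ (m mod p)) x" using funpow_mod_eq[OF less.prems(3)[OF x]] by simp
      thus ?thesis unfolding Orb_def using p0 by auto
    qed
    have "inj_on (\<lambda>i. (F ^^ i) x) {..<p}"
    proof (rule linorder_inj_onI)
      fix i j assume ij: "i < j" "i \<in> {..<p}" "j \<in> {..<p}"
      show "(F ^^ i) x \<noteq> (F ^^ j) x"
      proof
        assume eq: "(F ^^ i) x = (F ^^ j) x"
        define y where "y = (F ^^ i) x"
        have y: "y \<in> X" using iter[OF x] by (simp add: y_def)
        define k where "k = j - i"
        have k: "0 < k" "k < p" using ij by (auto simp: k_def)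
        have "j = k + i" using ij by (simp add: k_def)
        hence ky: "(F ^^ k) y = y" using eq by (simp add: y_def funpow_add)
        have "coprime k p"
          using k p nat_dvd_not_less prime_imp_coprime coprime_commute by metis
        then obtain a where a: "[k * a = 1] (mod p)" using cong_solve_coprime_nat by auto
        have "(F ^^ (k * a)) y = y"
          using ky by (induction a) (auto simp: funpow_add)
        moreover have "(F ^^ (k * a)) y = (F ^^ ((k * a) mod p)) y"
          using funpow_mod_eq[OF less.prems(3)[OF y]] by simp
        moreover have "(k * a) mod p = 1" using a prime_gt_1_nat[OF p] by (simp add: cong_def)
        ultimately show False using less.prems(4)[OF y] by simp
      qed
    qed auto
    hence cardOrb: "card Orb = p" unfolding Orb_def by (simp add: card_image)
    have OrbX: "Orb \<subseteq> X" unfolding Orb_def using iter[OF x] by auto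
    have "p dvd card (X - Orb)"
    proof (rule less.hyps)
      show "card (X - Orb) < card X"
        using OrbX OrbI[of 0] less.prems(1) x by (intro psubset_card_mono) auto
      fix y assume y: "y \<in> X - Orb"
      have "F y \<notin> Orb"
      proof
        assume "F y \<in> Orb"
        then obtain i where i: "F y = (F ^^ i) x" by (auto simp: Orb_def)
        have "y = (F ^^ (p - 1 + 1)) y" using less.prems(3)[of y] y p0 by simp
        also have "\<dots> = (F ^^ (p - 1)) (F y)" by (simp only: funpow_add o_apply) simp
        also have "\<dots> = (F ^^ (p - 1 + i)) x" by (simp add: i funpow_add)
        finally show False using OrbI[of "p - 1 + i"] y by simp
      qed
      thus "F y \<in> X - Orb" using y less.prems(2) by blast
    qed (use less.prems in auto)
    moreover have "card X = card (X - Orb) + p"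
      using cardOrb OrbX less.prems(1) by (simp add: card_Diff_subset finite_subset card_mono)
        (metis card_mono le_add_diff_inverse2)
    ultimately show ?thesis by simp
  qed simp
qed

text \<open>
  If a field automorphism fixes the sum of a family of irreducible characters of equal degree, then it
  permutes the family. Let \<open>f\<close> be the image of \<open>\<phi>\<^sub>0\<close>. Applying the automorphism to the convolution identities
  shows that \<open>f\<close> convolved with the sum is a multiple of \<open>f\<close>, and that \<open>f\<close> convolved with itself is the
  multiple of \<open>f\<close> that is known from irreducible characters of this degree. The former makes \<open>f\<close> a linear
  combination of the family, since convolving \<open>f\<close> with a member gives a multiple of that member; the
  latter forces the coefficients to be \<open>0\<close> or \<open>1\<close>. Comparing degrees, exactly one coefficient is \<open>1\<close>.
\<close>

lemma galois_conjugate_mem: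
  fixes H (structure)
  assumes H: "group H" and fin: "finite (carrier H)" and X: "X \<subseteq> Irr H" "finite X"
    and deg: "\<And>\<phi>. \<phi> \<in> X \<Longrightarrow> char_degree H \<phi> = d"
    and F: "complex_subfield F" and vals: "\<And>\<phi> x. \<phi> \<in> X \<Longrightarrow> x \<in> carrier H \<Longrightarrow> \<phi> x \<in> F"
    and \<sigma>_add: "\<And>x y. x \<in> F \<Longrightarrow> y \<in> F \<Longrightarrow> \<sigma> (x + y) = \<sigma> x + \<sigma> y"
    and \<sigma>_mult: "\<And>x y. x \<in> F \<Longrightarrow> y \<in> F \<Longrightarrow> \<sigma> (x * y) = \<sigma> x * \<sigma> y"
    and \<sigma>_rat: "\<And>a b. \<sigma> (of_nat a / of_nat b) = of_nat a / of_nat b"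
    and inv: "\<And>x. x \<in> carrier H \<Longrightarrow> \<sigma> (\<Sum>\<phi>\<in>X. \<phi> x) = (\<Sum>\<phi>\<in>X. \<phi> x)"
    and \<phi>0: "\<phi>0 \<in> X"
  shows "(\<lambda>x\<in>carrier H. \<sigma> (\<phi>0 x)) \<in> X"
proof -
  interpret H: group H by fact
  interpret F: complex_subfield F by fact
  have \<sigma>0: "\<sigma> 0 = 0" using \<sigma>_rat[of 0 1] by simp
  have \<sigma>_sum: "\<sigma> (sum g A) = (\<Sum>i\<in>A. \<sigma> (g i))" if "\<And>i. i \<in> A \<Longrightarrow> g i \<in> F" for g :: "'c \<Rightarrow> complex" and A
    using that by (induction A rule: infinite_finite_induct) (simp_all add: \<sigma>0 \<sigma>_add F.sum_mem)
  have d0: "d > 0" using deg[OF \<phi>0] Irr_degree(2)[OF H, of \<phi>0] X \<phi>0 by auto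
  let ?h = "of_nat (card (carrier H)) :: complex"
  have h0: "?h \<noteq> 0" using fin H.one_closed by (auto simp: card_eq_0_iff)
  define q where "q = ?h / of_nat d"
  have q0: "q \<noteq> 0" using h0 d0 by (simp add: q_def)
  have qF: "q \<in> F" unfolding q_def by (intro F.divide_mem F.of_nat_mem)
  have \<sigma>q: "\<sigma> (q * x) = q * \<sigma> x" if "x \<in> F" for x
    using \<sigma>_mult[OF qF that] \<sigma>_rat[of "card (carrier H)" d] by (simp add: q_def)
  have conv: "char_conv H \<phi> \<phi>' x = (if \<phi> = \<phi>' then q * \<phi> x else 0)"
    if "\<phi> \<in> X" "\<phi>' \<in> X" "x \<in> carrier H" for \<phi> \<phi>' x
    using char_conv_self[OF H fin _ that(3), of \<phi>] char_conv_distinct[OF H fin, of \<phi> \<phi>' x] that X deg[OF that(1)]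
    by (auto simp: q_def)
  define f where "f = (\<lambda>x\<in>carrier H. \<sigma> (\<phi>0 x))"
  have f: "f x = \<sigma> (\<phi>0 x)" if "x \<in> carrier H" for x using that by (simp add: f_def)
  have clf_f: "class_function H f"
    using class_functionD[OF Irr_class_function[OF H]] \<phi>0 X(1) by (auto simp: class_function_def f)
  have sum_conv: "(\<Sum>\<phi>\<in>X. char_conv H f \<phi> x) = q * f x" if x: "x \<in> carrier H" for x
  proof -
    have "(\<Sum>\<phi>\<in>X. char_conv H f \<phi> x) = (\<Sum>y\<in>carrier H. f (inv y) * (\<Sum>\<phi>\<in>X. \<phi> (x \<otimes> y)))"
      unfolding char_conv_def sum_distrib_left by (rule sum.swap)
    also have "\<dots> = (\<Sum>y\<in>carrier H. \<sigma> (\<phi>0 (inv y) * (\<Sum>\<phi>\<in>X. \<phi> (x \<otimes> y))))"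
      by (intro sum.cong refl) (use x \<phi>0 in \<open>simp add: f inv \<sigma>_mult vals F.sum_mem\<close>)
    also have "\<dots> = \<sigma> (\<Sum>y\<in>carrier H. \<phi>0 (inv y) * (\<Sum>\<phi>\<in>X. \<phi> (x \<otimes> y)))"
      by (rule \<sigma>_sum[symmetric]) (use x \<phi>0 in \<open>simp add: F.mult_mem F.sum_mem vals\<close>)
    also have "(\<Sum>y\<in>carrier H. \<phi>0 (inv y) * (\<Sum>\<phi>\<in>X. \<phi> (x \<otimes> y))) = (\<Sum>\<phi>\<in>X. char_conv H \<phi>0 \<phi> x)"
      unfolding char_conv_def sum_distrib_left by (rule sum.swap)
    also have "\<dots> = q * \<phi>0 x" using conv[OF \<phi>0 _ x] X(2) \<phi>0 by simp
    also have "\<sigma> \<dots> = q * f x" using x \<phi>0 by (simp add: \<sigma>q vals f)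
    finally show ?thesis .
  qed
  have conv_ff: "char_conv H f f x = q * f x" if x: "x \<in> carrier H" for x
  proof -
    have "char_conv H f f x = (\<Sum>y\<in>carrier H. \<sigma> (\<phi>0 (inv y) * \<phi>0 (x \<otimes> y)))"
      unfolding char_conv_def by (intro sum.cong refl) (use x \<phi>0 in \<open>simp add: f \<sigma>_mult vals\<close>)
    also have "\<dots> = \<sigma> (char_conv H \<phi>0 \<phi>0 x)"
      unfolding char_conv_def by (rule \<sigma>_sum[symmetric]) (use x \<phi>0 in \<open>simp add: F.mult_mem vals\<close>)
    also have "\<dots> = q * f x" using conv[OF \<phi>0 \<phi>0 x] x \<phi>0 by (simp add: \<sigma>q vals f)
    finally show ?thesis .
  qed
  have "\<forall>\<phi>\<in>X. \<exists>l. \<forall>x\<in>carrier H. char_conv H f \<phi> x = l * \<phi> x"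
    using char_conv_Irr_multiple[OF H clf_f] X(1) by blast
  then obtain l where l: "\<And>\<phi> x. \<phi> \<in> X \<Longrightarrow> x \<in> carrier H \<Longrightarrow> char_conv H f \<phi> x = l \<phi> * \<phi> x" by metis
  define a where "a = (\<lambda>\<phi>. l \<phi> / q)"
  have la: "l \<phi> = q * a \<phi>" for \<phi> using q0 by (simp add: a_def)
  have f_sum: "f x = (\<Sum>\<phi>\<in>X. a \<phi> * \<phi> x)" if x: "x \<in> carrier H" for x
  proof -
    have "q * f x = q * (\<Sum>\<phi>\<in>X. a \<phi> * \<phi> x)"
      unfolding sum_conv[OF x, symmetric] sum_distrib_left by (intro sum.cong refl) (simp add: l x la)
    thus ?thesis using q0 by simp
  qed
  have a2: "a \<phi> * a \<phi> = a \<phi>" if \<phi>: "\<phi> \<in> X" for \<phi>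
  proof -
    \<comment> \<open>The coefficients \<open>b\<close> of a vanishing combination are extracted by orthogonality.\<close>
    define b where "b = (\<lambda>\<phi>. a \<phi> * a \<phi> - a \<phi>)"
    have b0: "(\<Sum>\<phi>\<in>X. b \<phi> * \<phi> x) = 0" if x: "x \<in> carrier H" for x
    proof -
      have "q * f x = (\<Sum>y\<in>carrier H. f (inv y) * (\<Sum>\<phi>\<in>X. a \<phi> * \<phi> (x \<otimes> y)))"
        unfolding conv_ff[OF x, symmetric] char_conv_def by (intro sum.cong refl) (use x in \<open>simp add: f_sum[of "x \<otimes> _"]\<close>)
      also have "\<dots> = (\<Sum>\<phi>\<in>X. a \<phi> * char_conv H f \<phi> x)"
        unfolding char_conv_def sum_distrib_left by (subst sum.swap) (simp add: mult_ac)
      also have "\<dots> = q * (\<Sum>\<phi>\<in>X. a \<phi> * a \<phi> * \<phi> x)"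
        unfolding sum_distrib_left by (intro sum.cong refl) (simp add: l x la)
      finally have "f x = (\<Sum>\<phi>\<in>X. a \<phi> * a \<phi> * \<phi> x)" using q0 by simp
      thus ?thesis using f_sum[OF x] by (simp add: b_def left_diff_distrib sum_subtractf)
    qed
    have "0 = (\<Sum>y\<in>carrier H. \<phi> (inv y) * (\<Sum>\<phi>'\<in>X. b \<phi>' * \<phi>' (\<one> \<otimes> y)))"
      by (simp add: b0)
    also have "\<dots> = (\<Sum>\<phi>'\<in>X. b \<phi>' * char_conv H \<phi> \<phi>' \<one>)"
      unfolding char_conv_def sum_distrib_left by (subst sum.swap) (simp add: mult_ac)
    also have "\<dots> = (\<Sum>\<phi>'\<in>X. if \<phi> = \<phi>' then b \<phi>' * (q * \<phi> \<one>) else 0)"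
      by (intro sum.cong refl) (simp add: conv[OF \<phi>])
    also have "\<dots> = b \<phi> * (q * \<phi> \<one>)" using X(2) \<phi> by simp
    finally have "b \<phi> * (q * \<phi> \<one>) = 0" by simp
    moreover have "\<phi> \<one> \<noteq> 0" using Irr_degree[OF H, of \<phi>] \<phi> X(1) by auto
    ultimately show ?thesis using q0 by (simp add: b_def)
  qed
  have one: "\<phi> \<one> = of_nat d" if "\<phi> \<in> X" for \<phi>
    using Irr_degree(1)[OF H, of \<phi>] deg[OF that] X(1) that by auto
  have "of_nat d = (\<Sum>\<phi>\<in>X. a \<phi>) * of_nat d"
    using f_sum[OF H.one_closed] f[OF H.one_closed] \<sigma>_rat[of d 1] by (simp add: one \<phi>0 sum_distrib_right)
  hence suma: "(\<Sum>\<phi>\<in>X. a \<phi>) = 1" using d0 by simp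
  define S where "S = {\<phi> \<in> X. a \<phi> = 1}"
  have a01: "a \<phi> = (if \<phi> \<in> S then 1 else 0)" if "\<phi> \<in> X" for \<phi>
    using a2[OF that] that by (auto simp: S_def)
  have SX: "S \<subseteq> X" by (auto simp: S_def)
  have "(\<Sum>\<phi>\<in>X. a \<phi>) = of_nat (card S)"
  proof -
    have "(\<Sum>\<phi>\<in>X. a \<phi>) = (\<Sum>\<phi>\<in>X. if \<phi> \<in> S then 1 else 0)" by (intro sum.cong refl a01)
    also have "\<dots> = (\<Sum>\<phi>\<in>S. 1)"
      using X(2) SX by (subst sum.inter_restrict[symmetric]) (auto simp: Int_absorb1)
    finally show ?thesis by simp
  qed
  hence "card S = 1" using suma by (metis of_nat_eq_1_iff)
  then obtain \<phi> where S: "S = {\<phi>}" by (auto simp: card_1_singleton_iff)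
  have \<phi>X: "\<phi> \<in> X" using S SX by auto
  have "f x = \<phi> x" if x: "x \<in> carrier H" for x
  proof -
    have "f x = (\<Sum>\<phi>'\<in>X. if \<phi>' = \<phi> then \<phi>' x else 0)"
      unfolding f_sum[OF x] by (intro sum.cong refl) (simp add: a01 S)
    thus ?thesis using X(2) \<phi>X by simp
  qed
  hence "f = restrict \<phi> (carrier H)" by (auto simp: f_def restrict_def fun_eq_iff)
  hence "f = \<phi>" using Irr_restrict[of \<phi> H] \<phi>X X(1) by auto
  thus ?thesis using \<phi>X by (simp add: f_def)
qed

section \<open>Conductors\<close>

lemma char_conductor_exists:
  assumes "f > 0" "\<And>x. x \<in> carrier H \<Longrightarrow> \<theta> x \<in> cyclotomic_field f"
  shows "0 < f \<and> rat_adjoin (\<theta> ` carrier H) \<subseteq> cyclotomic_field f"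
  using rat_adjoin_minimal[OF cyclotomic_field_subfield, of "\<theta> ` carrier H" f] assms by auto

lemma char_conductor_le:
  assumes "f > 0" "\<And>x. x \<in> carrier H \<Longrightarrow> \<theta> x \<in> cyclotomic_field f"
  shows "char_conductor H \<theta> \<le> f"
  unfolding char_conductor_def by (rule Least_le) (rule char_conductor_exists[OF assms])

lemma Irr_value_mem:
  fixes H (structure)
  assumes "group H" "\<theta> \<in> Irr H" "x \<in> carrier H" "m > 0" "x [^] m = \<one>"
  shows "\<theta> x \<in> cyclotomic_field m"
proof -
  obtain n \<rho> where "is_rep H n \<rho>" "\<theta> = rep_character H n \<rho>" using assms(2) by (rule Irr_cases)
  thus ?thesis using rep_character_in_cyclotomic_field[OF assms(1) _ assms(3-5)] by simp
qed

lemma Irr_value_mem_order: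
  fixes H (structure)
  assumes "group H" "finite (carrier H)" "\<theta> \<in> Irr H" "x \<in> carrier H"
  shows "\<theta> x \<in> cyclotomic_field (card (carrier H))"
proof (rule Irr_value_mem[OF assms(1,3,4)])
  interpret H: group H by fact
  show "card (carrier H) > 0" using assms(2) H.one_closed by (auto simp: card_gt_0_iff)
  show "x [^] card (carrier H) = \<one>"
    using H.pow_order_eq_1[OF assms(4)] by (simp add: Coset.order_def)
qed

lemma char_conductor_Irr:
  assumes H: "group H" and fin: "finite (carrier H)" and \<theta>: "\<theta> \<in> Irr H"
  shows "char_conductor H \<theta> > 0" "x \<in> carrier H \<Longrightarrow> \<theta> x \<in> cyclotomic_field (char_conductor H \<theta>)"
proof -
  interpret H: group H by fact
  have "card (carrier H) > 0" using fin H.one_closed by (auto simp: card_gt_0_iff)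
  from char_conductor_exists[OF this, of H \<theta>] Irr_value_mem_order[OF H fin \<theta>]
  have "0 < char_conductor H \<theta> \<and> rat_adjoin (\<theta> ` carrier H) \<subseteq> cyclotomic_field (char_conductor H \<theta>)"
    unfolding char_conductor_def by (intro LeastI[of "\<lambda>f. 0 < f \<and> rat_adjoin (\<theta> ` carrier H) \<subseteq> cyclotomic_field f"]) blast
  thus "char_conductor H \<theta> > 0" "x \<in> carrier H \<Longrightarrow> \<theta> x \<in> cyclotomic_field (char_conductor H \<theta>)"
    using rat_adjoin_incl[of "\<theta> x" "\<theta> ` carrier H"] by auto
qed

text \<open>
  The automorphism with exponent \<open>j\<close> acts in a prescribed way on roots of unity of \<open>p\<close>-power order and
  trivially on those of order dividing \<open>M\<close>.
\<close>

lemma exists_cong_prime_power: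
  fixes p c M r :: nat
  assumes p: "prime p" and M: "\<not> p dvd M" and r: "[r = 1] (mod p)"
  obtains j where "[j = r] (mod p ^ c)" "[j = 1] (mod M)" "coprime j (p ^ c * M)"
proof -
  have cop: "coprime (p ^ c) M" using p M by (simp add: prime_imp_coprime)
  obtain j where j: "[j = r] (mod p ^ c)" "[j = 1] (mod M)"
    using binary_chinese_remainder_nat[OF cop] by blast
  have "coprime r p" using cong_imp_coprime[OF cong_sym[OF r]] by simp
  hence "coprime r (p ^ c)" by simp
  hence "coprime j (p ^ c)" using cong_imp_coprime[OF cong_sym[OF j(1)]] by simp
  moreover have "coprime j M" using cong_imp_coprime[OF cong_sym[OF j(2)]] by simp
  ultimately show thesis using that j by simp
qed

text \<open>
  By the Chinese remainder theorem, every automorphism needed for the descent from \<open>p\<^sup>k\<close> to \<open>p\<^sup>b\<close> is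
  induced by one that is trivial on the \<open>p\<^sup>b m\<close>-th cyclotomic field and hence fixes \<open>y\<close>.
  This is applied to the value of a character at a \<open>p\<close>-element, which is a sum of roots of unity of
  \<open>p\<close>-power order and belongs to the cyclotomic field of the conductor.
\<close>

lemma cyclotomic_field_prime_power_Int:
  assumes p: "prime p" and b: "b \<ge> 1" and m: "m > 0" "\<not> p dvd m"
    and y: "y \<in> cyclotomic_field (p ^ k)" "y \<in> cyclotomic_field (p ^ b * m)"
  shows "y \<in> cyclotomic_field (p ^ b)"
proof (cases "k \<le> b")
  case True
  have "cyclotomic_field (p ^ k) \<subseteq> cyclotomic_field (p ^ b)"
    by (rule cyclotomic_field_mono) (use True p prime_gt_0_nat in \<open>auto intro: le_imp_power_dvd\<close>)
  thus ?thesis using y(1) by blast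
next
  case False
  have p0: "p > 0" using p prime_gt_0_nat by blast
  let ?n = "p ^ k * m"
  have n: "?n > 0" using p0 m by simp
  have dr: "p ^ b * p ^ (k - b) = p ^ k" using False by (simp add: power_add[symmetric])
  have cop: "coprime (p ^ b) m" using p m by (simp add: prime_imp_coprime)
  have pb: "p ^ b dvd p ^ k" using False by (intro le_imp_power_dvd) simp
  show ?thesis
  proof (rule cyclotomic_field_descent[OF n, of _ "p ^ (k - b)"])
    show "p ^ b * p ^ (k - b) dvd ?n" "y \<in> cyclotomic_field (p ^ b * p ^ (k - b))" using y by (simp_all add: dr)
    fix t assume "t < p ^ (k - b)"
    have r1: "[1 + t * p ^ b = 1] (mod p ^ b)" unfolding cong_def by (rule mod_mult_self1)
    have "p dvd p ^ b" using b by (intro dvd_power) auto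
    hence "[1 + t * p ^ b = 1] (mod p)" using r1 cong_dvd_modulus_nat by blast
    from exists_cong_prime_power[OF p m(2) this, of k]
    obtain j where j: "[j = 1 + t * p ^ b] (mod p ^ k)" "[j = 1] (mod m)" "coprime j ?n" by blast
    have "[j = 1] (mod p ^ b)" using cong_dvd_modulus_nat[OF j(1) pb] r1 by (rule cong_trans)
    hence "[j = 1] (mod p ^ b * m)" using j(2) cop by (rule coprime_cong_mult_nat)
    moreover have "p ^ b * m dvd ?n" using pb by simp
    ultimately have "gal ?n j y = y" using gal_fix[OF n j(3)] y(2) by blast
    thus "\<exists>j. [j = 1 + t * p ^ b] (mod (p ^ b * p ^ (k - b))) \<and> coprime j ?n \<and> gal ?n j y = y"
      using j by (auto simp: dr)
  qed
qed

text \<open>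
  Assume \<open>a < b\<close> for the exponents of \<open>p\<close> in the conductors of \<open>\<chi>\<close> and \<open>\<psi>\<close>. An automorphism that is trivial
  on roots of unity of order \<open>p\<^sup>b\<^sup>-\<^sup>1\<close> and of order prime to \<open>p\<close> fixes the values of \<open>\<chi>\<close>, hence the sum of the
  conjugates of \<open>\<psi>\<close>, and so permutes these conjugates. Its \<open>p\<close>-th power fixes all their values. Their number
  is prime to \<open>p\<close>, so one of them is fixed; as they all take the same values, \<open>\<psi>\<close> is fixed as well. By
  descent the conductor of \<open>\<psi>\<close> has at most \<open>b - 1\<close> factors \<open>p\<close>, a contradiction.
\<close>

lemma p_exponent_conductor_le:
  fixes G (structure)
  assumes G: "group G" and fin: "finite (carrier G)" and N: "N \<lhd> G"
    and \<chi>: "\<chi> \<in> Irr G" and \<psi>: "\<psi> \<in> Irr (G\<lparr>carrier := N\<rparr>)"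
    and cons: "constituent (G\<lparr>carrier := N\<rparr>) \<psi> (restrict \<chi> N)"
    and p: "prime p" "odd p" and index: "\<not> p dvd card (conj_orbit G N \<psi>)"
    and b: "multiplicity p (char_conductor (G\<lparr>carrier := N\<rparr>) \<psi>) \<ge> 2"
  shows "multiplicity p (char_conductor (G\<lparr>carrier := N\<rparr>) \<psi>) \<le> multiplicity p (char_conductor G \<chi>)"
proof (rule ccontr)
  interpret G: group G by fact
  note NS = normal_subgroup_simps[OF N]
  let ?H = "G\<lparr>carrier := N\<rparr>"
  let ?X = "conj_orbit G N \<psi>"
  define f where "f = char_conductor ?H \<psi>"
  define f' where "f' = char_conductor G \<chi>"
  define b where "b = multiplicity p f"
  define a where "a = multiplicity p f'"
  assume "\<not> multiplicity p (char_conductor ?H \<psi>) \<le> multiplicity p (char_conductor G \<chi>)"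
  hence ab: "a < b" by (simp add: a_def b_def f_def f'_def)
  have b2: "b \<ge> 2" using b by (simp add: b_def f_def)
  have p0: "p > 0" and p1: "p > 1" using p prime_gt_1_nat[of p] by auto
  have npu: "\<not> is_unit p" using p1 by simp
  have finN: "finite N" using fin NS(3) finite_subset by blast
  have finH: "finite (carrier ?H)" using finN by simp
  have finX: "finite ?X" using fin by (simp add: conj_orbit_def)
  have XIrr: "?X \<subseteq> Irr ?H" by (rule conj_orbit_Irr[OF G N \<psi>])
  note cond_\<psi> = char_conductor_Irr[OF NS(1) finH \<psi>, folded f_def]
  note cond_\<chi> = char_conductor_Irr[OF G fin \<chi>, folded f'_def]
  have valX: "\<phi> x \<in> cyclotomic_field f" if "\<phi> \<in> ?X" "x \<in> N" for \<phi> x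
    using that cond_\<psi>(2) NS(5) by (auto simp: conj_orbit_def conj_char_def)
  obtain m where m: "f = p ^ b * m" "\<not> p dvd m"
    using multiplicity_decompose'[of f p] cond_\<psi>(1) npu unfolding b_def by (metis neq0_conv)
  obtain m' where m': "f' = p ^ a * m'" "\<not> p dvd m'"
    using multiplicity_decompose'[of f' p] cond_\<chi>(1) npu unfolding a_def by (metis neq0_conv)
  have m0: "m > 0" "m' > 0" using m m' cond_\<psi>(1) cond_\<chi>(1) by (auto intro: Nat.gr0I)
  \<comment> \<open>\<open>n\<close> is a common multiple of both conductors in which \<open>p\<close> has exponent \<open>b\<close>.\<close>
  define M where "M = m * m'"
  have pM: "\<not> p dvd M" using m m' p by (simp add: M_def prime_dvd_mult_iff)
  define n where "n = p ^ b * M"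
  have n0: "n > 0" using p0 m0 by (simp add: n_def M_def)
  interpret F: complex_subfield "cyclotomic_field n" by (rule cyclotomic_field_subfield)
  have fn: "f dvd n" by (simp add: m n_def M_def)
  have f'n: "f' dvd p ^ (b - 1) * M"
  proof -
    have "p ^ a dvd p ^ (b - 1)" using ab by (intro le_imp_power_dvd) simp
    thus ?thesis unfolding m' M_def by (intro mult_dvd_mono) auto
  qed
  have f'n': "f' dvd n" 
    by (rule dvd_trans[OF f'n]) (auto simp: n_def intro: mult_dvd_mono le_imp_power_dvd)
  have sub_f: "cyclotomic_field f \<subseteq> cyclotomic_field n" by (rule cyclotomic_field_mono[OF fn n0])
  let ?e = "ramification_index G N \<chi> \<psi>"
  note cl = clifford[OF G fin N \<chi> \<psi> cons]
  have sum_val: "(\<Sum>\<phi>\<in>?X. \<phi> x) \<in> cyclotomic_field f'" if x: "x \<in> N" for x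
  proof -
    interpret F': complex_subfield "cyclotomic_field f'" by (rule cyclotomic_field_subfield)
    have "(\<Sum>\<phi>\<in>?X. \<phi> x) = \<chi> x / of_nat ?e" using cl(2)[OF x] cl(1) by simp
    thus ?thesis using cond_\<chi>(2)[of x] x NS(3) by (auto intro: F'.divide_mem F'.of_nat_mem)
  qed
  have pp: "p ^ (b - 1) * p = p ^ b" using b2 power_minus_mult[of b p] by simp
  have pdvd: "p dvd p ^ (b - 1)" using b2 by (intro dvd_power) auto
  have dr: "p ^ (b - 1) * m * p = f" using pp by (simp add: m mult_ac)
  have "\<psi> x \<in> cyclotomic_field (p ^ (b - 1) * m)" if x: "x \<in> N" for x
  proof (rule cyclotomic_field_descent[OF n0, of _ p])
    show "p ^ (b - 1) * m * p dvd n" "\<psi> x \<in> cyclotomic_field (p ^ (b - 1) * m * p)"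
      unfolding dr using fn cond_\<psi>(2) x by simp_all
    fix t assume "t < p"
    let ?r = "1 + t * (p ^ (b - 1) * m)"
    have r1: "[?r = 1] (mod p ^ (b - 1) * m)" unfolding cong_def by (rule mod_mult_self1)
    have r2: "[?r = 1] (mod p ^ (b - 1))" using r1 by (rule cong_dvd_modulus_nat) simp
    have r3: "[?r = 1] (mod m)" using r1 by (rule cong_dvd_modulus_nat) simp
    have r4: "[?r = 1] (mod p)" using r2 pdvd by (rule cong_dvd_modulus_nat)
    \<comment> \<open>Modulo \<open>f\<close> the exponent is prescribed by descent; being \<open>1\<close> modulo \<open>M\<close>, it also fixes the values of \<open>\<chi>\<close>.\<close>
    obtain j where j: "[j = ?r] (mod p ^ b)" "[j = 1] (mod M)" "coprime j n"
      using exists_cong_prime_power[OF p(1) pM r4, of b] unfolding n_def by blast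
    have jm: "[j = 1] (mod m)" using j(2) by (rule cong_dvd_modulus_nat) (simp add: M_def)
    have cop: "coprime (p ^ k) m" "coprime (p ^ k) M" for k using p m(2) pM by (simp_all add: prime_imp_coprime)
    have jr: "[j = ?r] (mod f)"
      unfolding m(1) using j(1) cong_trans[OF jm cong_sym[OF r3]] cop(1) by (rule coprime_cong_mult_nat)
    have jb: "[j = 1] (mod p ^ (b - 1))"
      using cong_dvd_modulus_nat[OF j(1), of "p ^ (b - 1)"] r2 pp by (metis cong_trans dvd_triv_left)
    have jbM: "[j = 1] (mod p ^ (b - 1) * M)" using jb j(2) cop(2) by (rule coprime_cong_mult_nat)
    \<comment> \<open>The \<open>p\<close>-th power of the automorphism is trivial on the field of the conductor of \<open>\<psi>\<close>.\<close>
    have jp: "[j ^ p = 1] (mod p ^ b * M)"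
    proof (rule coprime_cong_mult_nat[OF _ _ cop(2)])
      have "j > 0"
      proof (rule Nat.gr0I)
        assume "j = 0"
        hence "[0 = 1] (mod p)" using cong_dvd_modulus_nat[OF jb pdvd] by simp
        thus False using p1 by (simp add: cong_def)
      qed
      then obtain v where v: "j = 1 + v" by (metis Suc_eq_plus1_left gr0_conv_Suc)
      have "[1 + v = 1 + 0] (mod p ^ (b - 1))" using jb by (simp add: v)
      hence "p ^ (b - 1) dvd v" by (simp only: cong_add_lcancel_nat cong_0_iff)
      then obtain s where s: "j = 1 + p ^ (b - 1) * s" using v by (auto elim: dvdE)
      have b1: "b - 1 \<ge> 1" using b2 by simp
      obtain s' where "j ^ (p ^ 1) = 1 + p ^ (b - 1 + 1) * s'"
        using one_plus_prime_power_pow[OF p b1, of s 1] unfolding s by blast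
      hence "j ^ p = 1 + p ^ (b - 1 + 1) * s'" by (simp only: power_one_right)
      also have "b - 1 + 1 = b" using b2 by simp
      finally have jp: "j ^ p = 1 + p ^ b * s'" .
      show "[j ^ p = 1] (mod p ^ b)" unfolding jp cong_def by (rule mod_mult_self2)
      show "[j ^ p = 1] (mod M)" using cong_pow[OF j(2), of p] by simp
    qed
    define \<Phi> where "\<Phi> = (\<lambda>\<phi>. \<lambda>x\<in>N. gal n j (\<phi> x))"
    have \<Phi>X: "\<Phi> \<phi> \<in> ?X" if \<phi>: "\<phi> \<in> ?X" for \<phi>
    proof -
      have "(\<lambda>x\<in>carrier ?H. gal n j (\<phi> x)) \<in> ?X"
      proof (rule galois_conjugate_mem[OF NS(1) finH XIrr finX conj_orbit_degree[OF G N] F.complex_subfield_axioms _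
            gal_add[OF n0 j(3)] gal_mult[OF n0 j(3)] gal_of_nat_divide[OF n0 j(3)] _ \<phi>])
        show "\<phi> x \<in> cyclotomic_field n" if "\<phi> \<in> ?X" "x \<in> carrier ?H" for \<phi> x
          using valX that sub_f by auto
        show "gal n j (\<Sum>\<phi>\<in>?X. \<phi> x) = (\<Sum>\<phi>\<in>?X. \<phi> x)" if "x \<in> carrier ?H" for x
          using gal_fix[OF n0 j(3) f'n' cong_dvd_modulus_nat[OF jbM f'n] sum_val[of x]] that by simp
      qed
      thus ?thesis by (simp add: \<Phi>_def)
    qed
    have jpow: "coprime (j ^ i) n" for i using j(3) by (metis coprime_power_left_iff)
    have restr: "restrict \<phi> N = \<phi>" if "\<phi> \<in> ?X" for \<phi>
      using Irr_restrict[of \<phi> ?H] that XIrr by auto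
    have iter: "(\<Phi> ^^ i) \<phi> = (\<lambda>x\<in>N. gal n (j ^ i) (\<phi> x))" if \<phi>: "\<phi> \<in> ?X" for i \<phi>
    proof (induction i)
      case 0
      have "gal n 1 (\<phi> x) = \<phi> x" if "x \<in> N" for x
        using gal_fix[OF n0 _ fn, of 1 "\<phi> x"] valX[OF \<phi> that] by simp
      hence "(\<lambda>x\<in>N. gal n 1 (\<phi> x)) = restrict \<phi> N" by (rule restrict_ext)
      thus ?case using restr[OF \<phi>] by simp
    next
      case (Suc i)
      have "gal n j (gal n (j ^ i) (\<phi> x)) = gal n (j ^ Suc i) (\<phi> x)" if "x \<in> N" for x
        using gal_gal[OF n0 j(3) jpow[of i]] valX[OF \<phi> that] sub_f by auto
      thus ?case by (simp add: Suc.IH) (auto simp: \<Phi>_def restrict_def fun_eq_iff)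
    qed
    have period: "(\<Phi> ^^ p) \<phi> = \<phi>" if \<phi>: "\<phi> \<in> ?X" for \<phi>
    proof -
      have "[j ^ p = 1] (mod f)"
        using jp by (rule cong_dvd_modulus_nat) (use fn in \<open>simp add: n_def\<close>)
      hence "gal n (j ^ p) (\<phi> x) = \<phi> x" if "x \<in> N" for x
        using gal_fix[OF n0 jpow fn] valX[OF \<phi> that] by blast
      hence "(\<lambda>x\<in>N. gal n (j ^ p) (\<phi> x)) = restrict \<phi> N" by (auto simp: restrict_def fun_eq_iff)
      thus ?thesis using iter[OF \<phi>] restr[OF \<phi>] by simp
    qed
    have "\<exists>\<phi>\<in>?X. \<Phi> \<phi> = \<phi>"
      using prime_dvd_card_if_no_fixed_point[OF p(1) finX \<Phi>X period] index by blast
    then obtain g where g: "g \<in> carrier G" "\<Phi> (conj_char G N g \<psi>) = conj_char G N g \<psi>"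
      by (auto simp: conj_orbit_def)
    have "gal n j (\<psi> x) = \<psi> x"
    proof -
      let ?y = "g \<otimes> x \<otimes> inv g"
      have xc: "x \<in> carrier G" using x NS(3) by blast
      have y: "?y \<in> N" by (rule NS(4)[OF g(1) x])
      have \<psi>x: "conj_char G N g \<psi> ?y = \<psi> x"
        unfolding conj_char_def restrict_apply
        using y by (simp only: if_True conj_conj_cancel(1)[OF G g(1) xc])
      have "gal n j (conj_char G N g \<psi> ?y) = \<Phi> (conj_char G N g \<psi>) ?y"
        unfolding \<Phi>_def restrict_apply using y by (simp only: if_True)
      also have "\<dots> = conj_char G N g \<psi> ?y" by (simp only: g(2))
      finally show ?thesis by (simp only: \<psi>x)
    qed
    with jr j(3) show "\<exists>j. [j = ?r] (mod (p ^ (b - 1) * m * p)) \<and> coprime j n \<and> gal n j (\<psi> x) = \<psi> x"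
      unfolding dr by (intro exI[of _ j] conjI)
  qed
  hence "f \<le> p ^ (b - 1) * m"
    unfolding f_def using p0 m0 by (intro char_conductor_le) auto
  moreover have "p ^ (b - 1) * m * 1 < p ^ (b - 1) * m * p" using p0 p1 m0 by (intro mult_strict_left_mono) auto
  ultimately show False unfolding dr by simp
qed

section \<open>Passing to the normal subgroup\<close>

lemma p_element_conj:
  fixes G (structure)
  assumes G: "group G" and N: "N \<lhd> G" and c: "c \<in> carrier G" and g: "g \<in> N" "p_element G p g"
  shows "p_element (G\<lparr>carrier := N\<rparr>) p (inv c \<otimes> g \<otimes> c)"
proof -
  interpret G: group G by fact
  note NS = normal_subgroup_simps[OF N]
  let ?H = "G\<lparr>carrier := N\<rparr>"
  interpret H: group ?H by (rule NS(1))
  let ?h = "inv c \<otimes> g \<otimes> c"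
  have gc: "g \<in> carrier G" using g NS(3) by auto
  have powN: "x [^]\<^bsub>?H\<^esub> k = x [^] k" for x and k :: nat by (simp add: nat_pow_def)
  have pow: "?h [^] k = inv c \<otimes> g [^] k \<otimes> c" for k :: nat
  proof (induction k)
    case (Suc k)
    have canc: "c \<otimes> (inv c \<otimes> z) = z" if "z \<in> carrier G" for z
      using c that by (simp add: G.m_assoc[symmetric])
    show ?case using Suc c gc by (simp add: G.m_assoc canc)
  qed (use c in simp)
  have iff: "?h [^] k = \<one> \<longleftrightarrow> g [^] k = \<one>" for k :: nat
  proof
    assume "?h [^] k = \<one>"
    hence "c \<otimes> (inv c \<otimes> g [^] k \<otimes> c) \<otimes> inv c = \<one>" using c by (simp add: pow)
    thus "g [^] k = \<one>" using conj_conj_cancel(2)[OF G c, of "g [^] k"] gc by simp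
  qed (use c in \<open>simp add: pow\<close>)
  have "group.ord ?H ?h = group.ord G g"
    unfolding H.ord_def G.ord_def powN using iff by simp
  moreover have "?h \<in> N" by (rule NS(5)[OF c g(1)])
  ultimately show ?thesis using g(2) by (simp add: p_element_def)
qed

theorem theorem4p6:
  fixes G :: "('a, 'b) monoid_scheme" and N :: "'a set"
    and \<chi> \<psi> :: "'a \<Rightarrow> complex" and p :: nat
  assumes "group G" and "finite (carrier G)" and "N \<lhd> G"
    and "\<chi> \<in> Irr G" and "\<psi> \<in> Irr (G\<lparr>carrier := N\<rparr>)"
    and "constituent (G\<lparr>carrier := N\<rparr>) \<psi> (restrict \<chi> N)"
    and "prime p" and "odd p"
    and "\<not> p dvd card (lcosets\<^bsub>G\<^esub> (inertia_group G N \<psi>))"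
    and "\<not> p dvd ramification_index G N \<chi> \<psi>"
    and "property_1_3 G p \<chi>"
    and "\<not> p dvd char_degree G \<chi> \<Longrightarrow> \<exists>g\<in>N. property_1_3_witness G p \<chi> g"
  shows "property_1_3 (G\<lparr>carrier := N\<rparr>) p \<psi>"
  unfolding property_1_3_def
proof
  note G = assms(1) and fin = assms(2) and N = assms(3) and \<chi> = assms(4) and \<psi> = assms(5) and cons = assms(6)
    and p = assms(7,8)
  interpret G: group G by fact
  note NS = normal_subgroup_simps[OF N]
  let ?H = "G\<lparr>carrier := N\<rparr>"
  interpret H: group ?H by (rule NS(1))
  let ?X = "conj_orbit G N \<psi>"
  let ?e = "ramification_index G N \<chi> \<psi>"
  assume deg: "\<not> p dvd char_degree ?H \<psi>"
  have finH: "finite (carrier ?H)" using fin NS(3) finite_subset by auto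
  have index: "\<not> p dvd card ?X"
    using assms(9) bij_betw_same_card[OF lcosets_inertia_bij[OF G N \<psi>]] by simp
  note cl = clifford[OF G fin N \<chi> \<psi> cons]
  have "\<phi> \<one>\<^bsub>G\<^esub> = of_nat (char_degree ?H \<psi>)" if "\<phi> \<in> ?X" for \<phi>
    using conj_orbit_at_one[OF G N that] Irr_degree(1)[OF NS(1) \<psi>] by simp
  hence "\<chi> \<one>\<^bsub>G\<^esub> = of_nat ?e * (\<Sum>\<phi>\<in>?X. of_nat (char_degree ?H \<psi>))"
    unfolding cl(2)[OF NS(6)] by simp
  hence "of_nat (char_degree G \<chi>) = (of_nat (?e * (card ?X * char_degree ?H \<psi>)) :: complex)"
    using Irr_degree(1)[OF G \<chi>] by simp
  hence "char_degree G \<chi> = ?e * (card ?X * char_degree ?H \<psi>)" by (simp only: of_nat_eq_iff)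
  hence "\<not> p dvd char_degree G \<chi>"
    using assms(10) index deg p(1) by (simp add: prime_dvd_mult_iff)
  then obtain g where g: "g \<in> N" "property_1_3_witness G p \<chi> g" using assms(12) by blast
  define f where "f = char_conductor ?H \<psi>"
  define b where "b = multiplicity p f"
  define a where "a = multiplicity p (char_conductor G \<chi>)"
  note cond = char_conductor_Irr[OF NS(1) finH \<psi>, folded f_def]
  have p0: "p > 0" using p(1) prime_gt_0_nat by blast
  have part: "p_part p f = p ^ b" "p_part p (char_conductor G \<chi>) = p ^ a"
    by (simp_all add: p_part_def a_def b_def)
  show "\<exists>g\<in>carrier ?H. property_1_3_witness ?H p \<psi> g"
  proof (cases "b \<le> 1")
    case True
    interpret C: complex_subfield "cyclotomic_field (p ^ b)" by (rule cyclotomic_field_subfield)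
    have "rat_adjoin {\<psi> \<one>\<^bsub>?H\<^esub>} \<subseteq> cyclotomic_field (p ^ b)"
      using Irr_degree(1)[OF NS(1) \<psi>] C.of_nat_mem
      by (intro rat_adjoin_minimal[OF cyclotomic_field_subfield]) simp
    hence "\<not> p dvd field_degree (cyclotomic_field (p ^ b)) (rat_adjoin {\<psi> \<one>\<^bsub>?H\<^esub>})"
      by (rule prime_not_dvd_field_degree_exponent_le_1[OF p(1) True rat_adjoin_subfield])
    moreover have "p_element ?H p \<one>\<^bsub>?H\<^esub>"
      unfolding p_element_def
    proof
      have "H.ord \<one>\<^bsub>?H\<^esub> = p ^ 0" using H.ord_eq_1[OF H.one_closed] by simp
      thus "\<exists>k. H.ord \<one>\<^bsub>?H\<^esub> = p ^ k" by blast
    qed (rule H.one_closed)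
    ultimately show ?thesis
      unfolding property_1_3_witness_def f_def[symmetric] part using H.one_closed by blast
  next
    case False
    hence b2: "b \<ge> 2" by simp
    have ba: "b \<le> a"
      using p_exponent_conductor_le[OF G fin N \<chi> \<psi> cons p index] b2 by (simp add: a_def b_def f_def)
    have "\<not> p dvd field_degree (cyclotomic_field (p ^ a)) (rat_adjoin {\<chi> g})"
      using g(2) unfolding property_1_3_witness_def part by blast
    hence chi_g: "\<chi> g \<notin> cyclotomic_field (p ^ (a - 1))"
      using prime_dvd_field_degree[OF p(1), of a "\<chi> g"] ba b2 by auto
    \<comment> \<open>Otherwise \<open>\<chi>(g)\<close>, a multiple of the sum of these values, would lie in the smaller field.\<close>
    have "\<exists>c\<in>carrier G. \<psi> (inv\<^bsub>G\<^esub> c \<otimes>\<^bsub>G\<^esub> g \<otimes>\<^bsub>G\<^esub> c) \<notin> cyclotomic_field (p ^ (b - 1))"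
    proof (rule ccontr)
      interpret C: complex_subfield "cyclotomic_field (p ^ (b - 1))" by (rule cyclotomic_field_subfield)
      assume "\<not> ?thesis"
      hence "\<phi> g \<in> cyclotomic_field (p ^ (b - 1))" if "\<phi> \<in> ?X" for \<phi>
        using that g(1) by (auto simp: conj_orbit_def conj_char_def)
      hence "\<chi> g \<in> cyclotomic_field (p ^ (b - 1))"
        unfolding cl(2)[OF g(1)] by (intro C.mult_mem C.of_nat_mem C.sum_mem)
      moreover have "cyclotomic_field (p ^ (b - 1)) \<subseteq> cyclotomic_field (p ^ (a - 1))"
        by (rule cyclotomic_field_mono) (use ba p0 in \<open>auto intro: le_imp_power_dvd\<close>)
      ultimately show False using chi_g by blast
    qed
    then obtain c where c: "c \<in> carrier G"
        "\<psi> (inv\<^bsub>G\<^esub> c \<otimes>\<^bsub>G\<^esub> g \<otimes>\<^bsub>G\<^esub> c) \<notin> cyclotomic_field (p ^ (b - 1))" by blast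
    define h where "h = inv\<^bsub>G\<^esub> c \<otimes>\<^bsub>G\<^esub> g \<otimes>\<^bsub>G\<^esub> c"
    have elem: "p_element ?H p h"
      unfolding h_def using p_element_conj[OF G N c(1) g(1)] g(2) by (simp add: property_1_3_witness_def)
    then obtain k where k: "h \<in> carrier ?H" "H.ord h = p ^ k" by (auto simp: p_element_def)
    have "\<psi> h \<in> cyclotomic_field (p ^ k)"
      using H.pow_ord_eq_1[OF k(1)] k p0 by (intro Irr_value_mem[OF NS(1) \<psi>]) auto
    moreover obtain m where m: "f = p ^ b * m" "\<not> p dvd m"
      using multiplicity_decompose'[of f p] cond(1) p(1) unfolding b_def
      by (metis neq0_conv not_prime_unit)
    moreover have "m > 0" using m cond(1) by (auto intro: Nat.gr0I)
    ultimately have "\<psi> h \<in> cyclotomic_field (p ^ b)"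
      using cyclotomic_field_prime_power_Int[OF p(1), of b m "\<psi> h" k] b2 cond(2)[OF k(1)] by simp
    hence "\<not> p dvd field_degree (cyclotomic_field (p ^ b)) (rat_adjoin {\<psi> h})"
      using c(2) by (intro prime_not_dvd_field_degree[OF p b2]) (simp_all add: h_def)
    thus ?thesis
      unfolding property_1_3_witness_def f_def[symmetric] part using elem k(1) by blast
  qed
qed

end
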